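(* Let $Q$ be a finite quiver without oriented cycles and $\beta$ a dimension vector of $Q$. Suppose that $\mathrm{SI}_\beta(Q)$ is a naturally graded upper cluster algebra $\overline{\mathcal C}(\Delta,\mathbf x;\boldsymbol\sigma)$ and that $B(\Delta)$ has full rank. Let $r$ be a vertex of $Q$ satisfying $$\min\Big(\sum_{h(a)=r}\beta(t(a)),\ \sum_{t(b)=r}\beta(h(b))\Big)\le\beta(r),$$ and suppose that $\boldsymbol\sigma(v)(r)=0$ for all $v\in\Delta_0$ except for a set $\mathbf v$ of frozen vertices, where either all $\boldsymbol\sigma(v)(r)<0$ or all $\boldsymbol\sigma(v)(r)>0$ ($v\in\mathbf v$). Then $\mathrm{SI}_{\overline\beta}(\overline Q)$ is the naturally graded upper cluster algebra $\overline{\mathcal C}(\Delta_{\mathbf v}^{\mathbf u},\mathbf x(\hat{\mathbf v});\boldsymbol\sigma(\hat{\mathbf v}))$, where $\mathbf u$ is attached to $\mathbf v$.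
   Context: The base field $k$ is algebraically closed of characteristic zero. **Upper cluster algebras.** An ice quiver $\Delta$ is a finite quiver without loops or oriented 2-cycles whose vertices $1,\dots,q$ are divided into mutable ones ($1,\dots,p$) and frozen ones ($p+1,\dots,q$). Its $B$-matrix is the $p\times q$ matrix $b_{u,v}=\#\{u\to v\}-\#\{v\to u\}$; full rank means rank $p$. A seed $(\Delta,\mathbf x)$ in a field $\mathcal F\supset k$ consists of an ice quiver and a family $\mathbf x=(x_v)_{v\in\Delta_0}$ (also written $\mathbf x(v)$) of elements algebraically independent over $k$. Mutation $\mu_u$ at a mutable vertex $u$ is the usual Fomin-Zelevinsky mutation (no arrows are created between frozen vertices), with exchange relation $x_ux_u'=\prod_{v\to u}x_v+\prod_{u\to w}x_w$. Put $\mathcal L_{\mathbf x}=k[x_1^{\pm1},\dots,x_p^{\pm1},x_{p+1},\dots,x_q]$ (frozen variables are not inverted). The upper cluster algebra (UCA) is $\overline{\mathcal C}(\Delta,\mathbf x)=\bigcap\mathcal L_{\mathbf x^\dagger}$ over all seeds $(\Delta^\dagger,\mathbf x^\dagger)$ mutation-equivalent to $(\Delta,\mathbf x)$. **Gradings.** A weight configuration $\boldsymbol\sigma$ on $\Delta$ assigns to each vertex $v$ a vector $\boldsymbol\sigma(v)$ in a lattice $\mathbb L$ with $\sum_{v\to u}\boldsymbol\sigma(v)=\sum_{u\to w}\boldsymbol\sigma(w)$ for every mutable $u$. Setting $\deg x_v=\boldsymbol\sigma(v)$ grades the UCA, written $\overline{\mathcal C}(\Delta,\mathbf x;\boldsymbol\sigma)$.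 **Semi-invariants.** $\mathrm{Rep}_\beta(Q)=\bigoplus_{a\in Q_1}\mathrm{Hom}(k^{\beta(t(a))},k^{\beta(h(a))})$ ($t$, $h$ denote tail and head) is acted on by $\mathrm{GL}_\beta=\prod_i\mathrm{GL}_{\beta(i)}$ by base change, and $\mathrm{SI}_\beta(Q)=k[\mathrm{Rep}_\beta(Q)]^{\mathrm{SL}_\beta}$ with $\mathrm{SL}_\beta=\prod_i\mathrm{SL}_{\beta(i)}$. It is graded by weights in $\mathbb L=\mathbb Z^{Q_0}$: $\mathrm{SI}_\beta(Q)_\sigma$ consists of the $f$ with $f(g\cdot M)=\prod_i\det(g(i))^{\sigma(i)}f(M)$ for all $g\in\mathrm{GL}_\beta$. It is a *naturally graded* UCA $\overline{\mathcal C}(\Delta,\mathbf x;\boldsymbol\sigma)$ if the two algebras are isomorphic and, under the isomorphism, $\boldsymbol\sigma(v)\in\mathbb Z^{Q_0}$ is the weight of the semi-invariant $\mathbf x(v)$ for each $v$. **Vertex removal.** $\overline Q$ has vertices $Q_0\setminus\{r\}$ and arrows obtained from $Q_1$ by removing all arrows incident to $r$ and adding an arrow $[ab]:t(a)\to h(b)$ for each pair of arrows $a,b$ of $Q$ with $h(a)=t(b)=r$. $\overline\beta$ is the restriction of $\beta$ to $Q_0\setminus\{r\}$. **Deleting and freezing.** For a set $\mathbf v$ of frozen vertices of $\Delta$, the set $\mathbf u$ attached to $\mathbf v$ is the set of all mutable vertices of $\Delta$ joined by an arrow (in either direction) to some vertex of $\mathbf v$. $\Delta_{\mathbf v}^{\mathbf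 u}$ is the ice quiver obtained from $\Delta$ by deleting the vertices in $\mathbf v$ and making the vertices in $\mathbf u$ frozen. $\mathbf x(\hat{\mathbf v})$ and $\boldsymbol\sigma(\hat{\mathbf v})$ are the restrictions of $\mathbf x$ and $\boldsymbol\sigma$ to $\Delta_0\setminus\mathbf v$; the weights $\boldsymbol\sigma(v)$, $v\notin\mathbf v$, have zero $r$-coordinate and are viewed in $\mathbb Z^{Q_0\setminus\{r\}}$.
   Formalization: At vertices i with β(i)=0 the weight of a semi-invariant is not determined; the formal notion of naturally graded UCA normalises σ(v)(i)=0 there, in hypothesis and conclusion, since otherwise the claim fails when β(r)=0. *)

theory Defs
  imports
    "HOL-Library.Poly_Mapping"
    "HOL-Computational_Algebra.Polynomial"
    "HOL-Algebra.Generated_Rings"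
    "Jordan_Normal_Form.Determinant"
    "Jordan_Normal_Form.DL_Rank"
    "Graph_Theory.Arc_Walk"
begin

section \<open>Quivers and semi-invariants\<close>

text \<open>
  A quiver is a \<^type>\<open>pre_digraph\<close> (finite quiver: \<^locale>\<open>fin_digraph\<close>), so loops and parallel
  arrows are possible.  A dimension vector is a function to \<^typ>\<open>nat\<close> of which only the values on
  the vertices matter.
\<close>

definition acyclic_quiver :: "('q, 'a) pre_digraph \<Rightarrow> bool" where
  "acyclic_quiver Q \<longleftrightarrow> fin_digraph Q \<and> (\<nexists>p. pre_digraph.cycle Q p)"

definition Rep :: "('q, 'a) pre_digraph \<Rightarrow> ('q \<Rightarrow> nat) \<Rightarrow> ('a \<Rightarrow> 'k::field mat) set" where
  "Rep Q \<beta> = (\<Pi>\<^sub>E a\<in>arcs Q. carrier_mat (\<beta> (head Q a)) (\<beta> (tail Q a)))"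

definition GL :: "('q, 'a) pre_digraph \<Rightarrow> ('q \<Rightarrow> nat) \<Rightarrow> ('q \<Rightarrow> 'k::field mat) set" where
  "GL Q \<beta> = (\<Pi>\<^sub>E i\<in>verts Q. Units (ring_mat TYPE('k) (\<beta> i) ()))"

definition SL :: "('q, 'a) pre_digraph \<Rightarrow> ('q \<Rightarrow> nat) \<Rightarrow> ('q \<Rightarrow> 'k::field mat) set" where
  "SL Q \<beta> = {g \<in> GL Q \<beta>. \<forall>i\<in>verts Q. det (g i) = 1}"

definition base_change ::
  "('q, 'a) pre_digraph \<Rightarrow> ('q \<Rightarrow> nat) \<Rightarrow> ('q \<Rightarrow> 'k::field mat) \<Rightarrow> ('a \<Rightarrow> 'k mat) \<Rightarrow> ('a \<Rightarrow> 'k mat)" where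
  "base_change Q \<beta> g M =
     (\<lambda>a\<in>arcs Q. g (head Q a) * M a * inv\<^bsub>ring_mat TYPE('k) (\<beta> (tail Q a)) ()\<^esub> (g (tail Q a)))"

definition fun_ring :: "'s set \<Rightarrow> ('s \<Rightarrow> 'k::comm_ring_1) ring" where
  "fun_ring S = \<lparr> carrier = S \<rightarrow>\<^sub>E UNIV,
     mult = (\<lambda>f g. \<lambda>s\<in>S. f s * g s), one = (\<lambda>s\<in>S. 1),
     zero = (\<lambda>s\<in>S. 0), add = (\<lambda>f g. \<lambda>s\<in>S. f s + g s) \<rparr>"

text \<open>
  The coordinate ring of the affine space \<^term>\<open>Rep Q \<beta>\<close>, as its ring of polynomial functions:
  the subalgebra of all functions generated by the matrix entries.  Over an infinite field this
  is the polynomial ring in the matrix entries.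
\<close>

definition poly_funs ::
  "('q, 'a) pre_digraph \<Rightarrow> ('q \<Rightarrow> nat) \<Rightarrow> (('a \<Rightarrow> 'k::field mat) \<Rightarrow> 'k) set" where
  "poly_funs Q \<beta> = generate_ring (fun_ring (Rep Q \<beta>))
     (range (\<lambda>c. \<lambda>M\<in>Rep Q \<beta>. c) \<union>
      {\<lambda>M\<in>Rep Q \<beta>. M a $$ (i, j) | a i j. a \<in> arcs Q \<and> i < \<beta> (head Q a) \<and> j < \<beta> (tail Q a)})"

definition SI :: "('q, 'a) pre_digraph \<Rightarrow> ('q \<Rightarrow> nat) \<Rightarrow> (('a \<Rightarrow> 'k::field mat) \<Rightarrow> 'k) ring" where
  "SI Q \<beta> = (fun_ring (Rep Q \<beta>))
     \<lparr> carrier := {f \<in> poly_funs Q \<beta>. \<forall>g\<in>SL Q \<beta>. \<forall>M\<in>Rep Q \<beta>. f (base_change Q \<beta> g M) = f M} \<rparr>"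

definition SI_weight ::
  "('q, 'a) pre_digraph \<Rightarrow> ('q \<Rightarrow> nat) \<Rightarrow> ('q \<Rightarrow> int) \<Rightarrow> (('a \<Rightarrow> 'k::field mat) \<Rightarrow> 'k) set" where
  "SI_weight Q \<beta> \<sigma> = {f \<in> carrier (SI Q \<beta>). \<forall>g\<in>GL Q \<beta>. \<forall>M\<in>Rep Q \<beta>.
     f (base_change Q \<beta> g M) = (\<Prod>i\<in>verts Q. det (g i) powi \<sigma> i) * f M}"

text \<open>Removal of a vertex \<open>r\<close>: the arrow \<open>Inr (a, b)\<close> is the composite \<open>[ab]\<close> through \<open>r\<close>.\<close>

definition remove_vertex :: "('q, 'a) pre_digraph \<Rightarrow> 'q \<Rightarrow> ('q, 'a + 'a \<times> 'a) pre_digraph" where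
  "remove_vertex Q r = \<lparr>
     verts = verts Q - {r},
     arcs = Inl ` {a \<in> arcs Q. tail Q a \<noteq> r \<and> head Q a \<noteq> r} \<union>
            Inr ` ({a \<in> arcs Q. head Q a = r} \<times> {b \<in> arcs Q. tail Q b = r}),
     tail = case_sum (tail Q) (\<lambda>(a, b). tail Q a),
     head = case_sum (head Q) (\<lambda>(a, b). head Q b) \<rparr>"


section \<open>Ice quivers, seeds and mutation\<close>

text \<open>\<open>narrows \<Delta> u v\<close> is the number of arrows from \<open>u\<close> to \<open>v\<close>.\<close>

record 'v ice_quiver =
  nodes :: "'v set"
  mutables :: "'v set"
  narrows :: "'v \<Rightarrow> 'v \<Rightarrow> nat"

definition is_ice_quiver :: "'v ice_quiver \<Rightarrow> bool" where
  "is_ice_quiver \<Delta> \<longleftrightarrow> finite (nodes \<Delta>) \<and> mutables \<Delta> \<subseteq> nodes \<Delta> \<and>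
     (\<forall>u v. narrows \<Delta> u v > 0 \<longrightarrow> u \<in> nodes \<Delta> \<and> v \<in> nodes \<Delta>) \<and>
     (\<forall>u. narrows \<Delta> u u = 0) \<and>
     (\<forall>u v. narrows \<Delta> u v = 0 \<or> narrows \<Delta> v u = 0)"

text \<open>Rows are indexed by the mutable vertices and columns by all vertices, in increasing order.\<close>

definition B_matrix :: "'v::linorder ice_quiver \<Rightarrow> rat mat" where
  "B_matrix \<Delta> = mat (card (mutables \<Delta>)) (card (nodes \<Delta>)) (\<lambda>(i, j).
     let u = sorted_list_of_set (mutables \<Delta>) ! i; v = sorted_list_of_set (nodes \<Delta>) ! j
     in of_nat (narrows \<Delta> u v) - of_nat (narrows \<Delta> v u))"

definition full_rank :: "'v::linorder ice_quiver \<Rightarrow> bool" where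
  "full_rank \<Delta> \<longleftrightarrow> vec_space.rank (card (mutables \<Delta>)) (B_matrix \<Delta>) = card (mutables \<Delta>)"

text \<open>
  Mutation at \<open>u\<close>: the arrows at \<open>u\<close> are reversed; elsewhere a composite arrow is added for each
  path \<open>v \<rightarrow> u \<rightarrow> w\<close> unless \<open>v\<close> and \<open>w\<close> are both frozen, and then 2-cycles are cancelled, which is
  the effect of the truncated subtraction.
\<close>

definition mutate_quiver :: "'v \<Rightarrow> 'v ice_quiver \<Rightarrow> 'v ice_quiver" where
  "mutate_quiver u \<Delta> = \<Delta> \<lparr> narrows := (\<lambda>v w.
     if v = u \<or> w = u then narrows \<Delta> w v
     else let n = (\<lambda>y z. narrows \<Delta> y z +
                (if y \<in> mutables \<Delta> \<or> z \<in> mutables \<Delta> then narrows \<Delta> y u * narrows \<Delta> u z else 0))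
          in n v w - n w v) \<rparr>"

text \<open>
  An extended cluster is a function on vertices of which only the values on
  \<^const>\<open>nodes\<close> matter.
\<close>

definition mutate_cluster :: "'v \<Rightarrow> 'v ice_quiver \<Rightarrow> ('v \<Rightarrow> 'f::field) \<Rightarrow> ('v \<Rightarrow> 'f)" where
  "mutate_cluster u \<Delta> x = x(u :=
     ((\<Prod>v\<in>nodes \<Delta>. x v ^ narrows \<Delta> v u) + (\<Prod>w\<in>nodes \<Delta>. x w ^ narrows \<Delta> u w)) / x u)"

text \<open>
  The field \<open>\<F> \<supseteq> k\<close> is a type of class \<^class>\<open>field\<close> together with an embedding
  \<open>\<iota>\<close> of the base field.
\<close>

definition alg_independent ::
  "('k::field \<Rightarrow> 'f::field) \<Rightarrow> 'v set \<Rightarrow> ('v \<Rightarrow> 'f) \<Rightarrow> bool" where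
  "alg_independent \<iota> V x \<longleftrightarrow> (\<forall>P :: ('v \<Rightarrow>\<^sub>0 nat) \<Rightarrow>\<^sub>0 'k.
     (\<forall>m\<in>Poly_Mapping.keys P. Poly_Mapping.keys m \<subseteq> V) \<longrightarrow>
     (\<Sum>m\<in>Poly_Mapping.keys P. \<iota> (Poly_Mapping.lookup P m) *
        (\<Prod>v\<in>Poly_Mapping.keys m. x v ^ Poly_Mapping.lookup m v)) = 0 \<longrightarrow> P = 0)"

definition is_seed :: "('k::field \<Rightarrow> 'f::field) \<Rightarrow> 'v ice_quiver \<Rightarrow> ('v \<Rightarrow> 'f) \<Rightarrow> bool" where
  "is_seed \<iota> \<Delta> x \<longleftrightarrow> is_ice_quiver \<Delta> \<and> alg_independent \<iota> (nodes \<Delta>) x"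

text \<open>Mutations of seeds are involutions, so closing under forward steps yields an equivalence.\<close>

inductive mutation_equivalent ::
  "'v ice_quiver \<Rightarrow> ('v \<Rightarrow> 'f::field) \<Rightarrow> 'v ice_quiver \<Rightarrow> ('v \<Rightarrow> 'f) \<Rightarrow> bool" for \<Delta> x where
  refl: "mutation_equivalent \<Delta> x \<Delta> x"
| step: "mutation_equivalent \<Delta> x \<Delta>' x' \<Longrightarrow> u \<in> mutables \<Delta>' \<Longrightarrow>
    mutation_equivalent \<Delta> x (mutate_quiver u \<Delta>') (mutate_cluster u \<Delta>' x')"

definition laurent_ring ::
  "('k::field \<Rightarrow> 'f::field) \<Rightarrow> 'v ice_quiver \<Rightarrow> ('v \<Rightarrow> 'f) \<Rightarrow> 'f set" where
  "laurent_ring \<iota> \<Delta> x =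
     generate_ring class_ring (range \<iota> \<union> x ` nodes \<Delta> \<union> (\<lambda>v. inverse (x v)) ` mutables \<Delta>)"

definition UCA :: "('k::field \<Rightarrow> 'f::field) \<Rightarrow> 'v ice_quiver \<Rightarrow> ('v \<Rightarrow> 'f) \<Rightarrow> 'f ring" where
  "UCA \<iota> \<Delta> x = class_ring
     \<lparr> carrier := \<Inter> {laurent_ring \<iota> \<Delta>' x' | \<Delta>' x'. mutation_equivalent \<Delta> x \<Delta>' x'} \<rparr>"


section \<open>Gradings\<close>

text \<open>
  Weight configuration with values in the lattice of integer vectors indexed by \<open>I\<close>; restricting
  \<open>I\<close> amounts to forgetting coordinates.
\<close>

definition weight_config :: "'q set \<Rightarrow> 'v ice_quiver \<Rightarrow> ('v \<Rightarrow> 'q \<Rightarrow> int) \<Rightarrow> bool" where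
  "weight_config I \<Delta> \<sigma> \<longleftrightarrow> (\<forall>u\<in>mutables \<Delta>. \<forall>i\<in>I.
     (\<Sum>v\<in>nodes \<Delta>. int (narrows \<Delta> v u) * \<sigma> v i) = (\<Sum>w\<in>nodes \<Delta>. int (narrows \<Delta> u w) * \<sigma> w i))"

text \<open>
  \<open>SI Q \<beta>\<close> is the naturally graded upper cluster algebra of the seed \<open>(\<Delta>, x)\<close> with weights \<open>\<sigma>\<close>.
  At a vertex \<open>i\<close> with \<open>\<beta> i = 0\<close> the group is trivial and the condition defining \<^const>\<open>SI_weight\<close>
  does not see the \<open>i\<close>-coordinate.  There ``the weight'' of a semi-invariant is normalised to be
  \<open>0\<close>; otherwise it would not be well defined and the weight spaces would not form a grading.
\<close>

definition naturally_graded_UCA ::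
  "('q, 'a) pre_digraph \<Rightarrow> ('q \<Rightarrow> nat) \<Rightarrow> ('k::field \<Rightarrow> 'f::field) \<Rightarrow>
   'v ice_quiver \<Rightarrow> ('v \<Rightarrow> 'f) \<Rightarrow> ('v \<Rightarrow> 'q \<Rightarrow> int) \<Rightarrow> bool" where
  "naturally_graded_UCA Q \<beta> \<iota> \<Delta> x \<sigma> \<longleftrightarrow>
     is_seed \<iota> \<Delta> x \<and> weight_config (verts Q) \<Delta> \<sigma> \<and>
     (\<forall>v\<in>nodes \<Delta>. \<forall>i\<in>verts Q. \<beta> i = 0 \<longrightarrow> \<sigma> v i = 0) \<and>
     (\<exists>\<phi> \<in> ring_iso (UCA \<iota> \<Delta> x) (SI Q \<beta>).
        (\<forall>c. \<phi> (\<iota> c) = (\<lambda>M\<in>Rep Q \<beta>. c)) \<and>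
        (\<forall>v\<in>nodes \<Delta>. \<phi> (x v) \<in> SI_weight Q \<beta> (\<sigma> v)))"


section \<open>Deleting and freezing\<close>

definition attached :: "'v ice_quiver \<Rightarrow> 'v set \<Rightarrow> 'v set" where
  "attached \<Delta> vs = {u \<in> mutables \<Delta>. \<exists>v\<in>vs. narrows \<Delta> u v > 0 \<or> narrows \<Delta> v u > 0}"

definition delete_freeze :: "'v ice_quiver \<Rightarrow> 'v set \<Rightarrow> 'v set \<Rightarrow> 'v ice_quiver" where
  "delete_freeze \<Delta> vs us = \<lparr>
     nodes = nodes \<Delta> - vs,
     mutables = mutables \<Delta> - vs - us,
     narrows = (\<lambda>y z. if y \<in> vs \<or> z \<in> vs then 0 else narrows \<Delta> y z) \<rparr>"

end

theory Submission
  imports Defs "HOL-Library.Function_Algebras" "Jordan_Normal_Form.Char_Poly"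
begin

text \<open>
  Both algebras are identified with the same subalgebra of \<open>SI Q \<beta>\<close>, the functions that are also
  invariant under the full group \<open>GL\<close> at \<open>r\<close>.

  On the side of representations, composing arrows through \<open>r\<close> maps \<open>Rep Q \<beta>\<close> to the representations
  of the quiver without \<open>r\<close>.  A polynomial function \<open>f\<close> of the incoming maps \<open>A\<close> and outgoing maps
  \<open>B\<close> at \<open>r\<close> that is invariant under \<open>GL\<close> at \<open>r\<close> satisfies \<open>f (h A, B) = f (A, B h)\<close> for invertible
  \<open>h\<close>, hence by density for all square \<open>h\<close>.  By the dimension hypothesis \<open>A = h E\<close> with a fixed
  injection \<open>E\<close> (or dually \<open>B = F h\<close>), so \<open>f (A, B) = f (E, B h)\<close> depends polynomially on \<open>B A\<close> only.

  On the cluster side, a matrix of determinant \<open>t\<close> at \<open>r\<close> rescales the initial variable \<open>x v\<close> by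
  \<open>t\<close> to the power \<open>\<sigma> v r\<close>, so invariance means that the initial Laurent expansion has degree 0
  in the variables \<open>vs\<close>.  Such elements have the required Laurent expansions in all seeds of the
  smaller quiver: at an attached vertex both terms of the exchange polynomial involve \<open>vs\<close>, which
  rules out negative powers of the frozen variable there.  Conversely, an element of the smaller
  upper cluster algebra is Laurent in the initial seed of \<open>\<Delta>\<close> and all adjacent ones, and for full
  rank this suffices for all seeds (the upper bound theorem of Berenstein, Fomin and Zelevinsky).
\<close>

section \<open>Spans of Laurent monomials\<close>

text \<open>For matching seeds, the Laurent rings of the two cluster algebras differ only in which
  exponents may occur: 0 at \<open>vs\<close> and nonnegative at the newly frozen vertices. Rings in
  the cluster part are therefore treated as spans of monomials with exponents in a given set, and
  the recurring argument is that a nonzero factor that is neutral for a condition on exponents can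
  be cancelled without losing the condition. Full rank acts through two consequences: rows are
  pairwise non-proportional, which makes exchange polynomials coprime, and independence of rows
  survives mutation, so that comparing a seed with its neighbours can be iterated. The sign
  hypothesis on the weights is used twice. Balance of weights forces arrows from \<open>vs\<close>
  to every attached vertex and back, and since exponents at frozen vertices are nonnegative, total
  degree 0 means exponent 0 at each vertex of \<open>vs\<close>. On the side of representations, the
  composition map has a polynomial section that is not equivariant; equivariance is regained only
  after applying an invariant function.\<close>

lemma class_ring_generate_induct [consumes 1, case_names one incl uminus add mult]:
  assumes "h \<in> generate_ring (class_ring :: 'a::field ring) H"
    and "P 1" "\<And>h. h \<in> H \<Longrightarrow> P h" "\<And>h. P h \<Longrightarrow> P (- h)"
    and "\<And>h g. P h \<Longrightarrow> P g \<Longrightarrow> P (h + g)" "\<And>h g. P h \<Longrightarrow> P g \<Longrightarrow> P (h * g)"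
  shows "P (h :: 'a)"
  using assms(1) by (induction rule: generate_ring.induct) (auto simp: assms(2-) class_ring_simps)

abbreviation (input) keys :: "('a \<Rightarrow>\<^sub>0 'b::zero) \<Rightarrow> 'a set" where "keys \<equiv> Poly_Mapping.keys"
abbreviation (input) lookup :: "('a \<Rightarrow>\<^sub>0 'b::zero) \<Rightarrow> 'a \<Rightarrow> 'b" where "lookup \<equiv> Poly_Mapping.lookup"
abbreviation (input) single :: "'a \<Rightarrow> 'b \<Rightarrow> 'a \<Rightarrow>\<^sub>0 'b::zero" where "single \<equiv> Poly_Mapping.single"

text \<open>A predicate on sets, so that a Laurent ring, a localization or a span of monomials can
  be the target of \<open>generate_ring_least\<close> without being packaged as a ring
  record.\<close>

definition subring_set :: "'a::comm_ring_1 set \<Rightarrow> bool" where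
  "subring_set R \<longleftrightarrow> 1 \<in> R \<and> (\<forall>a\<in>R. - a \<in> R) \<and> (\<forall>a\<in>R. \<forall>b\<in>R. a + b \<in> R \<and> a * b \<in> R)"

lemma
  assumes "subring_set R"
  shows subring_set_one: "1 \<in> R"
    and subring_set_zero: "0 \<in> R"
    and subring_set_uminus: "a \<in> R \<Longrightarrow> - a \<in> R"
    and subring_set_add: "a \<in> R \<Longrightarrow> b \<in> R \<Longrightarrow> a + b \<in> R"
    and subring_set_diff: "a \<in> R \<Longrightarrow> b \<in> R \<Longrightarrow> a - b \<in> R"
    and subring_set_mult: "a \<in> R \<Longrightarrow> b \<in> R \<Longrightarrow> a * b \<in> R"
    and subring_set_power: "a \<in> R \<Longrightarrow> a ^ n \<in> R"
    and subring_set_sum: "(\<And>i. i \<in> I \<Longrightarrow> f i \<in> R) \<Longrightarrow> sum f I \<in> R"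
    and subring_set_prod: "(\<And>i. i \<in> I \<Longrightarrow> f i \<in> R) \<Longrightarrow> prod f I \<in> R"
proof -
  show one: "1 \<in> R" and um: "a \<in> R \<Longrightarrow> - a \<in> R" and add: "a \<in> R \<Longrightarrow> b \<in> R \<Longrightarrow> a + b \<in> R"
    and mult: "a \<in> R \<Longrightarrow> b \<in> R \<Longrightarrow> a * b \<in> R" for a b
    using assms by (auto simp: subring_set_def)
  show zero: "0 \<in> R" using add[OF one um[OF one]] by simp
  show "a \<in> R \<Longrightarrow> b \<in> R \<Longrightarrow> a - b \<in> R" using add[of a "- b"] um[of b] by simp
  show "a \<in> R \<Longrightarrow> a ^ n \<in> R" by (induction n) (auto intro: one mult)
  show "(\<And>i. i \<in> I \<Longrightarrow> f i \<in> R) \<Longrightarrow> sum f I \<in> R"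
    by (induction I rule: infinite_finite_induct) (auto intro: zero add)
  show "(\<And>i. i \<in> I \<Longrightarrow> f i \<in> R) \<Longrightarrow> prod f I \<in> R"
    by (induction I rule: infinite_finite_induct) (auto intro: one mult)
qed

lemma subring_set_generate: "subring_set (generate_ring (class_ring :: 'a::field ring) H)"
  using generate_ring.intros[where R = "class_ring" and H = H]
  by (auto simp: subring_set_def class_ring_simps)

lemma generate_ring_least:
  assumes "subring_set R" "H \<subseteq> R"
  shows "generate_ring (class_ring :: 'a::field ring) H \<subseteq> R"
proof
  fix h assume "h \<in> generate_ring (class_ring :: 'a ring) H"
  then show "h \<in> R"
    using assms by (induction rule: class_ring_generate_induct) (auto simp: subring_set_def)
qed

text \<open>
  The value of an exponent vector outside \<open>V\<close> does not affect \<open>lmon V x\<close>, so uniqueness of Laurent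
  expansions only holds for exponents in \<open>exps V\<close>.
\<close>

definition exps :: "'v set \<Rightarrow> ('v \<Rightarrow> int) set" where
  "exps V = {n. \<forall>v. v \<notin> V \<longrightarrow> n v = 0}"

definition lmon :: "'v set \<Rightarrow> ('v \<Rightarrow> 'f::field) \<Rightarrow> ('v \<Rightarrow> int) \<Rightarrow> 'f" where
  "lmon V x n = (\<Prod>v\<in>V. x v powi n v)"

definition leval ::
  "('k::field \<Rightarrow> 'f::field) \<Rightarrow> 'v set \<Rightarrow> ('v \<Rightarrow> 'f) \<Rightarrow> (('v \<Rightarrow> int) \<Rightarrow>\<^sub>0 'k) \<Rightarrow> 'f" where
  "leval \<iota> V x p = (\<Sum>n\<in>keys p. \<iota> (lookup p n) * lmon V x n)"

text \<open>Laurent rings, graded components and positivity conditions are all spans of this form,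
  for different exponent sets \<open>E\<close>.\<close>

definition lspan ::
  "('k::field \<Rightarrow> 'f::field) \<Rightarrow> 'v set \<Rightarrow> ('v \<Rightarrow> 'f) \<Rightarrow> ('v \<Rightarrow> int) set \<Rightarrow> 'f set" where
  "lspan \<iota> V x E = leval \<iota> V x ` {p. keys p \<subseteq> E}"

lemma poly_mapping_sum_single:
  "p = (\<Sum>n\<in>keys p. single n (lookup p n))"
  by (rule poly_mapping_eqI) (simp add: lookup_sum lookup_single when_def in_keys_iff)

locale laurent =
  fixes \<iota> :: "'k::field \<Rightarrow> 'f::field" and V :: "'v set" and x :: "'v \<Rightarrow> 'f"
  assumes hom: "field_hom \<iota>" and fin: "finite V" and nz: "\<And>v. v \<in> V \<Longrightarrow> x v \<noteq> 0"
    and indep: "\<And>p. keys p \<subseteq> exps V \<Longrightarrow> leval \<iota> V x p = 0 \<Longrightarrow> p = 0"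
begin

sublocale field_hom \<iota> by (rule hom)

abbreviation "mn \<equiv> lmon V x"
abbreviation "ev \<equiv> leval \<iota> V x"
abbreviation "Sp \<equiv> lspan \<iota> V x"

lemma mon_zero: "mn 0 = 1" by (simp add: lmon_def)

lemma mon_add: "mn (m + n) = mn m * mn n"
  unfolding lmon_def prod.distrib[symmetric] by (rule prod.cong) (auto simp: power_int_add nz)

lemma mon_nonzero: "mn n \<noteq> 0"
  using nz fin by (simp add: lmon_def)

lemma ev_superset:
  assumes "finite S" "keys p \<subseteq> S"
  shows "ev p = (\<Sum>n\<in>S. \<iota> (lookup p n) * mn n)"
  unfolding leval_def using assms
  by (intro sum.mono_neutral_left) (auto simp: in_keys_iff)

lemma ev_zero: "ev 0 = 0" by (simp add: leval_def)

lemma ev_add: "ev (p + q) = ev p + ev q"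
proof -
  let ?S = "keys p \<union> keys q"
  have "ev (p + q) = (\<Sum>n\<in>?S. \<iota> (lookup (p + q) n) * mn n)"
    using Poly_Mapping.keys_add[of p q] by (intro ev_superset) auto
  also have "\<dots> = ev p + ev q"
    by (simp add: ev_superset[of ?S p] ev_superset[of ?S q] lookup_add hom_add distrib_right sum.distrib)
  finally show ?thesis .
qed

lemma ev_uminus: "ev (- p) = - ev p"
  using ev_add[of p "- p"] by (simp add: ev_zero eq_neg_iff_add_eq_0 add.commute)

lemma ev_diff: "ev (p - q) = ev p - ev q"
  using ev_add[of p "- q"] by (simp add: ev_uminus)

lemma ev_sum: "ev (sum f I) = (\<Sum>i\<in>I. ev (f i))"
  by (induction I rule: infinite_finite_induct) (auto simp: ev_zero ev_add)

lemma ev_single: "ev (single n c) = \<iota> c * mn n"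
  by (cases "c = 0") (auto simp: leval_def)

lemma ev_mult: "ev (p * q) = ev p * ev q"
proof -
  have "ev (p * q) = ev ((\<Sum>n\<in>keys p. single n (lookup p n)) *
    (\<Sum>n\<in>keys q. single n (lookup q n)))"
    using poly_mapping_sum_single[of p] poly_mapping_sum_single[of q] by simp
  also have "\<dots> = ev p * ev q"
    unfolding sum_product ev_sum mult_single ev_single hom_mult mon_add
    by (simp add: leval_def[of \<iota> V x p] leval_def[of \<iota> V x q] sum_product algebra_simps)
  finally show ?thesis .
qed

lemma SpI: "keys p \<subseteq> E \<Longrightarrow> ev p \<in> Sp E" by (auto simp: lspan_def)

lemma SpE:
  assumes "f \<in> Sp E"
  obtains p where "keys p \<subseteq> E" "f = ev p"
  using assms by (auto simp: lspan_def)

lemma Sp_mono: "E \<subseteq> F \<Longrightarrow> f \<in> Sp E \<Longrightarrow> f \<in> Sp F"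
  by (auto simp: lspan_def)

lemma Sp_zero: "0 \<in> Sp E" using SpI[of 0 E] by (simp add: ev_zero)

lemma Sp_const_mon: "n \<in> E \<Longrightarrow> \<iota> c * mn n \<in> Sp E"
  using SpI[of "single n c" E] by (auto simp: ev_single split: if_splits)

lemma Sp_mon: "n \<in> E \<Longrightarrow> mn n \<in> Sp E"
  using Sp_const_mon[of n E 1] by simp

lemma Sp_const: "0 \<in> E \<Longrightarrow> \<iota> c \<in> Sp E"
  using Sp_const_mon[of 0 E c] by (simp add: mon_zero)

lemma Sp_add:
  assumes "f \<in> Sp E" "g \<in> Sp E"
  shows "f + g \<in> Sp E"
proof -
  obtain p q where "keys p \<subseteq> E" "f = ev p" "keys q \<subseteq> E" "g = ev q"
    using assms unfolding lspan_def by blast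
  then show ?thesis
    using SpI[OF order_trans[OF Poly_Mapping.keys_add[of p q]], of E] by (simp add: ev_add)
qed

lemma Sp_uminus:
  assumes "f \<in> Sp E"
  shows "- f \<in> Sp E"
proof -
  obtain p where "keys p \<subseteq> E" "f = ev p" using assms by (rule SpE)
  then show ?thesis using SpI[of "- p" E] by (auto simp: ev_uminus in_keys_iff subset_iff)
qed

lemma Sp_sum: "(\<And>i. i \<in> I \<Longrightarrow> f i \<in> Sp E) \<Longrightarrow> sum f I \<in> Sp E"
  by (induction I rule: infinite_finite_induct) (auto intro: Sp_zero Sp_add)

lemma Sp_diff: "f \<in> Sp E \<Longrightarrow> g \<in> Sp E \<Longrightarrow> f - g \<in> Sp E"
  using Sp_add[of f E "- g"] Sp_uminus[of g E] by simp

lemma Sp_mult: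
  assumes "f \<in> Sp A" "g \<in> Sp B" "\<And>m n. m \<in> A \<Longrightarrow> n \<in> B \<Longrightarrow> m + n \<in> C"
  shows "f * g \<in> Sp C"
proof -
  obtain p q where "keys p \<subseteq> A" "f = ev p" "keys q \<subseteq> B" "g = ev q"
    using assms(1,2) unfolding lspan_def by blast
  then show ?thesis
    using SpI[OF order_trans[OF keys_mult[of p q]], of C] assms(3) by (auto simp: ev_mult)
qed

lemma Sp_subring:
  assumes "0 \<in> E" "\<And>m n. m \<in> E \<Longrightarrow> n \<in> E \<Longrightarrow> m + n \<in> E"
  shows "subring_set (Sp E)"
  unfolding subring_set_def using Sp_const[OF assms(1), of 1]
  by (auto intro: Sp_uminus Sp_add Sp_mult[OF _ _ assms(2)])

lemma Sp_split:
  assumes "f \<in> Sp E"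
  obtains g h where "f = g + h" "g \<in> Sp (E \<inter> A)" "h \<in> Sp (E - A)"
proof -
  obtain p where p: "keys p \<subseteq> E" "f = ev p" using assms by (rule SpE)
  have sum_Sp: "(\<Sum>n\<in>S. \<iota> (c n) * mn n) \<in> Sp F" if "S \<subseteq> F" for S F c
    using that by (induction S rule: infinite_finite_induct) (auto intro!: Sp_zero Sp_add Sp_const_mon)
  show ?thesis
  proof (rule that)
    show "f = (\<Sum>n\<in>keys p \<inter> A. \<iota> (lookup p n) * mn n) +
        (\<Sum>n\<in>keys p - A. \<iota> (lookup p n) * mn n)"
      unfolding p(2) leval_def by (rule sum.Int_Diff) simp
  qed (use p(1) in \<open>auto intro!: sum_Sp\<close>)
qed

text \<open>Laurent expansions are unique, so a relation splits along disjoint sets of exponents.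
  This separates components of different degree throughout.\<close>

lemma Sp_unique:
  assumes "g \<in> Sp A" "h \<in> Sp B" "A \<inter> B = {}" "A \<subseteq> exps V" "B \<subseteq> exps V" "g + h = 0"
  shows "g = 0" "h = 0"
proof -
  obtain p q where pq: "keys p \<subseteq> A" "g = ev p" "keys q \<subseteq> B" "h = ev q"
    using assms(1,2) unfolding lspan_def by blast
  have "p + q = 0"
  proof (rule indep)
    show "keys (p + q) \<subseteq> exps V"
      using pq(1,3) assms(4,5) Poly_Mapping.keys_add[of p q] by blast
    show "ev (p + q) = 0" using pq(2,4) assms(6) by (simp add: ev_add)
  qed
  then have "q = - p" by (simp add: eq_neg_iff_add_eq_0 add.commute)
  then have "keys q = keys p" by (auto simp: in_keys_iff)
  then have "keys p = {}" using pq(1,3) assms(3) by blast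
  then show "g = 0" using pq by (simp add: leval_def)
  then show "h = 0" using assms(6) by simp
qed

lemma Sp_disjoint:
  assumes "g \<in> Sp A" "g \<in> Sp B" "A \<inter> B = {}" "A \<subseteq> exps V" "B \<subseteq> exps V"
  shows "g = 0"
  using Sp_unique(1)[OF assms(1) Sp_uminus[OF assms(2)] assms(3-5)] by simp

lemma ev_inj:
  assumes "ev p = ev q" "keys p \<subseteq> exps V" "keys q \<subseteq> exps V"
  shows "p = q"
  using indep[of "p - q"] assms keys_diff[of p q] by (auto simp: ev_diff)

text \<open>Multiplication by \<open>P\<close> shifts exponents by elements of \<open>D\<close>,
  which do not affect \<open>R\<close>. The part of \<open>f\<close> whose exponents violate
  \<open>R\<close> therefore keeps violating it after multiplication by \<open>P ^ N\<close>, and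
  uniqueness of expansions forces it to vanish.\<close>

lemma Sp_cancel_power:
  assumes P: "P \<in> Sp D" "P \<noteq> 0" and f: "f \<in> Sp E" "E \<subseteq> exps V" "P ^ N * f \<in> Sp {n \<in> exps V. R n}"
    and D: "\<And>m n. m \<in> D \<Longrightarrow> n \<in> E \<Longrightarrow> m + n \<in> E" "\<And>m n. m \<in> D \<Longrightarrow> R (m + n) \<longleftrightarrow> R n"
  shows "f \<in> Sp {n \<in> E. R n}"
proof -
  obtain g h where gh: "f = g + h" "g \<in> Sp (E \<inter> {n. R n})" "h \<in> Sp (E - {n. R n})"
    by (rule Sp_split[OF f(1)])
  have power: "P ^ N * k \<in> Sp (E \<inter> {n. Q n})"
    if k: "k \<in> Sp (E \<inter> {n. Q n})" and Q: "\<And>m n. m \<in> D \<Longrightarrow> Q (m + n) \<longleftrightarrow> Q n" for k Q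
  proof (induction N)
    case (Suc N)
    have "P * (P ^ N * k) \<in> Sp (E \<inter> {n. Q n})" by (rule Sp_mult[OF P(1) Suc]) (use D(1) Q in auto)
    then show ?case by (simp add: mult.assoc)
  qed (use k in simp)
  have "P ^ N * f - P ^ N * g \<in> Sp {n \<in> exps V. R n}"
    using f(2) by (intro Sp_diff f(3) Sp_mono[OF _ power[OF gh(2) D(2)]]) auto
  then have "P ^ N * h \<in> Sp {n \<in> exps V. R n}" by (simp add: gh(1) algebra_simps)
  moreover have "P ^ N * h \<in> Sp (E \<inter> {n. \<not> R n})"
    using gh(3) D(2) by (intro power) (auto simp: Diff_eq Collect_neg_eq)
  ultimately have "P ^ N * h = 0" by (rule Sp_disjoint) (use f(2) in auto)
  then show ?thesis using gh P(2) by (simp add: Int_def)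
qed

end

section \<open>Seeds and their Laurent rings\<close>

definition uexp :: "'v \<Rightarrow> int \<Rightarrow> 'v \<Rightarrow> int" where
  "uexp v k = (\<lambda>w. if w = v then k else 0)"

lemma subring_set_power_int_nonneg: "subring_set R \<Longrightarrow> a \<in> R \<Longrightarrow> k \<ge> 0 \<Longrightarrow> a powi k \<in> R"
  by (simp add: power_int_def subring_set_power)

lemma subring_set_power_int_nonpos: "subring_set R \<Longrightarrow> inverse a \<in> R \<Longrightarrow> k \<le> 0 \<Longrightarrow> a powi k \<in> R"
  for a :: "'a::field"
  by (auto simp: power_int_def subring_set_power subring_set_one)

text \<open>For nonzero \<open>P\<close> in a field this is the localization of \<open>R\<close> at
  \<open>P\<close>, phrased without fractions; denominators can then be cleared generator by
  generator.\<close>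

lemma subring_set_localization:
  assumes R: "subring_set R" "P \<in> R"
  shows "subring_set {f. \<exists>N. P ^ N * f \<in> R}"
proof -
  have "\<exists>N. P ^ N * (f + g) \<in> R" "\<exists>N. P ^ N * (f * g) \<in> R" if "P ^ M * f \<in> R" "P ^ N * g \<in> R" for M N f g
  proof -
    have "P ^ N * (P ^ M * f) + P ^ M * (P ^ N * g) \<in> R"
      using R that by (metis subring_set_add subring_set_mult subring_set_power)
    then show "\<exists>N. P ^ N * (f + g) \<in> R" by (intro exI[of _ "M + N"]) (simp add: power_add algebra_simps)
    have "(P ^ M * f) * (P ^ N * g) \<in> R" using R that by (metis subring_set_mult)
    then show "\<exists>N. P ^ N * (f * g) \<in> R" by (intro exI[of _ "M + N"]) (simp add: power_add algebra_simps)
  qed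
  moreover have "\<exists>N. P ^ N * 1 \<in> R" using subring_set_one[OF R(1)] by (intro exI[of _ 0]) simp
  moreover have "P ^ N * f \<in> R \<Longrightarrow> P ^ N * (- f) \<in> R" for N f using subring_set_uminus[OF R(1)] by fastforce
  ultimately show ?thesis unfolding subring_set_def by blast
qed

lemma in_localization: "f \<in> R \<Longrightarrow> f \<in> {f. \<exists>N. P ^ N * f \<in> R}" for P :: "'a::comm_ring_1"
  by (auto intro: exI[of _ 0])

text \<open>Coprimality is expressed as \<open>Q\<close> being a nonzerodivisor modulo
  \<open>P\<close>, so no unique factorization is involved. Each round shows that
  \<open>P ^ Suc M * f\<close> is divisible by \<open>P\<close> in \<open>R\<close>, which lowers
  the exponent by one.\<close>

lemma in_if_coprime_denominators:
  fixes P Q f :: "'a::field"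
  assumes R: "subring_set R" "P \<in> R" "Q \<in> R" "P \<noteq> 0"
    and coprime: "\<And>a c. a \<in> R \<Longrightarrow> c \<in> R \<Longrightarrow> a * Q = P * c \<Longrightarrow> \<exists>d\<in>R. a = P * d"
    and "P ^ M * f \<in> R" "Q ^ N * f \<in> R"
  shows "f \<in> R"
  using assms(6)
proof (induction M)
  case (Suc M)
  have coprime_power: "\<exists>d\<in>R. a = P * d" if "a \<in> R" "c \<in> R" "a * Q ^ k = P * c" for a c k
    using that
  proof (induction k arbitrary: c)
    case (Suc k)
    have "a * Q ^ k \<in> R" using R Suc.prems(1) by (intro subring_set_mult subring_set_power)
    then obtain d where "d \<in> R" "a * Q ^ k = P * d"
      using coprime[of "a * Q ^ k" c] Suc.prems by (auto simp: mult_ac)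
    then show ?case using Suc.IH Suc.prems(1) by blast
  qed auto
  have "P ^ M * (Q ^ N * f) \<in> R" by (rule subring_set_mult[OF R(1) subring_set_power[OF R(1,2)] assms(7)])
  then obtain d where "d \<in> R" "P ^ Suc M * f = P * d"
    using coprime_power[OF Suc.prems, of "P ^ M * (Q ^ N * f)" N] by (auto simp: mult_ac)
  then have "P ^ M * f \<in> R" using R(4) by (simp add: mult.assoc)
  then show ?case by (rule Suc.IH)
qed simp

lemma lmon_upd:
  assumes "finite V" "u \<in> V"
  shows "lmon V (x(u := a)) n = lmon V x (n(u := 0)) * a powi n u"
proof -
  have "lmon V (x(u := a)) n = a powi n u * (\<Prod>v\<in>V - {u}. (x(u := a)) v powi n v)"
    using assms by (simp add: lmon_def prod.remove)
  also have "(\<Prod>v\<in>V - {u}. (x(u := a)) v powi n v) = (\<Prod>v\<in>V - {u}. x v powi (n(u := 0)) v)"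
    by (intro prod.cong) auto
  also have "\<dots> = lmon V x (n(u := 0))"
    using assms by (simp add: lmon_def prod.remove[of V u])
  finally show ?thesis by (simp only: mult.commute)
qed

lemma exponents_bounded_below:
  fixes S :: "('v \<Rightarrow> int) set"
  assumes "finite S" "finite V"
  shows "\<exists>N. \<forall>n\<in>S. \<forall>v\<in>V. n v + N \<ge> 0"
proof (intro exI ballI)
  fix n v assume "n \<in> S" "v \<in> V"
  then have "\<bar>n v\<bar> \<le> (\<Sum>v\<in>V. \<bar>n v\<bar>)" using assms by (intro member_le_sum) auto
  also have "\<dots> \<le> (\<Sum>n\<in>S. \<Sum>v\<in>V. \<bar>n v\<bar>)"
    using \<open>n \<in> S\<close> assms by (intro member_le_sum[of n S "\<lambda>n. \<Sum>v\<in>V. \<bar>n v\<bar>"]) (auto intro: sum_nonneg)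
  finally show "n v + (\<Sum>n\<in>S. \<Sum>v\<in>V. \<bar>n v\<bar>) \<ge> 0" by linarith
qed

context laurent
begin

lemma mon_uexp: "v \<in> V \<Longrightarrow> mn (uexp v k) = x v powi k"
  using fin by (simp add: lmon_def uexp_def if_distrib[of "\<lambda>k. x _ powi k"] prod.delta cong: if_cong)

lemma mon_split: "v \<in> V \<Longrightarrow> mn n = mn (n(v := 0)) * x v powi n v"
  using lmon_upd[OF fin, of v x "x v" n] by simp

lemma mon_in_subring:
  assumes "subring_set R" "\<And>v. v \<in> V \<Longrightarrow> x v powi n v \<in> R"
  shows "mn n \<in> R"
  unfolding lmon_def using assms by (intro subring_set_prod)

lemma Sp_least:
  assumes "subring_set R" "range \<iota> \<subseteq> R" "\<And>n. n \<in> E \<Longrightarrow> mn n \<in> R"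
  shows "Sp E \<subseteq> R"
  using assms unfolding lspan_def leval_def
  by (auto intro!: subring_set_sum subring_set_mult)

text \<open>The reindexing \<open>e\<close> serves mutation, where the exponent at the mutated
  vertex changes sign before monomials are compared.\<close>

lemma linear_independent:
  assumes "finite S" "inj_on e S" "e ` S \<subseteq> exps V" "(\<Sum>n\<in>S. \<iota> (c n) * mn (e n)) = 0" "n \<in> S"
  shows "c n = 0"
proof -
  define q where "q = (\<Sum>n\<in>S. single (e n) (c n))"
  have "ev q = 0" using assms(4) by (simp add: q_def ev_sum ev_single)
  moreover have "keys q \<subseteq> exps V"
    unfolding q_def using assms(3) by (intro order_trans[OF keys_sum]) auto
  ultimately have "q = 0" by (rule indep[rotated])
  moreover have "lookup q (e n) = (\<Sum>m\<in>S. if m = n then c m else 0)"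
    unfolding q_def lookup_sum lookup_single when_def using assms(2,5)
    by (intro sum.cong) (auto simp: inj_on_eq_iff)
  ultimately show ?thesis using assms(1,5) by simp
qed

end

text \<open>Multiplying a Laurent relation by the monomial with all exponents \<open>N\<close> makes
  it polynomial. The shift is injective on exponents supported in \<open>V\<close>, so no two
  coefficients are merged.\<close>

lemma laurent_if_alg_independent:
  fixes \<iota> :: "'k::field \<Rightarrow> 'f::field" and x :: "'v \<Rightarrow> 'f"
  assumes hom: "field_hom \<iota>" and fin: "finite V" and ai: "alg_independent \<iota> V x"
  shows "laurent \<iota> V x"
proof -
  interpret field_hom \<iota> by (rule hom)
  have nz: "x v \<noteq> 0" if "v \<in> V" for v
  proof
    assume "x v = 0"
    then have "single (single v 1) 1 = (0 :: ('v \<Rightarrow>\<^sub>0 nat) \<Rightarrow>\<^sub>0 'k)"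
      using that by (intro ai[unfolded alg_independent_def, rule_format]) auto
    then show False by (metis lookup_single_eq lookup_zero one_neq_zero)
  qed
  show ?thesis
  proof (unfold_locales, rule fin, fact nz)
    fix p assume p: "keys p \<subseteq> exps V" and ev0: "leval \<iota> V x p = 0"
    define S where "S = keys p"
    have "finite S" by (simp add: S_def)
    obtain N where N: "\<And>n v. n \<in> S \<Longrightarrow> v \<in> V \<Longrightarrow> n v + N \<ge> 0"
      using exponents_bounded_below[OF \<open>finite S\<close> fin] by blast
    define e where "e n = Abs_poly_mapping (\<lambda>v. if v \<in> V then nat (n v + N) else 0)" for n :: "'v \<Rightarrow> int"
    have e: "lookup (e n) v = (if v \<in> V then nat (n v + N) else 0)" for n v
      unfolding e_def by (subst lookup_Abs_poly_mapping) (auto intro: finite_subset[OF _ fin])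
    have inj: "inj_on e S"
    proof (rule inj_onI, rule ext)
      fix n m v assume nm: "n \<in> S" "m \<in> S" "e n = e m"
      show "n v = m v"
      proof (cases "v \<in> V")
        case True
        then show ?thesis using nm N[of n v] N[of m v] e[of n v] e[of m v] by simp
      next
        case False
        then show ?thesis using subsetD[OF p, of n] subsetD[OF p, of m] nm by (simp add: S_def exps_def)
      qed
    qed
    define P where "P = (\<Sum>n\<in>S. single (e n) (lookup p n))"
    have lookup_P: "lookup P (e n) = lookup p n" if "n \<in> S" for n
    proof -
      have "lookup P (e n) = (\<Sum>m\<in>S. if m = n then lookup p m else 0)"
        unfolding P_def lookup_sum lookup_single when_def using inj that
        by (intro sum.cong) (auto simp: inj_on_eq_iff)
      then show ?thesis using that \<open>finite S\<close> by simp
    qed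
    have keys_sub: "keys P \<subseteq> e ` S"
      unfolding P_def by (intro order_trans[OF keys_sum]) auto
    have keys_P: "keys P = e ` S"
      using keys_sub lookup_P by (auto simp: in_keys_iff S_def)
    have mon: "(\<Prod>v\<in>keys (e n). x v ^ lookup (e n) v) =
        lmon V x n * (\<Prod>v\<in>V. x v powi N)" if "n \<in> S" for n
    proof -
      have "(\<Prod>v\<in>keys (e n). x v ^ lookup (e n) v) =
          (\<Prod>v\<in>V. x v ^ lookup (e n) v)"
        using fin by (intro prod.mono_neutral_left) (auto simp: in_keys_iff e split: if_splits)
      also have "\<dots> = (\<Prod>v\<in>V. x v powi n v * x v powi N)"
        using N[OF that] nz
        by (intro prod.cong) (auto simp: e power_int_def[of _ "n _ + N"] power_int_add[OF disjI1, symmetric])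
      finally show ?thesis by (simp add: lmon_def prod.distrib)
    qed
    have "P = 0"
    proof (rule ai[unfolded alg_independent_def, rule_format])
      show "keys m \<subseteq> V" if "m \<in> keys P" for m
        using that by (auto simp: keys_P in_keys_iff e split: if_splits)
      have "(\<Sum>m\<in>keys P. \<iota> (lookup P m) *
          (\<Prod>v\<in>keys m. x v ^ lookup m v)) =
        (\<Sum>n\<in>S. \<iota> (lookup p n) * (lmon V x n * (\<Prod>v\<in>V. x v powi N)))"
        unfolding keys_P by (subst sum.reindex[OF inj]) (auto intro!: sum.cong simp: lookup_P mon)
      also have "\<dots> = leval \<iota> V x p * (\<Prod>v\<in>V. x v powi N)"
        by (simp add: leval_def S_def sum_distrib_right mult.assoc)
      finally show "(\<Sum>m\<in>keys P. \<iota> (lookup P m) *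
          (\<Prod>v\<in>keys m. x v ^ lookup m v)) = 0" by (simp add: ev0)
    qed
    then have "S = {}" using keys_P by auto
    then show "p = 0" by (simp add: S_def)
  qed
qed

section \<open>Exchange polynomials and a single mutation\<close>

definition in_exp :: "'v ice_quiver \<Rightarrow> 'v \<Rightarrow> 'v \<Rightarrow> int" where
  "in_exp \<Delta> u = (\<lambda>v. int (narrows \<Delta> v u))"

definition out_exp :: "'v ice_quiver \<Rightarrow> 'v \<Rightarrow> 'v \<Rightarrow> int" where
  "out_exp \<Delta> u = (\<lambda>v. int (narrows \<Delta> u v))"

definition exch :: "'v ice_quiver \<Rightarrow> ('v \<Rightarrow> 'f::field) \<Rightarrow> 'v \<Rightarrow> 'f" where
  "exch \<Delta> x u = lmon (nodes \<Delta>) x (in_exp \<Delta> u) + lmon (nodes \<Delta>) x (out_exp \<Delta> u)"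

definition lexps :: "'v ice_quiver \<Rightarrow> ('v \<Rightarrow> int) set" where
  "lexps \<Delta> = {n \<in> exps (nodes \<Delta>). \<forall>v\<in>nodes \<Delta> - mutables \<Delta>. n v \<ge> 0}"

lemma mutate_cluster_exch: "mutate_cluster u \<Delta> x = x(u := exch \<Delta> x u / x u)"
  by (simp add: mutate_cluster_def exch_def lmon_def in_exp_def out_exp_def)

lemma nodes_mutate [simp]: "nodes (mutate_quiver u \<Delta>) = nodes \<Delta>"
  and mutables_mutate [simp]: "mutables (mutate_quiver u \<Delta>) = mutables \<Delta>"
  by (simp_all add: mutate_quiver_def)

lemma lexps_mutate [simp]: "lexps (mutate_quiver u \<Delta>) = lexps \<Delta>"
  by (simp add: lexps_def)

lemma lexps_exps: "lexps \<Delta> \<subseteq> exps (nodes \<Delta>)" by (auto simp: lexps_def)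

lemma lexps_zero: "0 \<in> lexps \<Delta>" by (auto simp: lexps_def exps_def)

lemma lexps_add: "m \<in> lexps \<Delta> \<Longrightarrow> n \<in> lexps \<Delta> \<Longrightarrow> m + n \<in> lexps \<Delta>"
  by (auto simp: lexps_def exps_def)

lemma is_ice_quiver_mutate:
  assumes "is_ice_quiver \<Delta>" "u \<in> mutables \<Delta>"
  shows "is_ice_quiver (mutate_quiver u \<Delta>)"
proof -
  have *: "narrows \<Delta> v w = 0" if "v \<notin> nodes \<Delta> \<or> w \<notin> nodes \<Delta>" for v w
    using assms(1) that by (auto simp: is_ice_quiver_def)
  have "narrows (mutate_quiver u \<Delta>) v w = 0" if "v \<notin> nodes \<Delta> \<or> w \<notin> nodes \<Delta>" for v w
    using that *[of v] *[of w] *[of w v] *[of v w] *[of v u] *[of u w]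
    by (auto simp: mutate_quiver_def Let_def)
  moreover have "narrows (mutate_quiver u \<Delta>) v v = 0" for v
    using assms by (simp add: mutate_quiver_def Let_def is_ice_quiver_def)
  moreover have "narrows (mutate_quiver u \<Delta>) v w = 0 \<or> narrows (mutate_quiver u \<Delta>) w v = 0" for v w
  proof (cases "v = u \<or> w = u")
    case True
    then show ?thesis using assms by (auto simp: mutate_quiver_def is_ice_quiver_def)
  next
    case False
    then show ?thesis by (simp add: mutate_quiver_def Let_def) linarith
  qed
  ultimately show ?thesis
    using assms(1) unfolding is_ice_quiver_def by (metis nodes_mutate mutables_mutate less_irrefl)
qed

locale seed = laurent \<iota> "nodes \<Delta>" x
  for \<iota> :: "'k::field_char_0 \<Rightarrow> 'f::field" and \<Delta> :: "'v ice_quiver" and x :: "'v \<Rightarrow> 'f" +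
  assumes ice: "is_ice_quiver \<Delta>"
begin

abbreviation "V \<equiv> nodes \<Delta>"
abbreviation "U \<equiv> mutables \<Delta>"

lemma U_sub: "U \<subseteq> V" using ice by (simp add: is_ice_quiver_def)

lemma narrows_self: "narrows \<Delta> v v = 0" using ice by (simp add: is_ice_quiver_def)

lemma narrows_outside: "v \<notin> V \<or> w \<notin> V \<Longrightarrow> narrows \<Delta> v w = 0"
  using ice by (auto simp: is_ice_quiver_def)

lemma narrows_antisym: "narrows \<Delta> v w = 0 \<or> narrows \<Delta> w v = 0"
  using ice by (simp add: is_ice_quiver_def)

lemma in_exp_lexps: "in_exp \<Delta> u \<in> lexps \<Delta>"
  and out_exp_lexps: "out_exp \<Delta> u \<in> lexps \<Delta>"
  using narrows_outside by (auto simp: in_exp_def out_exp_def lexps_def exps_def)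

lemma in_exp_exps: "in_exp \<Delta> u \<in> exps V"
  and out_exp_exps: "out_exp \<Delta> u \<in> exps V"
  using in_exp_lexps out_exp_lexps lexps_exps by blast+

lemma in_exp_self: "in_exp \<Delta> u u = 0" and out_exp_self: "out_exp \<Delta> u u = 0"
  by (simp_all add: in_exp_def out_exp_def narrows_self)

text \<open>For \<open>m = n\<close> the coefficient is 2, so this is a place where the
  characteristic matters; it occurs for the exchange polynomial of an isolated vertex.\<close>

lemma mon_plus_mon_nonzero:
  assumes "m \<in> exps V" "n \<in> exps V"
  shows "mn m + mn n \<noteq> 0"
proof
  let ?p = "single m 1 + single n (1 :: 'k)"
  assume "mn m + mn n = 0"
  then have "ev ?p = 0" by (simp add: ev_add ev_single)
  then have "?p = 0"
    by (rule indep[rotated]) (use assms Poly_Mapping.keys_add[of "single m 1"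
      "single n (1 :: 'k)"] in auto)
  then have "lookup ?p m = 0" by simp
  then show False by (auto simp: lookup_add lookup_single when_def split: if_splits)
qed

lemma exch_nonzero: "exch \<Delta> x u \<noteq> 0"
  unfolding exch_def by (rule mon_plus_mon_nonzero[OF in_exp_exps out_exp_exps])

lemma exch_Sp: "exch \<Delta> x u \<in> Sp {in_exp \<Delta> u, out_exp \<Delta> u}"
  unfolding exch_def by (intro Sp_add Sp_mon) auto

lemma Sp_lexps_subring: "subring_set (Sp (lexps \<Delta>))"
  by (intro Sp_subring lexps_zero lexps_add)

lemma uexp_lexps:
  assumes "v \<in> V" "v \<in> U \<or> k \<ge> 0"
  shows "uexp v k \<in> lexps \<Delta>"
  using assms U_sub by (auto simp: uexp_def lexps_def exps_def)

lemma power_int_Sp: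
  assumes "v \<in> V" "v \<in> U \<or> k \<ge> 0"
  shows "x v powi k \<in> Sp (lexps \<Delta>)"
  using Sp_mon[OF uexp_lexps[OF assms]] by (simp add: mon_uexp assms(1))

lemma mon_in_subring_lexps:
  assumes R: "subring_set R" and n: "n \<in> lexps \<Delta>"
    and gens: "\<And>v. v \<in> V \<Longrightarrow> v \<notin> W \<Longrightarrow> x v \<in> R" "\<And>v. v \<in> U \<Longrightarrow> v \<notin> W \<Longrightarrow> inverse (x v) \<in> R"
    and W: "\<And>v. v \<in> W \<Longrightarrow> x v powi n v \<in> R"
  shows "mn n \<in> R"
proof (rule mon_in_subring[OF R])
  fix v assume v: "v \<in> V"
  show "x v powi n v \<in> R"
  proof (cases "v \<in> W")
    case False
    show ?thesis
    proof (cases "n v \<ge> 0")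
      case True
      then show ?thesis using subring_set_power_int_nonneg[OF R] gens(1) v False by blast
    next
      case neg: False
      then have "v \<in> U" using n v by (auto simp: lexps_def)
      then show ?thesis using subring_set_power_int_nonpos[OF R gens(2)] neg False by auto
    qed
  qed (use W in blast)
qed

lemma laurent_ring_eq_Sp: "laurent_ring \<iota> \<Delta> x = Sp (lexps \<Delta>)"
proof
  show "laurent_ring \<iota> \<Delta> x \<subseteq> Sp (lexps \<Delta>)"
    unfolding laurent_ring_def
  proof (rule generate_ring_least[OF Sp_lexps_subring])
    show "range \<iota> \<union> x ` nodes \<Delta> \<union> (\<lambda>v. inverse (x v)) ` mutables \<Delta> \<subseteq> Sp (lexps \<Delta>)"
      using power_int_Sp[of _ 1] power_int_Sp[of _ "- 1"] U_sub Sp_const[OF lexps_zero]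
      by (auto simp: power_int_minus)
  qed
  let ?G = "range \<iota> \<union> x ` nodes \<Delta> \<union> (\<lambda>v. inverse (x v)) ` mutables \<Delta>"
  show "Sp (lexps \<Delta>) \<subseteq> laurent_ring \<iota> \<Delta> x"
    unfolding laurent_ring_def
    by (intro Sp_least subring_set_generate mon_in_subring_lexps[where W = "{}"])
      (auto intro: generate_ring.incl)
qed

lemma exch_lexps: "exch \<Delta> x u \<in> Sp (lexps \<Delta>)"
  by (rule Sp_mono[OF _ exch_Sp]) (use in_exp_lexps out_exp_lexps in blast)

text \<open>
  The terms of \<open>u\<close>-degree \<open>k\<close> in a relation between monomials of the new cluster become, up to a
  power of the exchange polynomial, the terms of \<open>u\<close>-degree \<open>- k\<close> in a relation for the old one.
\<close>

lemma mutate_laurent: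
  assumes u: "u \<in> U"
  shows "laurent \<iota> V (mutate_cluster u \<Delta> x)"
proof -
  define P where "P = exch \<Delta> x u"
  define y where "y = mutate_cluster u \<Delta> x"
  have y: "y = x(u := P / x u)" by (simp add: y_def P_def mutate_cluster_exch)
  have uV: "u \<in> V" using u U_sub by blast
  have P0: "P \<noteq> 0" unfolding P_def by (rule exch_nonzero)
  have mon_y: "lmon V y n = mn (n(u := - n u)) * P powi n u" for n
    unfolding y lmon_upd[OF fin uV] mon_split[OF uV, of "n(u := - n u)"]
    by (simp add: power_int_divide_distrib power_int_minus field_simps)
  have Psub: "P ^ k * f \<in> Sp A" if "f \<in> Sp A" "\<And>m n. m \<in> {in_exp \<Delta> u, out_exp \<Delta> u} \<Longrightarrow> n \<in> A \<Longrightarrow> m + n \<in> A" for A f k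
  proof (induction k)
    case (Suc k)
    have "P * (P ^ k * f) \<in> Sp A"
      unfolding P_def by (rule Sp_mult[OF exch_Sp Suc[unfolded P_def] that(2)])
    then show ?case by (simp add: mult.assoc)
  qed (use that in simp)
  show ?thesis
    unfolding y_def[symmetric]
  proof (unfold_locales, rule fin)
    show "y v \<noteq> 0" if "v \<in> V" for v using nz that uV P0 by (simp add: y)
  next
    fix p assume p: "keys p \<subseteq> exps V" and ev0: "leval \<iota> V y p = 0"
    define S where "S = keys p"
    define c where "c = lookup p"
    have "finite S" by (simp add: S_def)
    show "p = 0"
    proof (rule ccontr)
      assume "p \<noteq> 0"
      then obtain n0 where n0: "n0 \<in> S" unfolding S_def using keys_eq_empty[of p] by blast
      define k where "k = n0 u"
      \<comment> \<open>New monomials carry the factor \<open>P powi n u\<close>, possibly with a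
        negative exponent; multiplying by \<open>P powi N\<close> makes all these exponents
        nonnegative.\<close>
      define N where "N = (\<Sum>n\<in>S. \<bar>n u\<bar>)"
      have N: "n u + N \<ge> 0" if "n \<in> S" for n
        using member_le_sum[of n S "\<lambda>n. \<bar>n u\<bar>"] that \<open>finite S\<close> by (auto simp: N_def)
      have pow: "P powi N * P powi n u = P ^ nat (N + n u)" if "n \<in> S" for n
      proof -
        have "P powi (N + n u) = P powi N * P powi n u" by (rule power_int_add) (use P0 in simp)
        moreover have "P powi (N + n u) = P ^ nat (N + n u)"
          using N[OF that] by (simp add: power_int_def add.commute)
        ultimately show ?thesis by simp
      qed
      define t where "t n = P ^ nat (N + n u) * (\<iota> (c n) * mn (n(u := - n u)))" for n
      have "0 = P powi N * leval \<iota> V y p" by (simp add: ev0)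
      also have "\<dots> = (\<Sum>n\<in>S. t n)"
        unfolding leval_def sum_distrib_left S_def[symmetric] c_def[symmetric]
        by (intro sum.cong) (auto simp: t_def mon_y simp flip: pow)
      also have "\<dots> = (\<Sum>n\<in>S \<inter> {n. n u = k}. t n) + (\<Sum>n\<in>S - {n. n u = k}. t n)"
        by (rule sum.Int_Diff[OF \<open>finite S\<close>])
      finally have sum0: "(\<Sum>n\<in>S \<inter> {n. n u = k}. t n) + (\<Sum>n\<in>S - {n. n u = k}. t n) = 0" by simp
      have upd: "n(u := - n u) \<in> exps V" if "n \<in> S" for n
        using that p uV by (auto simp: S_def exps_def)
      have stab: "m + n \<in> {n \<in> exps V. n u = - j}"
        if "m \<in> {in_exp \<Delta> u, out_exp \<Delta> u}" "n \<in> {n \<in> exps V. n u = - j}" for m n j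
        using that in_exp_exps[of u] out_exp_exps[of u] in_exp_self[of u] out_exp_self[of u]
        by (auto simp: exps_def)
      have t_Sp: "t n \<in> Sp {m \<in> exps V. m u = - n u}" if "n \<in> S" for n
        unfolding t_def by (rule Psub[OF Sp_const_mon stab]) (use upd[OF that] in auto)
      have "(\<Sum>n\<in>S \<inter> {n. n u = k}. t n) = 0"
      proof (rule Sp_unique(1)[OF _ _ _ _ _ sum0])
        show "(\<Sum>n\<in>S \<inter> {n. n u = k}. t n) \<in> Sp {m \<in> exps V. m u = - k}"
          by (intro Sp_sum) (use t_Sp in auto)
        show "(\<Sum>n\<in>S - {n. n u = k}. t n) \<in> Sp {m \<in> exps V. m u \<noteq> - k}"
          by (intro Sp_sum Sp_mono[OF _ t_Sp]) auto
      qed auto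
      also have "(\<Sum>n\<in>S \<inter> {n. n u = k}. t n) =
          P ^ nat (N + k) * (\<Sum>n\<in>S \<inter> {n. n u = k}. \<iota> (c n) * mn (n(u := - n u)))"
        unfolding sum_distrib_left by (intro sum.cong) (auto simp: t_def)
      finally have "(\<Sum>n\<in>S \<inter> {n. n u = k}. \<iota> (c n) * mn (n(u := - n u))) = 0"
        using P0 by simp
      then have "c n0 = 0"
      proof (rule linear_independent[rotated 3])
        show "inj_on (\<lambda>n. n(u := - n u)) (S \<inter> {n. n u = k})"
        proof (intro inj_onI ext)
          fix m n :: "'v \<Rightarrow> int" and v
          assume "m(u := - m u) = n(u := - n u)"
          then have "(m(u := - m u)) v = (n(u := - n u)) v" by simp
          then show "m v = n v" by (auto split: if_splits)
        qed
        show "(\<lambda>n. n(u := - n u)) ` (S \<inter> {n. n u = k}) \<subseteq> exps V" using upd by blast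
      qed (use n0 k_def \<open>finite S\<close> in auto)
      then show False using n0 by (simp add: S_def c_def in_keys_iff)
    qed
  qed
qed

lemma mutate_seed: "u \<in> U \<Longrightarrow> seed \<iota> (mutate_quiver u \<Delta>) (mutate_cluster u \<Delta> x)"
  using mutate_laurent[of u] is_ice_quiver_mutate[OF ice, of u]
  by (simp add: seed_def seed_axioms_def)

end

section \<open>Adjacent seeds\<close>

text \<open>Reversing all arrows swaps the two terms of each exchange relation and so changes
  neither clusters nor Laurent rings. This symmetry allows arrows between two mutable vertices to be
  oriented at will.\<close>

definition opp :: "'v ice_quiver \<Rightarrow> 'v ice_quiver" where
  "opp \<Delta> = \<Delta> \<lparr> narrows := (\<lambda>v w. narrows \<Delta> w v) \<rparr>"

lemma opp_simps [simp]:
  "nodes (opp \<Delta>) = nodes \<Delta>" "mutables (opp \<Delta>) = mutables \<Delta>" "narrows (opp \<Delta>) v w = narrows \<Delta> w v"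
  by (simp_all add: opp_def)

lemma mutate_quiver_opp: "mutate_quiver u (opp \<Delta>) = opp (mutate_quiver u \<Delta>)"
  by (auto simp: mutate_quiver_def opp_def Let_def fun_eq_iff mult.commute intro!: ice_quiver.equality)

lemma mutate_cluster_opp: "mutate_cluster u (opp \<Delta>) x = mutate_cluster u \<Delta> x"
  by (simp add: mutate_cluster_def add.commute)

lemma is_ice_quiver_opp: "is_ice_quiver (opp \<Delta>) \<longleftrightarrow> is_ice_quiver \<Delta>"
  by (auto simp: is_ice_quiver_def) (metis neq0_conv)+

lemma laurent_ring_opp: "laurent_ring \<iota> (opp \<Delta>) x = laurent_ring \<iota> \<Delta> x"
  by (simp add: laurent_ring_def)

lemma laurent_ring_mutate_quiver [simp]: "laurent_ring \<iota> (mutate_quiver u \<Delta>) x = laurent_ring \<iota> \<Delta> x"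
  by (simp add: laurent_ring_def)

context seed
begin

abbreviation "L \<equiv> Sp (lexps \<Delta>)"

lemma L_gens: "\<iota> c \<in> L" "v \<in> V \<Longrightarrow> x v \<in> L" "v \<in> U \<Longrightarrow> inverse (x v) \<in> L"
  using power_int_Sp[of v 1] power_int_Sp[of v "- 1"] U_sub Sp_const[OF lexps_zero]
  by (auto simp: power_int_minus)

lemma mon_mutate_cluster:
  assumes "u \<in> V" "n u = 0"
  shows "lmon V (mutate_cluster u \<Delta> x) n = mn n"
proof -
  have "n(u := 0) = n" using assms(2) by auto
  then show ?thesis by (simp add: mutate_cluster_exch lmon_upd[OF fin assms(1)] assms(2))
qed

text \<open>Mutation at \<open>u\<close> reverses the arrows at \<open>u\<close>, which swaps the
  two terms, and neither term contains the variable that was replaced.\<close>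

lemma exch_mutate:
  assumes "u \<in> U"
  shows "exch (mutate_quiver u \<Delta>) (mutate_cluster u \<Delta> x) u = exch \<Delta> x u"
proof -
  have "in_exp (mutate_quiver u \<Delta>) u = out_exp \<Delta> u" "out_exp (mutate_quiver u \<Delta>) u = in_exp \<Delta> u"
    by (auto simp: in_exp_def out_exp_def mutate_quiver_def)
  then show ?thesis
    using assms U_sub by (simp add: exch_def mon_mutate_cluster in_exp_self out_exp_self subset_iff)
qed

lemma initial_in_mutated:
  assumes u: "u \<in> U" and v: "v \<in> V"
  shows "x v \<in> laurent_ring \<iota> \<Delta> (mutate_cluster u \<Delta> x)"
proof -
  interpret Y: seed \<iota> "mutate_quiver u \<Delta>" "mutate_cluster u \<Delta> x" by (rule mutate_seed[OF u])
  have "x v \<in> Y.L"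
  proof (cases "v = u")
    case True
    have "x u = exch \<Delta> x u * inverse (mutate_cluster u \<Delta> x u)"
      using exch_nonzero[of u] nz[OF v] True by (simp add: mutate_cluster_exch field_simps)
    also have "\<dots> \<in> Y.L"
      using Y.exch_lexps[of u] Y.L_gens(3)[of u] u
      by (intro subring_set_mult[OF Y.Sp_lexps_subring]) (simp_all add: exch_mutate[OF u])
    finally show ?thesis using True by simp
  next
    case False
    then show ?thesis using Y.L_gens(2)[of v] v by (simp add: mutate_cluster_exch)
  qed
  then show ?thesis using Y.laurent_ring_eq_Sp by simp
qed

text \<open>The only generator of the old Laurent ring that is not Laurent in the new cluster is
  \<open>inverse (x u)\<close>, which equals the new variable divided by the exchange
  polynomial.\<close>

lemma laurent_clear_denominator:
  assumes u: "u \<in> U" and f: "f \<in> L"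
  shows "\<exists>N. exch \<Delta> x u ^ N * f \<in> laurent_ring \<iota> \<Delta> (mutate_cluster u \<Delta> x)"
proof -
  define P where "P = exch \<Delta> x u"
  define y where "y = mutate_cluster u \<Delta> x"
  interpret Y: seed \<iota> "mutate_quiver u \<Delta>" y unfolding y_def by (rule mutate_seed[OF u])
  have y: "y = x(u := P / x u)" by (simp add: y_def P_def mutate_cluster_exch)
  have uV: "u \<in> V" using u U_sub by blast
  have P0: "P \<noteq> 0" unfolding P_def by (rule exch_nonzero)
  have PL: "P \<in> Y.L"
    using Y.exch_lexps[of u] exch_mutate[OF u] by (simp add: P_def y_def)
  let ?R = "{f. \<exists>N. P ^ N * f \<in> Y.L}"
  have xL: "x v \<in> Y.L" if "v \<in> V" for v
    using initial_in_mutated[OF u that] Y.laurent_ring_eq_Sp by (simp add: y_def)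
  have "P ^ 1 * inverse (x u) = y u" by (simp add: y field_simps)
  also have "\<dots> \<in> Y.L" using Y.L_gens(2)[of u] uV by simp
  finally have inv_u: "inverse (x u) \<in> ?R" by blast
  have "laurent_ring \<iota> \<Delta> x \<subseteq> ?R"
    unfolding laurent_ring_def
  proof (rule generate_ring_least)
    show "subring_set ?R" by (rule subring_set_localization[OF Y.Sp_lexps_subring PL])
    have "x v \<in> ?R" if "v \<in> V" for v by (rule in_localization[OF xL[OF that]])
    moreover have "inverse (x v) \<in> ?R" if "v \<in> U" for v
      using inv_u in_localization[OF Y.L_gens(3)[of v]] that by (cases "v = u") (auto simp: y)
    ultimately show "range \<iota> \<union> x ` V \<union> (\<lambda>v. inverse (x v)) ` U \<subseteq> ?R"
      using in_localization[OF Y.L_gens(1)] by blast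
  qed
  then show ?thesis
    using f Y.laurent_ring_eq_Sp by (auto simp: laurent_ring_eq_Sp y_def P_def)
qed

text \<open>Split \<open>f\<close> by the sign of its degree in \<open>x u\<close>. The nonnegative
  part is generated by the allowed elements. The negative part \<open>h\<close> is Laurent in the
  new cluster as well, and a power of \<open>P\<close> turns it into terms of positive degree in the
  new variable; as \<open>P\<close> is free of that variable, \<open>h\<close> itself has this form.
  The conclusion is stated for an arbitrary \<open>R\<close>, since it is applied to a localization
  and to a span cut out by a degree condition.\<close>

lemma adjacent_laurent_subset:
  assumes u: "u \<in> U" and f: "f \<in> L" "f \<in> laurent_ring \<iota> \<Delta> (mutate_cluster u \<Delta> x)"
    and R: "subring_set R" "range \<iota> \<subseteq> R" "\<And>v. v \<in> V \<Longrightarrow> x v \<in> R"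
      "\<And>v. v \<in> U \<Longrightarrow> v \<noteq> u \<Longrightarrow> inverse (x v) \<in> R" "exch \<Delta> x u / x u \<in> R"
  shows "f \<in> R"
proof -
  define P where "P = exch \<Delta> x u"
  define y where "y = mutate_cluster u \<Delta> x"
  interpret Y: seed \<iota> "mutate_quiver u \<Delta>" y unfolding y_def by (rule mutate_seed[OF u])
  have y: "y = x(u := P / x u)" by (simp add: y_def P_def mutate_cluster_exch)
  have uV: "u \<in> V" using u U_sub by blast
  have P0: "P \<noteq> 0" unfolding P_def by (rule exch_nonzero)
  have PL: "P \<in> Y.L"
    using Y.exch_lexps[of u] exch_mutate[OF u] by (simp add: P_def y_def)
  have fY: "f \<in> Y.L" using f(2) Y.laurent_ring_eq_Sp by (simp add: y_def)
  obtain g h where gh: "f = g + h" "g \<in> Sp (lexps \<Delta> \<inter> {n. n u \<ge> 0})" "h \<in> Sp (lexps \<Delta> - {n. n u \<ge> 0})"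
    by (rule Sp_split[OF f(1)])
  have g_in: "Sp (lexps \<Delta> \<inter> {n. n u \<ge> 0}) \<subseteq> S"
    if "subring_set S" "range \<iota> \<subseteq> S" "\<And>v. v \<in> V \<Longrightarrow> x v \<in> S"
      "\<And>v. v \<in> U \<Longrightarrow> v \<noteq> u \<Longrightarrow> inverse (x v) \<in> S" for S
    using that by (intro Sp_least mon_in_subring_lexps[where W = "{u}"])
      (auto intro: subring_set_power_int_nonneg uV)
  have "x v \<in> Y.L" if "v \<in> V" for v
    using initial_in_mutated[OF u that] Y.laurent_ring_eq_Sp by (simp add: y_def)
  moreover have "inverse (x v) \<in> Y.L" if "v \<in> U" "v \<noteq> u" for v
    using Y.L_gens(3)[of v] that by (simp add: y)
  ultimately have "g \<in> Y.L"
    using gh(2) g_in[of Y.L] Y.Sp_lexps_subring Y.L_gens(1) by blast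
  then have hY: "h \<in> Y.Sp (lexps \<Delta>)"
    using Y.Sp_diff[OF fY, of g] gh(1) by simp
  let ?A = "{n \<in> exps V. n u > 0}"
  have stab: "m + n \<in> ?A" if "m \<in> {in_exp \<Delta> u, out_exp \<Delta> u}" "n \<in> ?A" for m n
    using that in_exp_exps[of u] out_exp_exps[of u] in_exp_self[of u] out_exp_self[of u]
    by (auto simp: exps_def)
  have PD: "P \<in> Y.Sp {in_exp \<Delta> u, out_exp \<Delta> u}"
    using Y.exch_Sp[of u] unfolding P_def y_def exch_mutate[OF u]
    by (rule Y.Sp_mono[unfolded y_def, rotated]) (auto simp: in_exp_def out_exp_def mutate_quiver_def)
  have P_A: "P ^ k * f \<in> Y.Sp ?A" if "f \<in> Y.Sp ?A" for f k
  proof (induction k)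
    case (Suc k)
    have "P * (P ^ k * f) \<in> Y.Sp ?A" by (rule Y.Sp_mult[OF PD Suc stab])
    then show ?case by (simp add: mult.assoc)
  qed (use that in simp)
  \<comment> \<open>Since \<open>x u\<close> is \<open>P / y u\<close>, a pole of order
    \<open>k\<close> in \<open>x u\<close> becomes \<open>y u ^ k\<close> after multiplication by
    \<open>P ^ k\<close>; \<open>N\<close> is the sum of all pole orders.\<close>
  have "\<exists>N. P ^ N * h \<in> Y.Sp ?A"
  proof -
    obtain p where p: "keys p \<subseteq> lexps \<Delta> - {n. n u \<ge> 0}" "h = ev p" using gh(3) by (rule SpE)
    define N where "N = (\<Sum>n\<in>keys p. nat (- n u))"
    have "P ^ N * (\<iota> (lookup p n) * mn n) \<in> Y.Sp ?A" if n: "n \<in> keys p" for n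
    proof -
      have neg: "n u < 0" and nexp: "n \<in> exps V" using n p(1) by (auto simp: lexps_def)
      define k where "k = nat (- n u)"
      have k: "n u = - int k" using neg by (simp add: k_def)
      have "k \<le> N"
        unfolding N_def k_def using n member_le_sum[of n "keys p" "\<lambda>n. nat (- n u)"] by simp
      then have "P ^ N = P ^ (N - k) * P ^ k" by (simp flip: power_add)
      moreover have "P ^ k * mn n = lmon V y (n(u := - n u))"
        unfolding y lmon_upd[OF fin uV] mon_split[OF uV, of n]
        using P0 nz[OF uV] by (simp add: k power_int_minus power_divide field_simps)
      ultimately have "P ^ N * (\<iota> (lookup p n) * mn n) =
          P ^ (N - k) * (\<iota> (lookup p n) * lmon V y (n(u := - n u)))"
        by (simp add: mult_ac)
      also have "\<dots> \<in> Y.Sp ?A"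
      proof (rule P_A)
        have "\<iota> (lookup p n) * lmon (nodes (mutate_quiver u \<Delta>)) y (n(u := - n u)) \<in> Y.Sp ?A"
          by (rule Y.Sp_const_mon) (use neg nexp uV in \<open>auto simp: exps_def\<close>)
        then show "\<iota> (lookup p n) * lmon V y (n(u := - n u)) \<in> Y.Sp ?A" by simp
      qed
      finally show ?thesis .
    qed
    then have "P ^ N * h \<in> Y.Sp ?A"
      unfolding p(2) leval_def sum_distrib_left by (rule Y.Sp_sum)
    then show ?thesis ..
  qed
  then obtain N where N: "P ^ N * h \<in> Y.Sp ?A" by blast
  have "h \<in> Y.Sp {n \<in> lexps \<Delta>. n u > 0}"
  proof (rule Y.Sp_cancel_power[OF PD P0 hY])
    show "m + n \<in> lexps \<Delta>" if "m \<in> {in_exp \<Delta> u, out_exp \<Delta> u}" "n \<in> lexps \<Delta>" for m n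
      using that in_exp_lexps[of u] out_exp_lexps[of u] lexps_add[of m] by blast
    show "0 < (m + n) u \<longleftrightarrow> 0 < n u" if "m \<in> {in_exp \<Delta> u, out_exp \<Delta> u}" for m n
      using that in_exp_self[of u] out_exp_self[of u] by auto
  qed (use N lexps_exps[of \<Delta>] in simp_all)
  moreover have "Y.Sp {n \<in> lexps \<Delta>. n u > 0} \<subseteq> R"
  proof (rule Y.Sp_least[OF R(1,2)])
    fix n assume n: "n \<in> {n \<in> lexps \<Delta>. n u > 0}"
    show "lmon (nodes (mutate_quiver u \<Delta>)) y n \<in> R"
      by (rule Y.mon_in_subring_lexps[OF R(1), where W = "{u}"])
        (use n R(3-5) in \<open>auto simp: y P_def intro!: subring_set_power_int_nonneg[OF R(1)]\<close>)
  qed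
  moreover have "g \<in> R" using gh(2) g_in[of R] R by blast
  ultimately show ?thesis using gh(1) subring_set_add[OF R(1)] by blast
qed

text \<open>Without oriented 2-cycles, \<open>x v\<close> occurs in at most one of the two terms of
  the exchange polynomial, so some nonzero part is free of it.\<close>

lemma exch_split_frozen:
  assumes "v \<in> V"
  obtains P0 P1 where "exch \<Delta> x u = P0 + P1" "P0 \<noteq> 0" "P0 \<in> Sp {n \<in> exps V. n v = 0}"
    "P1 \<in> Sp {n \<in> exps V. n v > 0}"
proof -
  have io: "in_exp \<Delta> u v \<ge> 0" "out_exp \<Delta> u v \<ge> 0" by (simp_all add: in_exp_def out_exp_def)
  consider "in_exp \<Delta> u v = 0" "out_exp \<Delta> u v = 0" | "in_exp \<Delta> u v = 0" "out_exp \<Delta> u v > 0"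
    | "in_exp \<Delta> u v > 0" "out_exp \<Delta> u v = 0"
    using narrows_antisym[of u v] io by (fastforce simp: in_exp_def out_exp_def)
  then show ?thesis
  proof cases
    case 1
    then show ?thesis
      using in_exp_exps[of u] out_exp_exps[of u] exch_nonzero[of u] Sp_mono[OF _ exch_Sp[of u]]
      by (intro that[of "exch \<Delta> x u" 0]) (auto intro: Sp_zero)
  next
    case 2
    then show ?thesis
      using in_exp_exps[of u] out_exp_exps[of u] mon_nonzero
      by (intro that[of "mn (in_exp \<Delta> u)" "mn (out_exp \<Delta> u)"]) (auto simp: exch_def intro: Sp_mon)
  next
    case 3
    then show ?thesis
      using in_exp_exps[of u] out_exp_exps[of u] mon_nonzero
      by (intro that[of "mn (out_exp \<Delta> u)" "mn (in_exp \<Delta> u)"]) (auto simp: exch_def intro: Sp_mon)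
  qed
qed

text \<open>For frozen \<open>v\<close> this holds because the component of \<open>x v\<close>-degree 0 of \<open>exch \<Delta> x u\<close> is nonzero.\<close>

lemma exch_dvd_cancel_var:
  assumes a: "a \<in> L" and q: "q \<in> L" "a * x v = exch \<Delta> x u * q" and v: "v \<in> V"
  shows "\<exists>d\<in>L. a = exch \<Delta> x u * d"
proof -
  have "q * inverse (x v) \<in> L"
  proof (cases "v \<in> U")
    case True
    then show ?thesis using q(1) L_gens(3) subring_set_mult[OF Sp_lexps_subring] by blast
  next
    case False
    let ?Z = "{n \<in> exps V. n v = 0}" and ?A = "{n \<in> exps V. n v > 0}"
    obtain P0 P1 where P: "exch \<Delta> x u = P0 + P1" "P0 \<noteq> 0" "P0 \<in> Sp ?Z" "P1 \<in> Sp ?A"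
      by (rule exch_split_frozen[OF v])
    obtain g h where gh: "q = g + h" "g \<in> Sp (lexps \<Delta> \<inter> {n. n v > 0})" "h \<in> Sp (lexps \<Delta> - {n. n v > 0})"
      by (rule Sp_split[OF q(1)])
    have nonneg: "n v \<ge> 0" if "n \<in> lexps \<Delta>" for n using that v False by (auto simp: lexps_def)
    have add0: "m + n \<in> ?Z" if "m \<in> ?Z" "n \<in> lexps \<Delta> - {n. n v > 0}" for m n
      using that nonneg[of n] by (auto simp: lexps_def exps_def)
    have add1: "m + n \<in> ?A" if "m \<in> ?A" "n \<in> lexps \<Delta>" for m n
      using that nonneg[of n] by (auto simp: lexps_def exps_def)
    have low: "P0 * h \<in> Sp ?Z" by (rule Sp_mult[OF P(3) gh(3) add0])
    have high: "P1 * h + exch \<Delta> x u * g - a * x v \<in> Sp ?A"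
    proof (intro Sp_diff Sp_add)
      show "P1 * h \<in> Sp ?A" by (rule Sp_mult[OF P(4) gh(3) add1]) auto
      have "g * exch \<Delta> x u \<in> Sp ?A"
        by (rule Sp_mult[OF gh(2) exch_lexps add1]) (auto simp: lexps_def)
      then show "exch \<Delta> x u * g \<in> Sp ?A" by (simp add: mult.commute)
      have "x v \<in> Sp {uexp v 1}" using Sp_mon[of "uexp v 1" "{uexp v 1}"] by (simp add: mon_uexp v)
      from Sp_mult[OF this a add1] have "x v * a \<in> Sp ?A" using v by (auto simp: exps_def uexp_def)
      then show "a * x v \<in> Sp ?A" by (simp add: mult.commute)
    qed
    have sum0: "P0 * h + (P1 * h + exch \<Delta> x u * g - a * x v) = 0"
      using q(2) by (simp add: P(1) gh(1) algebra_simps)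
    have "P0 * h = 0" by (rule Sp_unique(1)[OF low high _ _ _ sum0]) auto
    then have "q \<in> Sp (lexps \<Delta> \<inter> {n. n v > 0})" using P(2) gh by simp
    moreover have "inverse (x v) \<in> Sp {uexp v (- 1)}"
      using Sp_mon[of "uexp v (- 1)" "{uexp v (- 1)}"] by (simp add: mon_uexp v power_int_minus)
    ultimately show ?thesis
      by (rule Sp_mult) (use v in \<open>auto simp: lexps_def exps_def uexp_def\<close>)
  qed
  moreover have "a = exch \<Delta> x u * (q * inverse (x v))"
    using q(2) nz[OF v] by (simp add: field_simps)
  ultimately show ?thesis by blast
qed

text \<open>The monomial is removed one variable at a time: mutable variables are units of
  \<open>L\<close>, and frozen ones, which occur with nonnegative exponent, are cancelled by
  \<open>exch_dvd_cancel_var\<close>.\<close>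

lemma exch_dvd_cancel_mon:
  assumes a: "a \<in> L" and q: "q \<in> L" "a * mn n = exch \<Delta> x u * q" and n: "n \<in> lexps \<Delta>"
  shows "\<exists>d\<in>L. a = exch \<Delta> x u * d"
proof -
  let ?P = "exch \<Delta> x u"
  note sub = Sp_lexps_subring
  have power: "\<exists>d\<in>L. a = ?P * d" if "a \<in> L" "q \<in> L" "a * x v ^ k = ?P * q" "v \<in> V" for a q v k
    using that
  proof (induction k arbitrary: q)
    case (Suc k)
    have "a * x v ^ k \<in> L" using Suc.prems L_gens(2) sub by (metis subring_set_mult subring_set_power)
    then obtain d where "d \<in> L" "a * x v ^ k = ?P * d"
      using exch_dvd_cancel_var[of "a * x v ^ k" q v u] Suc.prems by (auto simp: mult_ac)
    then show ?case using Suc by blast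
  qed auto
  have "\<exists>d\<in>L. a = ?P * d" if "finite W" "W \<subseteq> V" "a \<in> L" "q \<in> L" "a * (\<Prod>v\<in>W. x v powi n v) = ?P * q" for W a q
    using that
  proof (induction W arbitrary: a q rule: finite_induct)
    case (insert v W)
    have v: "v \<in> V" using insert.prems by simp
    have vn: "x v powi n v \<in> L"
      by (rule power_int_Sp[OF v]) (use n v in \<open>auto simp: lexps_def\<close>)
    obtain d where d: "d \<in> L" "a * x v powi n v = ?P * d"
      using insert.IH[of "a * x v powi n v" q] insert.prems insert.hyps subring_set_mult[OF sub _ vn]
      by (auto simp: mult.assoc)
    show ?case
    proof (cases "v \<in> U")
      case True
      have "x v powi (- n v) \<in> L" by (rule power_int_Sp[OF v]) (use True in simp)
      then have "d * x v powi (- n v) \<in> L" using d(1) sub by (intro subring_set_mult)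
      moreover have "a = ?P * (d * x v powi (- n v))"
        using d(2) nz[OF v] by (simp add: power_int_minus field_simps)
      ultimately show ?thesis by blast
    next
      case False
      then have "n v \<ge> 0" using n v by (auto simp: lexps_def)
      then show ?thesis using power[of a d v "nat (n v)"] insert.prems d v by (simp add: power_int_def)
    qed
  qed auto
  from this[OF fin order.refl a q(1)] q(2) show ?thesis by (simp add: lmon_def)
qed

text \<open>Compares components of lowest degree, using that \<open>exch \<Delta> x u\<close> is homogeneous.\<close>

lemma exch_coprime_binomial:
  fixes wt :: "('v \<Rightarrow> int) \<Rightarrow> int"
  assumes add: "\<And>m n. wt (m + n) = wt m + wt n"
    and hom: "wt (in_exp \<Delta> u) = wt (out_exp \<Delta> u)"
    and mn: "m1 \<in> lexps \<Delta>" "m2 \<in> lexps \<Delta>" "wt m1 < wt m2"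
    and a: "a \<in> L" and c: "c \<in> L" "a * (mn m1 + mn m2) = exch \<Delta> x u * c"
  shows "\<exists>d\<in>L. a = exch \<Delta> x u * d"
proof -
  let ?P = "exch \<Delta> x u" and ?Q = "mn m1 + mn m2" and ?e = "wt (in_exp \<Delta> u)"
  note sub = Sp_lexps_subring
  have QL: "?Q \<in> L" using mn by (intro Sp_add Sp_mon)
  have P: "?P \<in> Sp (lexps \<Delta> \<inter> {n. wt n = ?e})"
    by (rule Sp_mono[OF _ exch_Sp]) (use hom in_exp_lexps out_exp_lexps in auto)
  \<comment> \<open>Induction on the width \<open>l\<close> of a degree interval containing the
    support of \<open>a\<close>. In lowest degree only \<open>mn m1\<close> contributes from the
    binomial, so the lowest component of \<open>a\<close> is divisible by \<open>?P\<close>;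
    removing it shortens the interval from below.\<close>
  have *: "\<exists>d\<in>L. a = ?P * d" if "a \<in> Sp (lexps \<Delta> \<inter> {n. k \<le> wt n \<and> wt n < k + int l})" "c \<in> L"
    "a * ?Q = ?P * c" for a c k l
    using that
  proof (induction l arbitrary: a c k)
    case 0
    have "a \<in> Sp {}" by (rule Sp_mono[OF _ 0(1)]) auto
    then have "a = 0" by (auto simp: lspan_def leval_def)
    then show ?case using subring_set_zero[OF sub] by auto
  next
    case (Suc l)
    let ?B = "lexps \<Delta> \<inter> {n. wt n = k + wt m1}"
    obtain b b' where b: "a = b + b'" "b \<in> Sp (lexps \<Delta> \<inter> {n. k \<le> wt n \<and> wt n < k + int (Suc l)} \<inter> {n. wt n = k})"
      "b' \<in> Sp (lexps \<Delta> \<inter> {n. k \<le> wt n \<and> wt n < k + int (Suc l)} - {n. wt n = k})"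
      by (rule Sp_split[OF Suc.prems(1)])
    have b1: "b \<in> Sp (lexps \<Delta> \<inter> {n. wt n = k})" by (rule Sp_mono[OF _ b(2)]) auto
    have b2: "b' \<in> Sp (lexps \<Delta> \<inter> {n. k + 1 \<le> wt n \<and> wt n < k + 1 + int l})"
      by (rule Sp_mono[OF _ b(3)]) auto
    obtain g h where gh: "c = g + h" "g \<in> Sp (lexps \<Delta> \<inter> {n. wt n = k + wt m1 - ?e})"
      "h \<in> Sp (lexps \<Delta> - {n. wt n = k + wt m1 - ?e})"
      by (rule Sp_split[OF Suc.prems(2)])
    have low: "b * mn m1 - ?P * g \<in> Sp ?B"
      by (intro Sp_diff Sp_mult[OF b1 Sp_mon[of m1 "{m1}"]] Sp_mult[OF P gh(2)])
        (use mn in \<open>auto intro: lexps_add simp: add\<close>)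
    have high: "b * mn m2 + b' * mn m1 + b' * mn m2 - ?P * h \<in> Sp (lexps \<Delta> - ?B)"
      by (intro Sp_diff Sp_add Sp_mult[OF b1 Sp_mon[of m2 "{m2}"]] Sp_mult[OF b2 Sp_mon[of m1 "{m1}"]]
          Sp_mult[OF b2 Sp_mon[of m2 "{m2}"]] Sp_mult[OF P gh(3)])
        (use mn in \<open>auto intro: lexps_add simp: add\<close>)
    have "b * mn m1 - ?P * g = 0"
      by (rule Sp_unique(1)[OF low high])
        (use lexps_exps Suc.prems(3) in \<open>auto simp: b(1) gh(1) algebra_simps\<close>)
    moreover have bL: "b \<in> L" "b' \<in> L" "g \<in> L" using b1 b2 gh(2) by (auto intro: Sp_mono[rotated])
    ultimately obtain d where d: "d \<in> L" "b = ?P * d" using exch_dvd_cancel_mon[OF bL(1,3) _ mn(1)] by auto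
    have "c - d * ?Q \<in> L" using sub Suc.prems(2) d(1) QL by (intro Sp_diff subring_set_mult)
    moreover have "b' * ?Q = ?P * (c - d * ?Q)"
      using Suc.prems(3) d(2) by (simp add: b(1) algebra_simps)
    ultimately obtain d' where "d' \<in> L" "b' = ?P * d'" using Suc.IH[OF b2] by blast
    then have "d + d' \<in> L" "a = ?P * (d + d')" using d b(1) by (auto intro: Sp_add simp: algebra_simps)
    then show ?case by blast
  qed
  obtain p where p: "keys p \<subseteq> lexps \<Delta>" "a = ev p" using a by (rule SpE)
  \<comment> \<open>All degrees lie in the closed interval from \<open>- B\<close> to
    \<open>B\<close>, which contains \<open>2 * B + 1\<close> integers.\<close>
  define B where "B = (\<Sum>n\<in>keys p. \<bar>wt n\<bar>)"
  have "\<bar>wt n\<bar> \<le> B" if "n \<in> keys p" for n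
    unfolding B_def using that by (intro member_le_sum) auto
  then have "keys p \<subseteq> lexps \<Delta> \<inter> {n. - B \<le> wt n \<and> wt n < - B + int (nat (2 * B + 1))}"
    using p(1) by (fastforce simp: abs_le_iff)
  then show ?thesis using *[OF _ c] p(2) SpI by blast
qed

end

section \<open>Upper bounds\<close>

text \<open>Full rank of the B-matrix as independence of its rows, in a form that avoids an order on
  the vertices and is easily followed through mutations.\<close>

definition rows_independent :: "'v ice_quiver \<Rightarrow> bool" where
  "rows_independent \<Delta> \<longleftrightarrow> (\<forall>c :: 'v \<Rightarrow> rat.
     (\<forall>v\<in>nodes \<Delta>. (\<Sum>u\<in>mutables \<Delta>. c u * (of_nat (narrows \<Delta> u v) - of_nat (narrows \<Delta> v u))) = 0) \<longrightarrow>
     (\<forall>u\<in>mutables \<Delta>. c u = 0))"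

text \<open>This is the congruence of the two powers modulo \<open>t\<close>, with the quotient kept
  inside \<open>R\<close>.\<close>

lemma power_add_expand:
  fixes t :: "'a::comm_ring_1"
  assumes R: "subring_set R" "d \<in> R" "e \<in> R" "t \<in> R"
  shows "\<exists>q\<in>R. (d + e * t) ^ k = d ^ k + t * q"
proof (induction k)
  case 0
  then show ?case using subring_set_zero[OF R(1)] by force
next
  case (Suc k)
  then obtain q where q: "q \<in> R" "(d + e * t) ^ k = d ^ k + t * q" by blast
  have "(d + e * t) * q + e * d ^ k \<in> R"
    using R q(1) by (intro subring_set_add subring_set_mult subring_set_power)
  moreover have "(d + e * t) ^ Suc k = d ^ Suc k + t * ((d + e * t) * q + e * d ^ k)"
    by (simp add: q(2) algebra_simps)
  ultimately show ?case by blast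
qed

context seed
begin

text \<open>
  The target ring contains \<open>P2 ^ M * f\<close> and \<open>P ^ N * f\<close>, where \<open>P\<close> and \<open>P2\<close> are the exchange
  polynomials of the two mutations, so it suffices that \<open>P\<close> and \<open>P2\<close> are coprime there.  If \<open>i\<close> and
  \<open>j\<close> are joined by arrows, then \<open>P\<close> is a monomial modulo \<open>P2\<close>; otherwise a degree function that
  is constant on the terms of \<open>P2\<close> but not on those of \<open>P\<close> separates them.
\<close>

lemma laurent_ring_two_step_oriented:
  assumes i: "i \<in> U" and j: "j \<in> U" and ij: "i \<noteq> j" and ji0: "narrows \<Delta> j i = 0"
    and nonprop: "narrows \<Delta> i j = 0 \<Longrightarrow> \<exists>v w.
      (in_exp \<Delta> i - out_exp \<Delta> i) v * (in_exp \<Delta> j - out_exp \<Delta> j) w \<noteq>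
      (in_exp \<Delta> i - out_exp \<Delta> i) w * (in_exp \<Delta> j - out_exp \<Delta> j) v"
    and f: "f \<in> L" "f \<in> laurent_ring \<iota> \<Delta> (mutate_cluster i \<Delta> x)"
      "f \<in> laurent_ring \<iota> \<Delta> (mutate_cluster j \<Delta> x)"
  shows "f \<in> laurent_ring \<iota> \<Delta> (mutate_cluster j (mutate_quiver i \<Delta>) (mutate_cluster i \<Delta> x))"
proof -
  define P where "P = exch \<Delta> x i"
  define y where "y = mutate_cluster i \<Delta> x"
  define \<Delta>y where "\<Delta>y = mutate_quiver i \<Delta>"
  define P2 where "P2 = exch \<Delta>y y j"
  define z where "z = mutate_cluster j \<Delta>y y"
  define \<Delta>z where "\<Delta>z = mutate_quiver j \<Delta>y"
  have nodes_eq: "nodes \<Delta>y = V" "mutables \<Delta>y = U" "nodes \<Delta>z = V" "mutables \<Delta>z = U"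
    by (simp_all add: \<Delta>y_def \<Delta>z_def)
  have lexps_eq: "lexps \<Delta>y = lexps \<Delta>" "lexps \<Delta>z = lexps \<Delta>" by (simp_all add: \<Delta>y_def \<Delta>z_def)
  interpret Y: seed \<iota> \<Delta>y y unfolding y_def \<Delta>y_def by (rule mutate_seed[OF i])
  interpret Z: seed \<iota> \<Delta>z z unfolding z_def \<Delta>z_def by (rule Y.mutate_seed) (simp add: j nodes_eq)
  note sub = Z.Sp_lexps_subring
  have iV: "i \<in> V" and jV: "j \<in> V" using i j U_sub by blast+
  have y: "y = x(i := P / x i)" by (simp add: y_def P_def mutate_cluster_exch)
  have z: "z = y(j := P2 / y j)" by (simp add: z_def P2_def mutate_cluster_exch)
  have P0: "P \<noteq> 0" unfolding P_def by (rule exch_nonzero)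
  have P20: "P2 \<noteq> 0" unfolding P2_def by (rule Y.exch_nonzero)
  have zi: "z i = P / x i" and zj: "z j = P2 / x j" and zv: "\<And>v. v \<noteq> i \<Longrightarrow> v \<noteq> j \<Longrightarrow> z v = x v"
    using ij by (auto simp: y z)
  have LZ: "laurent_ring \<iota> \<Delta> z = Z.L"
    using Z.laurent_ring_eq_Sp by (simp add: \<Delta>z_def \<Delta>y_def)
  have mon_zy: "Z.mn n = Y.mn n" if "n j = 0" for n
    using Y.mon_mutate_cluster[of j n] that jV by (simp add: z_def nodes_eq)
  have mon_zx: "Z.mn n = mn n" if "n j = 0" "n i = 0" for n
    using mon_zy[of n] mon_mutate_cluster[of i n] that iV by (simp add: y_def nodes_eq)
  have exch_z: "exch \<Delta>z z j = P2"
    using Y.exch_mutate[of j] j by (simp add: \<Delta>z_def z_def P2_def nodes_eq)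
  have P2_L: "P2 \<in> Z.L" using Z.exch_lexps[of j] by (simp add: exch_z)
  have z_gens: "v \<in> V \<Longrightarrow> z v \<in> Z.L" "v \<in> U \<Longrightarrow> inverse (z v) \<in> Z.L" for v
    using Z.L_gens by (auto simp: nodes_eq)
  have xj: "x j = P2 * inverse (z j)" using P20 nz[OF jV] by (simp add: zj)
  have xj_L: "x j \<in> Z.L" unfolding xj by (intro subring_set_mult sub P2_L z_gens j)
  have mon_L: "mn n \<in> Z.L" if "n \<in> lexps \<Delta>" "n i = 0" "n j \<ge> 0" for n
  proof -
    have "mn (n(j := 0)) \<in> Z.L"
      using mon_zx[of "n(j := 0)"] Z.Sp_mon[of "n(j := 0)" "lexps \<Delta>z"] that ij jV
      by (auto simp: lexps_eq) (auto simp: lexps_def exps_def)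
    then show ?thesis
      unfolding mon_split[OF jV, of n]
      by (intro subring_set_mult[OF sub] subring_set_power_int_nonneg[OF sub] xj_L that)
  qed
  have P_L: "P \<in> Z.L"
    unfolding P_def exch_def
    by (intro subring_set_add[OF sub] mon_L in_exp_lexps out_exp_lexps)
      (simp_all add: in_exp_def out_exp_def narrows_self)
  have xi: "x i = P * inverse (z i)" using P0 nz[OF iV] by (simp add: zi)
  have xi_L: "x i \<in> Z.L" unfolding xi by (intro subring_set_mult sub P_L z_gens i)
  have x_L: "x v \<in> Z.L" if "v \<in> V" for v
    using xi_L xj_L z_gens(1)[OF that] zv[of v] by (cases "v = i \<or> v = j") auto
  \<comment> \<open>The first part puts into \<open>Z.L\<close> the variable obtained by mutating
    the initial seed at \<open>j\<close>, a generator required by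
    \<open>adjacent_laurent_subset\<close>; the second is the coprimality of \<open>P2\<close> and
    \<open>P\<close> in \<open>Z.L\<close>.\<close>
  have key: "exch \<Delta> x j / x j \<in> Z.L \<and>
    (\<forall>a\<in>Z.L. \<forall>c\<in>Z.L. a * P = P2 * c \<longrightarrow> (\<exists>d\<in>Z.L. a = P2 * d))"
  proof (cases "narrows \<Delta> i j = 0")
    case True
    have nar: "narrows \<Delta>y v j = narrows \<Delta> v j" "narrows \<Delta>y j v = narrows \<Delta> j v" for v
      using True ji0 ij narrows_antisym[of v j] by (auto simp: \<Delta>y_def mutate_quiver_def Let_def)
    have "P2 = exch \<Delta> x j"
    proof -
      have "P2 = mn (in_exp \<Delta>y j) + mn (out_exp \<Delta>y j)"
        unfolding P2_def exch_def using mon_zy[of "in_exp \<Delta>y j"] mon_zy[of "out_exp \<Delta>y j"]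
          mon_zx[of "in_exp \<Delta>y j"] mon_zx[of "out_exp \<Delta>y j"] True ji0
        by (simp add: in_exp_def out_exp_def nar narrows_self)
      also have "\<dots> = exch \<Delta> x j" by (simp add: in_exp_def out_exp_def nar exch_def)
      finally show ?thesis .
    qed
    then have "exch \<Delta> x j / x j \<in> Z.L" using z_gens(1)[OF jV] zj by simp
    moreover have "\<exists>d\<in>Z.L. a = P2 * d" if ac: "a \<in> Z.L" "c \<in> Z.L" "a * P = P2 * c" for a c
    proof -
      obtain v w where vw: "(in_exp \<Delta> i - out_exp \<Delta> i) v * (in_exp \<Delta> j - out_exp \<Delta> j) w \<noteq>
          (in_exp \<Delta> i - out_exp \<Delta> i) w * (in_exp \<Delta> j - out_exp \<Delta> j) v"
        using nonprop[OF True] by blast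
      \<comment> \<open>\<open>wt\<close> is a 2 by 2 minor against row \<open>j\<close> in the
        columns \<open>v\<close> and \<open>w\<close>. It vanishes on row \<open>j\<close>, so
        \<open>P2\<close> is homogeneous, and by the choice of \<open>v\<close> and \<open>w\<close>
        it does not vanish on row \<open>i\<close>, so the terms of \<open>P\<close> have different
        degrees.\<close>
      define wt :: "('v \<Rightarrow> int) \<Rightarrow> int" where
        "wt n = n v * (in_exp \<Delta> j - out_exp \<Delta> j) w - n w * (in_exp \<Delta> j - out_exp \<Delta> j) v" for n
      have wt_add: "wt (m + n) = wt m + wt n" for m n by (simp add: wt_def algebra_simps)
      have "in_exp \<Delta>z j = out_exp \<Delta> j" "out_exp \<Delta>z j = in_exp \<Delta> j"
        by (auto simp: in_exp_def out_exp_def \<Delta>z_def mutate_quiver_def nar[unfolded \<Delta>y_def mutate_quiver_def] fun_eq_iff)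
          (simp_all add: \<Delta>y_def[symmetric] nar)
      then have wt_j: "wt (in_exp \<Delta>z j) = wt (out_exp \<Delta>z j)"
        by (simp add: wt_def algebra_simps)
      have wt_i: "wt (in_exp \<Delta> i) \<noteq> wt (out_exp \<Delta> i)" using vw by (simp add: wt_def algebra_simps)
      have "Z.mn (in_exp \<Delta> i) = mn (in_exp \<Delta> i)" "Z.mn (out_exp \<Delta> i) = mn (out_exp \<Delta> i)"
        using True ji0 by (auto intro!: mon_zx simp: in_exp_def out_exp_def narrows_self)
      then have P_z: "P = Z.mn (in_exp \<Delta> i) + Z.mn (out_exp \<Delta> i)" by (simp add: P_def exch_def)
      note binom = Z.exch_coprime_binomial[of wt j _ _ a c, unfolded exch_z, OF wt_add wt_j _ _ _ ac(1,2)]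
      show ?thesis
      proof (cases "wt (in_exp \<Delta> i) < wt (out_exp \<Delta> i)")
        case True
        show ?thesis
          by (rule binom[of "in_exp \<Delta> i" "out_exp \<Delta> i"])
            (use True ac(3) P_z in \<open>simp_all add: lexps_eq in_exp_lexps out_exp_lexps\<close>)
      next
        case False
        show ?thesis
          by (rule binom[of "out_exp \<Delta> i" "in_exp \<Delta> i"])
            (use False wt_i ac(3) P_z in \<open>simp_all add: lexps_eq in_exp_lexps out_exp_lexps add.commute\<close>)
      qed
    qed
    ultimately show ?thesis by blast
  next
    case False
    define b where "b = narrows \<Delta> i j"
    have b: "b > 0" using False by (simp add: b_def)
    \<comment> \<open>The exchange polynomials of the initial seed are
      \<open>D + C * x j ^ b\<close> at \<open>i\<close> and \<open>A * x i ^ b + B\<close> at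
      \<open>j\<close>. All four monomials are free of \<open>x i\<close> and \<open>x j\<close>,
      hence unchanged in the third cluster.\<close>
    define D where "D = mn (in_exp \<Delta> i)"
    define C where "C = mn ((out_exp \<Delta> i)(j := 0))"
    define A where "A = mn ((in_exp \<Delta> j)(i := 0))"
    define B where "B = mn (out_exp \<Delta> j)"
    have D_z: "D = Z.mn (in_exp \<Delta> i)"
      unfolding D_def using ji0 by (intro mon_zx[symmetric]) (auto simp: in_exp_def narrows_self)
    have C_z: "C = Z.mn ((out_exp \<Delta> i)(j := 0))"
      unfolding C_def using ij by (intro mon_zx[symmetric]) (auto simp: out_exp_def narrows_self)
    have A_z: "A = Z.mn ((in_exp \<Delta> j)(i := 0))"
      unfolding A_def using ij by (intro mon_zx[symmetric]) (auto simp: in_exp_def narrows_self)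
    have B_z: "B = Z.mn (out_exp \<Delta> j)"
      unfolding B_def using ji0 by (intro mon_zx[symmetric]) (auto simp: out_exp_def narrows_self)
    have exps_L: "in_exp \<Delta> i \<in> lexps \<Delta>z" "(out_exp \<Delta> i)(j := 0) \<in> lexps \<Delta>z" "(in_exp \<Delta> j)(i := 0) \<in> lexps \<Delta>z"
      using in_exp_lexps[of i] out_exp_lexps[of i] in_exp_lexps[of j]
      by (auto simp: lexps_eq) (auto simp: lexps_def exps_def)
    have D_L: "D \<in> Z.L" and C_L: "C \<in> Z.L" and A_L: "A \<in> Z.L"
      unfolding D_z C_z A_z by (intro Z.Sp_mon exps_L)+
    have P_eq: "P = D + C * x j ^ b"
      unfolding P_def exch_def D_def C_def mon_split[OF jV, of "out_exp \<Delta> i"]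
      by (simp add: out_exp_def b_def)
    have P_eq': "P = D + (C * x j ^ (b - 1)) * x j"
      using b power_minus_mult[of b "x j"] by (simp add: P_eq mult.assoc)
    have Cx_L: "C * x j ^ (b - 1) \<in> Z.L" by (intro subring_set_mult[OF sub] subring_set_power[OF sub] C_L xj_L)
    have coprime: "\<exists>d\<in>Z.L. a = P2 * d" if ac: "a \<in> Z.L" "c \<in> Z.L" "a * P = P2 * c" for a c
    proof (rule Z.exch_dvd_cancel_mon[of a _ "in_exp \<Delta> i" j, unfolded exch_z])
      show "c - a * (C * x j ^ (b - 1)) * inverse (z j) \<in> Z.L"
        by (intro subring_set_diff[OF sub] subring_set_mult[OF sub] ac C_L subring_set_power[OF sub] xj_L z_gens j)
      have "a * D = a * P - a * (C * x j ^ (b - 1)) * x j" by (simp add: P_eq' algebra_simps)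
      also have "\<dots> = P2 * c - a * (C * x j ^ (b - 1)) * (P2 * inverse (z j))" using ac(3) xj by simp
      also have "\<dots> = P2 * (c - a * (C * x j ^ (b - 1)) * inverse (z j))" by (simp add: algebra_simps)
      finally show "a * Z.mn (in_exp \<Delta> i) = P2 * (c - a * (C * x j ^ (b - 1)) * inverse (z j))"
        unfolding D_z .
    qed (fact ac exps_L)+
    obtain q where q: "q \<in> Z.L" "P ^ b = D ^ b + x j * q"
      using power_add_expand[OF sub D_L Cx_L xj_L, of b] unfolding P_eq'[symmetric] by blast
    \<comment> \<open>Modulo \<open>x j\<close> the variable \<open>x i\<close> equals
      \<open>D * inverse (z i)\<close>. Substituting this into \<open>A * x i ^ b + B\<close> gives
      \<open>Z.mn g * P2\<close>: away from \<open>i\<close>, the minimum in \<open>g\<close> is the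
      common factor lost when mutation cancels 2-cycles, and at \<open>i\<close> the exponent
      \<open>- int b\<close> comes from the inverse of \<open>z i\<close>.\<close>
    define g where "g = (\<lambda>v. if v = i then - int b
      else min (int (narrows \<Delta> v j) + int b * int (narrows \<Delta> v i)) (int (narrows \<Delta> j v)))"
    have g_L: "g \<in> lexps \<Delta>z"
      using narrows_outside i iV by (auto simp: lexps_eq) (auto simp: g_def lexps_def exps_def)
    have int_diff: "int (m - n) = max 0 (int m - int n)" for m n by simp
    have in_y: "in_exp \<Delta>y j v = (if v = i then 0 else max 0
        (int (narrows \<Delta> v j) + int b * int (narrows \<Delta> v i) - int (narrows \<Delta> j v)))" for v
      using ij ji0 j by (auto simp: in_exp_def \<Delta>y_def mutate_quiver_def Let_def b_def)
        (simp_all add: int_diff mult.commute)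
    have out_y: "out_exp \<Delta>y j v = (if v = i then int b else max 0
        (int (narrows \<Delta> j v) - (int (narrows \<Delta> v j) + int b * int (narrows \<Delta> v i))))" for v
      using ij ji0 j by (auto simp: out_exp_def \<Delta>y_def mutate_quiver_def Let_def b_def)
        (simp_all add: int_diff mult.commute)
    define m1 where "m1 = (\<lambda>v. ((in_exp \<Delta> j)(i := 0)) v + (int b * in_exp \<Delta> i v + uexp i (- int b) v))"
    have m1: "m1 = g + in_exp \<Delta>y j"
    proof
      fix v show "m1 v = (g + in_exp \<Delta>y j) v"
        by (simp add: m1_def g_def in_y) (auto simp: in_exp_def uexp_def narrows_self)
    qed
    have m2: "out_exp \<Delta> j = g + out_exp \<Delta>y j"
    proof
      fix v show "out_exp \<Delta> j v = (g + out_exp \<Delta>y j) v"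
        by (simp add: g_def out_y) (auto simp: out_exp_def ji0)
    qed
    have "Z.mn (\<lambda>v. int b * in_exp \<Delta> i v) = D ^ b"
      unfolding D_z lmon_def by (simp add: power_int_mult mult.commute[of "int b"] prod_power_distrib)
    moreover have "m1 = (in_exp \<Delta> j)(i := 0) + ((\<lambda>v. int b * in_exp \<Delta> i v) + uexp i (- int b))"
      by (auto simp: m1_def fun_eq_iff)
    ultimately have mon_m1: "Z.mn m1 = A * (D ^ b * z i powi (- int b))"
      using Z.mon_add Z.mon_uexp[of i "- int b"] iV by (simp add: A_z nodes_eq)
    have "P2 = Z.mn (in_exp \<Delta>y j) + Z.mn (out_exp \<Delta>y j)"
      unfolding P2_def exch_def by (subst (1 2) mon_zy) (simp_all add: Y.in_exp_self Y.out_exp_self)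
    then have crux: "A * (D ^ b * z i powi (- int b)) + B = Z.mn g * P2"
      unfolding mon_m1[symmetric] B_z m1 m2 Z.mon_add by (simp add: algebra_simps)
    \<comment> \<open>Expanding \<open>P ^ b\<close> as \<open>D ^ b + x j * q\<close> leaves a
      multiple of \<open>x j\<close> plus \<open>Z.mn g * P2\<close>. The latter is also a multiple
      of \<open>x j\<close>, because \<open>P2\<close> equals \<open>z j * x j\<close>.\<close>
    have "exch \<Delta> x j = A * x i ^ b + B"
      unfolding exch_def A_def B_def mon_split[OF iV, of "in_exp \<Delta> j"] by (simp add: in_exp_def b_def)
    also have "x i ^ b = P ^ b * z i powi (- int b)"
      unfolding xi by (simp add: power_mult_distrib power_int_minus power_inverse)
    finally have "exch \<Delta> x j = A * z i powi (- int b) * q * x j + Z.mn g * P2"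
      unfolding crux[symmetric] q(2) by (simp add: algebra_simps)
    then have "exch \<Delta> x j / x j = A * z i powi (- int b) * q + Z.mn g * z j"
      using nz[OF jV] by (simp add: zj field_simps)
    also have "\<dots> \<in> Z.L"
      by (intro subring_set_add[OF sub] subring_set_mult[OF sub] A_L q Z.Sp_mon g_L z_gens jV
          subring_set_power_int_nonpos[OF sub] i) auto
    finally show ?thesis using coprime by blast
  qed
  obtain M where M: "P2 ^ M * f \<in> Z.L"
    using Y.laurent_clear_denominator[of j f] j f(2) LZ Y.laurent_ring_eq_Sp
    by (auto simp: nodes_eq P2_def y_def z_def \<Delta>y_def)
  \<comment> \<open>Among the generators for the pair of seeds adjacent at \<open>j\<close>, only
    \<open>inverse (x i)\<close> needs a denominator, since it equals
    \<open>z i / P\<close>.\<close>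
  have "f \<in> {f. \<exists>N. P ^ N * f \<in> Z.L}"
  proof (rule adjacent_laurent_subset[OF j f(1,3)])
    show "subring_set {f. \<exists>N. P ^ N * f \<in> Z.L}" by (rule subring_set_localization[OF sub P_L])
    show "range \<iota> \<subseteq> {f. \<exists>N. P ^ N * f \<in> Z.L}" using in_localization[OF Z.L_gens(1)] by blast
    show "x v \<in> {f. \<exists>N. P ^ N * f \<in> Z.L}" if "v \<in> V" for v
      using in_localization[OF x_L[OF that]] .
    show "inverse (x v) \<in> {f. \<exists>N. P ^ N * f \<in> Z.L}" if "v \<in> U" "v \<noteq> j" for v
    proof (cases "v = i")
      case True
      have "P ^ 1 * inverse (x v) = z i" by (simp add: zi True field_simps)
      then have "P ^ 1 * inverse (x v) \<in> Z.L" using z_gens(1)[OF iV] by simp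
      then show ?thesis by blast
    next
      case False
      then show ?thesis using in_localization[OF z_gens(2)[OF that(1)]] zv[OF False that(2)] by simp
    qed
    show "exch \<Delta> x j / x j \<in> {f. \<exists>N. P ^ N * f \<in> Z.L}" using in_localization key by blast
  qed
  then obtain N where N: "P ^ N * f \<in> Z.L" by blast
  have "f \<in> Z.L"
    by (rule in_if_coprime_denominators[OF sub P2_L P_L P20 _ M N]) (use key in blast)
  then show ?thesis using LZ by (simp add: z_def y_def \<Delta>y_def)
qed

text \<open>Arrows from \<open>j\<close> to \<open>i\<close> are turned around by passing to the
  opposite quiver.\<close>

lemma laurent_ring_two_step:
  assumes i: "i \<in> U" and j: "j \<in> U" and ij: "i \<noteq> j"
    and nonprop: "\<exists>v w.
      (in_exp \<Delta> i - out_exp \<Delta> i) v * (in_exp \<Delta> j - out_exp \<Delta> j) w \<noteq>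
      (in_exp \<Delta> i - out_exp \<Delta> i) w * (in_exp \<Delta> j - out_exp \<Delta> j) v"
    and f: "f \<in> L" "f \<in> laurent_ring \<iota> \<Delta> (mutate_cluster i \<Delta> x)"
      "f \<in> laurent_ring \<iota> \<Delta> (mutate_cluster j \<Delta> x)"
  shows "f \<in> laurent_ring \<iota> \<Delta> (mutate_cluster j (mutate_quiver i \<Delta>) (mutate_cluster i \<Delta> x))"
proof (cases "narrows \<Delta> j i = 0")
  case True
  then show ?thesis using laurent_ring_two_step_oriented[OF i j ij] nonprop f by blast
next
  case False
  then have ij0: "narrows \<Delta> i j = 0" using narrows_antisym[of i j] by simp
  interpret O: seed \<iota> "opp \<Delta>" x
    using laurent_axioms ice by (simp add: seed_def seed_axioms_def is_ice_quiver_opp)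
  have "f \<in> laurent_ring \<iota> (opp \<Delta>)
      (mutate_cluster j (mutate_quiver i (opp \<Delta>)) (mutate_cluster i (opp \<Delta>) x))"
    by (rule O.laurent_ring_two_step_oriented[OF _ _ ij])
      (use False ij0 f i j in \<open>simp_all add: mutate_cluster_opp laurent_ring_opp lexps_def\<close>)
  then show ?thesis by (simp add: mutate_cluster_opp mutate_quiver_opp laurent_ring_opp)
qed

lemma mutate_cluster_involution:
  assumes "u \<in> U"
  shows "mutate_cluster u (mutate_quiver u \<Delta>) (mutate_cluster u \<Delta> x) = x"
  using exch_mutate[OF assms] nz[of u] assms U_sub exch_nonzero[of u]
  by (auto simp: mutate_cluster_exch fun_eq_iff)

text \<open>If all 2 by 2 minors of rows \<open>i\<close> and \<open>j\<close> vanished, then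
  \<open>d j w\<close> times row \<open>i\<close> minus \<open>d i w\<close> times row
  \<open>j\<close> would be zero; row \<open>i\<close> is nonzero, so some \<open>d i w\<close> is a
  nonzero coefficient.\<close>

lemma rows_not_proportional:
  assumes "rows_independent \<Delta>" and i: "i \<in> U" and j: "j \<in> U" and ij: "i \<noteq> j"
  shows "\<exists>v w. (in_exp \<Delta> i - out_exp \<Delta> i) v * (in_exp \<Delta> j - out_exp \<Delta> j) w \<noteq>
      (in_exp \<Delta> i - out_exp \<Delta> i) w * (in_exp \<Delta> j - out_exp \<Delta> j) v"
proof (rule ccontr)
  define d where "d u v = (of_nat (narrows \<Delta> u v) - of_nat (narrows \<Delta> v u) :: rat)" for u v
  have finU: "finite U" using fin U_sub by (rule rev_finite_subset)
  assume "\<not> ?thesis"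
  then have raw: "(in_exp \<Delta> i - out_exp \<Delta> i) v * (in_exp \<Delta> j - out_exp \<Delta> j) w =
      (in_exp \<Delta> i - out_exp \<Delta> i) w * (in_exp \<Delta> j - out_exp \<Delta> j) v" for v w
    by blast
  have *: "(int (narrows \<Delta> i v) - int (narrows \<Delta> v i)) * (int (narrows \<Delta> j w) - int (narrows \<Delta> w j)) =
      (int (narrows \<Delta> i w) - int (narrows \<Delta> w i)) * (int (narrows \<Delta> j v) - int (narrows \<Delta> v j))" for v w
    using raw[of v w] by (simp add: in_exp_def out_exp_def algebra_simps)
  have d: "d i v * d j w = d i w * d j v" for v w
    using arg_cong[OF *[of v w], of "of_int :: int \<Rightarrow> rat"] by (simp add: d_def)
  have two: "(\<Sum>u\<in>U. c u * d u v) = c i * d i v + c j * d j v" if "\<And>u. u \<noteq> i \<Longrightarrow> u \<noteq> j \<Longrightarrow> c u = 0" for c v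
  proof -
    have "(\<Sum>u\<in>U. c u * d u v) = (\<Sum>u\<in>{i, j}. c u * d u v)"
      using finU i j that by (intro sum.mono_neutral_right) auto
    then show ?thesis using ij by simp
  qed
  have rows: "\<forall>u\<in>U. c u = 0" if "\<forall>v\<in>V. (\<Sum>u\<in>U. c u * d u v) = 0" for c
    using assms(1) that unfolding rows_independent_def d_def by blast
  have "\<forall>u\<in>U. (if u = i then 1 else 0 :: rat) = 0" if "\<forall>w. d i w = 0"
    by (rule rows) (use that in \<open>simp add: two ij\<close>)
  then have "\<exists>w. d i w \<noteq> 0" using i by (metis zero_neq_one)
  then obtain w where w: "d i w \<noteq> 0" by blast
  have "\<forall>u\<in>U. (if u = i then d j w else if u = j then - d i w else 0) = 0"
    by (rule rows) (use ij in \<open>simp add: two d[of _ w] mult.commute[of "d j w"]\<close>)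
  then show False using w j ij by auto
qed

text \<open>Mutation acts on the B-matrix by invertible row and column operations. A relation
  between the new rows thus becomes one between the old rows, in which only the coefficient at
  \<open>k\<close> has changed.\<close>

lemma rows_independent_mutate:
  assumes ind: "rows_independent \<Delta>" and k: "k \<in> U"
  shows "rows_independent (mutate_quiver k \<Delta>)"
  unfolding rows_independent_def
proof (intro allI impI)
  define d where "d u v = (of_nat (narrows \<Delta> u v) - of_nat (narrows \<Delta> v u) :: rat)" for u v
  define d' where "d' u v = (of_nat (narrows (mutate_quiver k \<Delta>) u v) -
    of_nat (narrows (mutate_quiver k \<Delta>) v u) :: rat)" for u v
  have finU: "finite U" using fin U_sub by (rule rev_finite_subset)
  have kV: "k \<in> V" using k U_sub by blast
  fix c :: "'v \<Rightarrow> rat"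
  assume "\<forall>v\<in>nodes (mutate_quiver k \<Delta>). (\<Sum>u\<in>mutables (mutate_quiver k \<Delta>). c u *
    (of_nat (narrows (mutate_quiver k \<Delta>) u v) - of_nat (narrows (mutate_quiver k \<Delta>) v u))) = 0"
  then have c: "(\<Sum>u\<in>U. c u * d' u v) = 0" if "v \<in> V" for v using that by (simp add: d'_def)
  have d'_k: "d' u k = - d u k" "d' k u = - d k u" for u
    by (simp_all add: d'_def d_def mutate_quiver_def)
  have d': "d' u v = d u v + of_nat (narrows \<Delta> u k) * d k v + d u k * of_nat (narrows \<Delta> v k)"
    if "u \<in> U" "u \<noteq> k" "v \<noteq> k" for u v
  proof -
    have diff: "of_nat (m - n) - of_nat (n - m) = (of_nat m - of_nat n :: rat)" for m n
      by (cases "m \<le> n") (simp_all add: of_nat_diff)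
    show ?thesis
      using that unfolding d'_def d_def by (simp add: mutate_quiver_def Let_def diff algebra_simps)
  qed
  have ck: "(\<Sum>u\<in>U. c u * d u k) = 0"
    using c[OF kV] by (simp add: d'_k sum_negf)
  have dkk: "d k k = 0" by (simp add: d_def)
  have rows: "\<forall>u\<in>U. e u = 0" if "\<forall>v\<in>V. (\<Sum>u\<in>U. e u * d u v) = 0" for e
    using ind that unfolding rows_independent_def d_def by blast
  \<comment> \<open>\<open>s\<close> collects the multiples of row \<open>k\<close> that mutation
    adds to the other rows. The column operation contributes only multiples of column
    \<open>k\<close>, which disappear by the relation \<open>ck\<close>.\<close>
  define s where "s = (\<Sum>u\<in>U - {k}. c u * of_nat (narrows \<Delta> u k))"
  have "\<forall>u\<in>U. (c(k := s - c k)) u = 0"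
  proof (rule rows, intro ballI)
    fix v assume v: "v \<in> V"
    show "(\<Sum>u\<in>U. (c(k := s - c k)) u * d u v) = 0"
    proof (cases "v = k")
      case True
      have "(\<Sum>u\<in>U. (c(k := s - c k)) u * d u v) = (\<Sum>u\<in>U. c u * d u k)"
        by (intro sum.cong) (auto simp: True dkk)
      then show ?thesis using ck by simp
    next
      case False
      have ck': "(\<Sum>u\<in>U - {k}. c u * d u k) = 0"
        using ck k finU by (simp add: sum.remove[of U k] dkk)
      have "0 = c k * d' k v + (\<Sum>u\<in>U - {k}. c u * d' u v)"
        using c[OF v] k finU by (simp add: sum.remove[of U k])
      also have "(\<Sum>u\<in>U - {k}. c u * d' u v) =
          (\<Sum>u\<in>U - {k}. c u * d u v + c u * of_nat (narrows \<Delta> u k) * d k v + c u * d u k * of_nat (narrows \<Delta> v k))"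
        by (intro sum.cong) (auto simp: d' False algebra_simps)
      also have "\<dots> = (\<Sum>u\<in>U - {k}. c u * d u v) + s * d k v"
        by (simp add: sum.distrib s_def ck' flip: sum_distrib_right)
      finally have "(\<Sum>u\<in>U - {k}. c u * d u v) + (s - c k) * d k v = 0"
        by (simp add: d'_k algebra_simps)
      moreover have "(\<Sum>u\<in>U. (c(k := s - c k)) u * d u v) =
          (s - c k) * d k v + (\<Sum>u\<in>U - {k}. (c(k := s - c k)) u * d u v)"
        using k finU by (simp add: sum.remove[of U k])
      moreover have "(\<Sum>u\<in>U - {k}. (c(k := s - c k)) u * d u v) = (\<Sum>u\<in>U - {k}. c u * d u v)"
        by (intro sum.cong) auto
      ultimately show ?thesis by simp
    qed
  qed
  then have *: "c u = 0" if "u \<in> U" "u \<noteq> k" for u using that by (metis fun_upd_other)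
  then have "s = 0" by (simp add: s_def)
  then have "c k = 0" using \<open>\<forall>u\<in>U. (c(k := s - c k)) u = 0\<close> k by (metis diff_0 fun_upd_same neg_equal_0_iff_equal)
  then show "\<forall>u\<in>mutables (mutate_quiver k \<Delta>). c u = 0" using * by auto
qed

text \<open>Being Laurent in a seed and in all its neighbours is inherited by each neighbour:
  mutating back returns the seed itself, and mutating elsewhere is the two-step comparison.
  Independence of rows is carried along because that comparison uses it at every seed.\<close>

theorem upper_bound_subset_UCA:
  assumes ind: "rows_independent \<Delta>" and f: "f \<in> laurent_ring \<iota> \<Delta> x"
    "\<And>u. u \<in> U \<Longrightarrow> f \<in> laurent_ring \<iota> \<Delta> (mutate_cluster u \<Delta> x)"
  shows "f \<in> carrier (UCA \<iota> \<Delta> x)"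
proof -
  have "seed \<iota> \<Delta>' x' \<and> rows_independent \<Delta>' \<and> f \<in> laurent_ring \<iota> \<Delta>' x' \<and>
      (\<forall>u\<in>mutables \<Delta>'. f \<in> laurent_ring \<iota> \<Delta>' (mutate_cluster u \<Delta>' x'))"
    if "mutation_equivalent \<Delta> x \<Delta>' x'" for \<Delta>' x'
    using that
  proof (induction rule: mutation_equivalent.induct)
    case refl
    then show ?case using ind f seed_axioms by blast
  next
    case (step \<Delta>' x' u)
    then interpret S: seed \<iota> \<Delta>' x' by blast
    have "f \<in> laurent_ring \<iota> \<Delta>' (mutate_cluster w (mutate_quiver u \<Delta>') (mutate_cluster u \<Delta>' x'))"
      if "w \<in> S.U" for w
    proof (cases "w = u")
      case True
      then show ?thesis using S.mutate_cluster_involution[OF step(2)] step by simp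
    next
      case False
      then show ?thesis
        using S.laurent_ring_two_step[OF step(2) that _ S.rows_not_proportional] step that S.laurent_ring_eq_Sp
        by blast
    qed
    then show ?case using S.mutate_seed S.rows_independent_mutate step by simp
  qed
  then show ?thesis by (auto simp: UCA_def)
qed

end

section \<open>Deleting frozen vertices\<close>

text \<open>Rank here means column rank, so a maximal independent set of columns spans the whole
  space. The coefficients of a relation between rows form a vector orthogonal to all columns, hence
  to every vector.\<close>

lemma rows_independent_if_full_rank:
  fixes \<Delta> :: "'v::linorder ice_quiver"
  assumes ice: "is_ice_quiver \<Delta>" and rank: "full_rank \<Delta>"
  shows "rows_independent \<Delta>"
  unfolding rows_independent_def
proof (intro allI impI)
  fix c :: "'v \<Rightarrow> rat"
  assume c: "\<forall>v\<in>nodes \<Delta>. (\<Sum>u\<in>mutables \<Delta>. c u * (of_nat (narrows \<Delta> u v) - of_nat (narrows \<Delta> v u))) = 0"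
  define p where "p = card (mutables \<Delta>)"
  define us where "us = sorted_list_of_set (mutables \<Delta>)"
  define ns where "ns = sorted_list_of_set (nodes \<Delta>)"
  have fin: "finite (nodes \<Delta>)" "finite (mutables \<Delta>)"
    using ice by (auto simp: is_ice_quiver_def intro: finite_subset)
  have us: "set us = mutables \<Delta>" "distinct us" "length us = p"
    using fin by (auto simp: us_def p_def)
  have ns: "set ns = nodes \<Delta>" "length ns = card (nodes \<Delta>)"
    using fin by (auto simp: ns_def)
  interpret vec_space "TYPE(rat)" p .
  let ?B = "B_matrix \<Delta>"
  have B: "?B \<in> carrier_mat p (card (nodes \<Delta>))" by (simp add: B_matrix_def p_def)
  have Bij: "?B $$ (i, j) = of_nat (narrows \<Delta> (us ! i) (ns ! j)) - of_nat (narrows \<Delta> (ns ! j) (us ! i))"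
    if "i < p" "j < card (nodes \<Delta>)" for i j
    using that by (simp add: B_matrix_def p_def us_def ns_def Let_def)
  have cols: "set (cols ?B) \<subseteq> carrier_vec p" using cols_dim B by blast
  obtain S where S: "finite S" "maximal S (\<lambda>T. T \<subseteq> set (cols ?B) \<and> lin_indpt T)"
    using maximal_exists_superset[of "set (cols ?B)" "\<lambda>T. T \<subseteq> set (cols ?B) \<and> lin_indpt T" "{}"]
    by (auto simp: lin_dep_def)
  have S': "S \<subseteq> set (cols ?B)" "lin_indpt S" using S(2) by (auto simp: maximal_def)
  have "card S = p" using rank_card_indpt[OF B S(2)] rank by (simp add: full_rank_def p_def)
  then have "basis S"
    using S(1) S' cols by (intro dim_li_is_basis) (auto simp: dim_is_n)
  then have span_S: "span S = carrier_vec p" by (simp add: basis_def)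
  define w where "w = vec p (\<lambda>i. c (us ! i))"
  have w: "w \<in> carrier_vec p" by (simp add: w_def)
  have "col ?B j \<bullet> w = 0" if "j < card (nodes \<Delta>)" for j
  proof -
    have "col ?B j \<bullet> w = (\<Sum>i<p. ?B $$ (i, j) * c (us ! i))"
      using B that by (simp add: scalar_prod_def w_def lessThan_atLeast0)
    also have "\<dots> = (\<Sum>i<p. c (us ! i) * (of_nat (narrows \<Delta> (us ! i) (ns ! j)) - of_nat (narrows \<Delta> (ns ! j) (us ! i))))"
      by (intro sum.cong) (auto simp: Bij that)
    also have "\<dots> = (\<Sum>u\<in>set us. c u * (of_nat (narrows \<Delta> u (ns ! j)) - of_nat (narrows \<Delta> (ns ! j) u)))"
      using us(2,3) by (simp add: sum.distinct_set_conv_list sum_list_sum_nth lessThan_atLeast0)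
    also have "\<dots> = 0" using c us(1) ns that by (metis nth_mem)
    finally show ?thesis .
  qed
  then have "w \<in> orthogonal_complement S"
    using S'(1) B w by (fastforce simp: orthogonal_complement_def cols_def comm_scalar_prod[OF w])
  moreover have "S \<subseteq> carrier_vec p" using S'(1) cols by blast
  ultimately have "w \<in> orthogonal_complement (carrier_vec p)"
    using in_orthogonal_complement_span[of S] span_S by simp
  then have "w $ i = 0" if "i < p" for i
    using that w by (auto simp: orthogonal_complement_def dest: bspec[of _ _ "unit_vec p i"])
  then show "\<forall>u\<in>mutables \<Delta>. c u = 0"
    using us by (auto simp: w_def in_set_conv_nth simp flip: us(1))
qed

lemma lmon_subset:
  assumes "finite V" "W \<subseteq> V" "\<And>v. v \<in> V - W \<Longrightarrow> n v = 0"
  shows "lmon W x n = lmon V x n"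
  unfolding lmon_def using assms by (intro prod.mono_neutral_left) auto

lemma lspan_subset:
  assumes "finite V" "W \<subseteq> V" "E \<subseteq> exps W"
  shows "lspan \<iota> W x E = lspan \<iota> V x E"
proof -
  have "leval \<iota> W x p = leval \<iota> V x p" if "keys p \<subseteq> E" for p
    unfolding leval_def using that assms
    by (intro sum.cong arg_cong2[of _ _ _ _ "(*)"] lmon_subset) (auto simp: exps_def)
  then show ?thesis by (auto simp: lspan_def image_iff)
qed

context laurent
begin

lemma laurent_subset:
  assumes "W \<subseteq> V"
  shows "laurent \<iota> W x"
proof
  show "finite W" using assms fin by (rule finite_subset)
  show "x v \<noteq> 0" if "v \<in> W" for v using nz assms that by blast
  fix p assume p: "keys p \<subseteq> exps W" "leval \<iota> W x p = 0"
  have "leval \<iota> W x p = ev p"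
    unfolding leval_def using p(1) assms fin
    by (intro sum.cong arg_cong2[of _ _ _ _ "(*)"] lmon_subset) (auto simp: exps_def)
  then show "p = 0" using p assms by (intro indep) (auto simp: exps_def)
qed

text \<open>By uniqueness a single expansion satisfies all the support conditions. The separate set
  \<open>E\<close> covers an empty index set, which occurs when no vertex is attached.\<close>

lemma Sp_Inter:
  assumes "f \<in> Sp E" "E \<subseteq> exps V" "\<And>i. i \<in> I \<Longrightarrow> f \<in> Sp (F i)" "\<And>i. i \<in> I \<Longrightarrow> F i \<subseteq> exps V"
  shows "f \<in> Sp (E \<inter> (\<Inter>i\<in>I. F i))"
proof -
  obtain p where p: "keys p \<subseteq> E" "f = ev p" using assms(1) by (rule SpE)
  have "keys p \<subseteq> F i" if i: "i \<in> I" for i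
  proof -
    obtain q where q: "keys q \<subseteq> F i" "f = ev q" using assms(3)[OF i] by (rule SpE)
    have "p = q" using p q assms(2) assms(4)[OF i] by (intro ev_inj) auto
    then show ?thesis using q(1) by simp
  qed
  then have "keys p \<subseteq> E \<inter> (\<Inter>i\<in>I. F i)" using p(1) by blast
  then show ?thesis unfolding p(2) by (rule SpI)
qed

end

context seed
begin

text \<open>
  Both terms of the exchange polynomial at \<open>u\<close> involve \<open>vs\<close>, so the new variable at \<open>u\<close> has positive
  degree in \<open>vs\<close> and does not contribute to elements of degree 0.
\<close>

lemma nonneg_if_two_sided:
  assumes vs: "vs \<subseteq> V - U" and u: "u \<in> U" and v: "v1 \<in> vs" "v2 \<in> vs" "narrows \<Delta> v1 u > 0" "narrows \<Delta> u v2 > 0"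
    and f: "f \<in> L" "f \<in> laurent_ring \<iota> \<Delta> (mutate_cluster u \<Delta> x)" "f \<in> Sp E"
    and E: "E \<subseteq> {n \<in> exps V. \<forall>v\<in>vs. n v = 0}"
  shows "f \<in> Sp {n \<in> E. n u \<ge> 0}"
proof -
  \<comment> \<open>A negative power of \<open>x u\<close> is tolerated only if it is paid for by
    positive degree in \<open>vs\<close>. Degrees in \<open>vs\<close> are nonnegative because these
    vertices are frozen, so \<open>?E\<close> is closed under addition.\<close>
  let ?E = "{n \<in> lexps \<Delta>. n u \<ge> 0 \<or> (\<Sum>v\<in>vs. n v) > 0}"
  have fin_vs: "finite vs" using vs fin by (auto intro: finite_subset)
  have nonneg: "(\<Sum>v\<in>vs. n v) \<ge> 0" if "n \<in> lexps \<Delta>" for n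
    using that vs by (intro sum_nonneg) (auto simp: lexps_def)
  have uV: "u \<in> V" using u U_sub by blast
  have "f \<in> Sp ?E"
  proof (rule adjacent_laurent_subset[OF u f(1,2)])
    show "subring_set (Sp ?E)"
    proof (rule Sp_subring)
      show "m + n \<in> ?E" if "m \<in> ?E" "n \<in> ?E" for m n
        using that nonneg[of m] nonneg[of n] lexps_add[of m \<Delta> n] by (auto simp: sum.distrib)
    qed (simp add: lexps_zero)
    show "range \<iota> \<subseteq> Sp ?E" using Sp_const[of ?E] by (auto simp: lexps_zero)
    show "x v \<in> Sp ?E" if "v \<in> V" for v
    proof -
      have "uexp v 1 u \<ge> 0" by (simp add: uexp_def)
      then show ?thesis using Sp_mon[of "uexp v 1" ?E] uexp_lexps[of v 1] that by (simp add: mon_uexp)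
    qed
    show "inverse (x v) \<in> Sp ?E" if "v \<in> U" "v \<noteq> u" for v
    proof -
      have "uexp v (- 1) u \<ge> 0" using that(2) by (simp add: uexp_def)
      moreover have "v \<in> V" using that(1) U_sub by blast
      ultimately show ?thesis
        using Sp_mon[of "uexp v (- 1)" ?E] uexp_lexps[of v "- 1"] that(1)
        by (simp add: mon_uexp power_int_minus)
    qed
    have pos: "(\<Sum>v\<in>vs. n v) > 0" if "n \<in> lexps \<Delta>" "w \<in> vs" "n w > 0" for n w
      using that vs fin_vs by (intro sum_pos2[of vs w]) (auto simp: lexps_def)
    have "(\<Sum>v\<in>vs. uexp u (- 1) v) = 0" using vs u by (intro sum.neutral) (auto simp: uexp_def)
    then have shift: "n + uexp u (- 1) \<in> ?E" if "n \<in> lexps \<Delta>" "w \<in> vs" "n w > 0" for n w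
      using pos[OF that] that(1) lexps_add[OF _ uexp_lexps[of u "- 1"], of n] u uV by (simp add: sum.distrib)
    have "in_exp \<Delta> u + uexp u (- 1) \<in> ?E"
      by (rule shift[OF in_exp_lexps v(1)]) (simp add: in_exp_def v(3))
    moreover have "out_exp \<Delta> u + uexp u (- 1) \<in> ?E"
      by (rule shift[OF out_exp_lexps v(2)]) (simp add: out_exp_def v(4))
    ultimately have "mn (in_exp \<Delta> u + uexp u (- 1)) + mn (out_exp \<Delta> u + uexp u (- 1)) \<in> Sp ?E"
      by (intro Sp_add Sp_mon)
    then show "exch \<Delta> x u / x u \<in> Sp ?E"
      by (simp add: mon_add mon_uexp uV power_int_minus exch_def add_divide_distrib divide_inverse distrib_right)
  qed
  \<comment> \<open>The one-element index set specializes \<open>Sp_Inter\<close> to two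
    spans.\<close>
  then have "f \<in> Sp (E \<inter> (\<Inter>i\<in>{()}. ?E))"
    using f(3) E by (intro Sp_Inter) (auto simp: lexps_def)
  then show ?thesis by (rule Sp_mono[rotated]) (use E in auto)
qed

end

text \<open>\<open>two_sided\<close> is the only trace of the grading on the cluster side. It
  persists along mutations at unattached vertices, since these do not change the arrows between
  \<open>vs\<close> and mutable vertices.\<close>

locale frozen_deletion = seed \<iota> \<Delta> x
  for \<iota> :: "'k::field_char_0 \<Rightarrow> 'f::field" and \<Delta> :: "'v ice_quiver" and x :: "'v \<Rightarrow> 'f" +
  fixes vs us :: "'v set"
  assumes vs: "vs \<subseteq> V - U" and us_def: "us = attached \<Delta> vs"
    and two_sided: "\<And>u. u \<in> us \<Longrightarrow> (\<exists>v\<in>vs. narrows \<Delta> u v > 0) \<and> (\<exists>v\<in>vs. narrows \<Delta> v u > 0)"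
begin

text \<open>
  Mutation creates no arrows between frozen vertices, so after freezing \<open>us\<close> the two quivers keep
  agreeing only on arrows with an end that stays mutable.
\<close>

definition compatible :: "'v ice_quiver \<Rightarrow> 'v ice_quiver \<Rightarrow> bool" where
  "compatible \<Gamma> \<Gamma>' \<longleftrightarrow> nodes \<Gamma> = V \<and> mutables \<Gamma> = U \<and> nodes \<Gamma>' = V - vs \<and> mutables \<Gamma>' = U - us \<and>
    is_ice_quiver \<Gamma> \<and> is_ice_quiver \<Gamma>' \<and>
    (\<forall>v w. v \<notin> vs \<longrightarrow> w \<notin> vs \<longrightarrow> v \<in> U - us \<or> w \<in> U - us \<longrightarrow> narrows \<Gamma>' v w = narrows \<Gamma> v w) \<and>
    (\<forall>u\<in>U. \<forall>v\<in>vs. narrows \<Gamma> u v = narrows \<Delta> u v \<and> narrows \<Gamma> v u = narrows \<Delta> v u)"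

lemma us_sub: "us \<subseteq> U" by (auto simp: us_def attached_def)

lemma unattached: "w \<in> U - us \<Longrightarrow> v \<in> vs \<Longrightarrow> narrows \<Delta> w v = 0 \<and> narrows \<Delta> v w = 0"
  unfolding us_def attached_def by auto

lemma
  assumes "compatible \<Gamma> \<Gamma>'"
  shows compatible_sets: "nodes \<Gamma> = V" "mutables \<Gamma> = U" "nodes \<Gamma>' = V - vs" "mutables \<Gamma>' = U - us"
    and compatible_ice: "is_ice_quiver \<Gamma>" "is_ice_quiver \<Gamma>'"
    and compatible_narrows: "v \<notin> vs \<Longrightarrow> w \<notin> vs \<Longrightarrow> v \<in> U - us \<or> w \<in> U - us \<Longrightarrow> narrows \<Gamma>' v w = narrows \<Gamma> v w"
    and compatible_vs: "u \<in> U \<Longrightarrow> v \<in> vs \<Longrightarrow> narrows \<Gamma> u v = narrows \<Delta> u v"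
      "u \<in> U \<Longrightarrow> v \<in> vs \<Longrightarrow> narrows \<Gamma> v u = narrows \<Delta> v u"
  using assms unfolding compatible_def by blast+

lemma compatible_refl: "compatible \<Delta> (delete_freeze \<Delta> vs us)"
proof -
  have "U - vs - us = U - us" using vs by blast
  then show ?thesis using ice vs by (auto simp: compatible_def delete_freeze_def is_ice_quiver_def)
qed

lemma narrows_unattached:
  assumes "compatible \<Gamma> \<Gamma>'" "w \<in> U - us" "v \<in> vs"
  shows "narrows \<Gamma> w v = 0" "narrows \<Gamma> v w = 0"
  using unattached[OF assms(2,3)] compatible_vs[OF assms(1) _ assms(3), of w] assms(2) by auto

lemma compatible_exps:
  assumes c: "compatible \<Gamma> \<Gamma>'" and w: "w \<in> U - us"
  shows "in_exp \<Gamma>' w = in_exp \<Gamma> w" "out_exp \<Gamma>' w = out_exp \<Gamma> w"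
proof -
  have "narrows \<Gamma>' v w = narrows \<Gamma> v w \<and> narrows \<Gamma>' w v = narrows \<Gamma> w v" for v
  proof (cases "v \<in> vs")
    case True
    then have "v \<notin> nodes \<Gamma>'" by (simp add: compatible_sets(3)[OF c])
    then have "narrows \<Gamma>' v w = 0" "narrows \<Gamma>' w v = 0"
      using compatible_ice(2)[OF c] unfolding is_ice_quiver_def by (metis neq0_conv)+
    then show ?thesis using narrows_unattached[OF c w True] by simp
  next
    case False
    then show ?thesis using compatible_narrows[OF c, of v w] compatible_narrows[OF c, of w v] w vs by auto
  qed
  then show "in_exp \<Gamma>' w = in_exp \<Gamma> w" "out_exp \<Gamma>' w = out_exp \<Gamma> w"
    by (simp_all add: in_exp_def out_exp_def)
qed

lemma compatible_exch:
  assumes c: "compatible \<Gamma> \<Gamma>'" and w: "w \<in> U - us"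
  shows "exch \<Gamma>' y w = exch \<Gamma> y w"
proof -
  have "lmon (V - vs) y n = lmon V y n" if "\<And>v. v \<in> vs \<Longrightarrow> n v = 0" for n
    using that fin by (intro lmon_subset) auto
  then show ?thesis
    using narrows_unattached[OF c w]
    by (simp add: exch_def compatible_exps[OF c w] compatible_sets[OF c]) (simp add: in_exp_def out_exp_def)
qed

text \<open>The vertex \<open>w\<close> has no arrows to or from \<open>vs\<close>, so no path
  through \<open>w\<close> meets \<open>vs\<close>. For a pair of vertices with an end in
  \<open>U - us\<close>, both quivers add the same composite arrows.\<close>

lemma compatible_mutate:
  assumes c: "compatible \<Gamma> \<Gamma>'" and w: "w \<in> U - us"
  shows "compatible (mutate_quiver w \<Gamma>) (mutate_quiver w \<Gamma>')"
proof -
  have ag: "narrows \<Gamma>' v z = narrows \<Gamma> v z" if "v \<notin> vs" "z \<notin> vs" "v \<in> U - us \<or> z \<in> U - us" for v z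
    using compatible_narrows[OF c] that .
  have wvs: "w \<notin> vs" using w vs by blast
  have mut: "mutables \<Gamma> = U" "mutables \<Gamma>' = U - us" by (rule compatible_sets[OF c])+
  have anti: "narrows \<Gamma> v z = 0 \<or> narrows \<Gamma> z v = 0" for v z
    using compatible_ice(1)[OF c] by (simp add: is_ice_quiver_def)
  have "narrows (mutate_quiver w \<Gamma>') v z = narrows (mutate_quiver w \<Gamma>) v z"
    if vz: "v \<notin> vs" "z \<notin> vs" "v \<in> U - us \<or> z \<in> U - us" for v z
  proof -
    have "narrows \<Gamma>' v z = narrows \<Gamma> v z" "narrows \<Gamma>' z v = narrows \<Gamma> z v"
      "narrows \<Gamma>' v w = narrows \<Gamma> v w" "narrows \<Gamma>' w z = narrows \<Gamma> w z"
      "narrows \<Gamma>' z w = narrows \<Gamma> z w" "narrows \<Gamma>' w v = narrows \<Gamma> w v"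
      using vz w wvs by (auto intro!: ag)
    then show ?thesis using vz by (auto simp: mutate_quiver_def Let_def mut)
  qed
  moreover have "narrows (mutate_quiver w \<Gamma>) u v = narrows \<Delta> u v \<and> narrows (mutate_quiver w \<Gamma>) v u = narrows \<Delta> v u"
    if uv: "u \<in> U" "v \<in> vs" for u v
  proof -
    have "narrows \<Gamma> u v = narrows \<Delta> u v" "narrows \<Gamma> v u = narrows \<Delta> v u"
      using compatible_vs[OF c uv] by simp_all
    then show ?thesis
      using narrows_unattached[OF c w uv(2)] uv wvs anti[of u v]
      by (auto simp: mutate_quiver_def Let_def)
  qed
  moreover have "is_ice_quiver (mutate_quiver w \<Gamma>)" "is_ice_quiver (mutate_quiver w \<Gamma>')"
    using compatible_ice[OF c] w mut by (auto intro!: is_ice_quiver_mutate)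
  ultimately show ?thesis using compatible_sets[OF c] by (simp add: compatible_def)
qed

abbreviation "\<Delta>' \<equiv> delete_freeze \<Delta> vs us"

lemma lexps_compatible:
  assumes "compatible \<Gamma> \<Gamma>'"
  shows "lexps \<Gamma>' = {n \<in> lexps \<Gamma>. (\<forall>v\<in>vs. n v = 0) \<and> (\<forall>u\<in>us. n u \<ge> 0)}"
proof (intro Set.set_eqI iffI)
  fix n assume n: "n \<in> lexps \<Gamma>'"
  have zero: "n v = 0" if "v \<notin> V - vs" for v
    using n that by (simp add: lexps_def exps_def compatible_sets[OF assms])
  have nonneg: "n v \<ge> 0" if "v \<in> V" "v \<notin> U - us" for v
    using n that zero[of v] by (cases "v \<in> vs") (simp_all add: lexps_def exps_def compatible_sets[OF assms])
  have "n u \<ge> 0" if "u \<in> us" for u using nonneg[of u] that us_sub U_sub by auto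
  then show "n \<in> {n \<in> lexps \<Gamma>. (\<forall>v\<in>vs. n v = 0) \<and> (\<forall>u\<in>us. n u \<ge> 0)}"
    using zero nonneg by (simp add: lexps_def exps_def compatible_sets[OF assms])
next
  fix n assume n: "n \<in> {n \<in> lexps \<Gamma>. (\<forall>v\<in>vs. n v = 0) \<and> (\<forall>u\<in>us. n u \<ge> 0)}"
  then have "n v = 0" if "v \<notin> V - vs" for v
    using that compatible_sets[OF assms] by (cases "v \<in> vs") (auto simp: lexps_def exps_def)
  moreover have "n v \<ge> 0" if "v \<in> (V - vs) - (U - us)" for v
    using n that compatible_sets[OF assms] by (cases "v \<in> us") (auto simp: lexps_def)
  ultimately show "n \<in> lexps \<Gamma>'"
    by (simp add: lexps_def exps_def compatible_sets[OF assms])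
qed

lemma lexps_deleted: "lexps \<Delta>' = {n \<in> lexps \<Delta>. (\<forall>v\<in>vs. n v = 0) \<and> (\<forall>u\<in>us. n u \<ge> 0)}"
  by (rule lexps_compatible[OF compatible_refl])

lemma lspan_compatible:
  assumes "compatible \<Gamma> \<Gamma>'"
  shows "lspan \<iota> (V - vs) y (lexps \<Gamma>') = lspan \<iota> V y (lexps \<Gamma>')"
  using fin lexps_exps[of \<Gamma>'] compatible_sets[OF assms] by (intro lspan_subset) auto

lemma seed_compatible:
  assumes "compatible \<Gamma> \<Gamma>'" "seed \<iota> \<Gamma> y"
  shows "seed \<iota> \<Gamma>' y"
  using assms(2) laurent.laurent_subset[of \<iota> V y "V - vs"] compatible_ice[OF assms(1)]
  by (simp add: compatible_sets[OF assms(1)] seed_def seed_axioms_def)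

lemma laurent_ring_compatible:
  assumes "compatible \<Gamma> \<Gamma>'" "seed \<iota> \<Gamma> y"
  shows "laurent_ring \<iota> \<Gamma>' y = lspan \<iota> V y (lexps \<Gamma>')"
  using seed.laurent_ring_eq_Sp[OF seed_compatible[OF assms]] lspan_compatible[OF assms(1)]
  by (simp add: compatible_sets[OF assms(1)])

text \<open>Every seed of the smaller quiver shares its cluster with a compatible seed of
  \<open>\<Delta>\<close>, in which \<open>f\<close> is Laurent. Degree 0 in \<open>vs\<close> is
  passed on by clearing the denominator with the exchange polynomial, which is free of
  \<open>vs\<close>, and cancelling it again; nonnegativity at \<open>us\<close> is then obtained
  afresh in each seed.\<close>

lemma in_UCA_deleted:
  assumes f: "f \<in> carrier (UCA \<iota> \<Delta> x)" "f \<in> laurent_ring \<iota> \<Delta>' x"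
  shows "f \<in> carrier (UCA \<iota> \<Delta>' x)"
proof -
  have f_L: "f \<in> laurent_ring \<iota> \<Gamma> y" if "mutation_equivalent \<Delta> x \<Gamma> y" for \<Gamma> y
    using f(1) that by (auto simp: UCA_def)
  have "\<exists>\<Gamma>. mutation_equivalent \<Delta> x \<Gamma> y \<and> compatible \<Gamma> \<Gamma>' \<and> seed \<iota> \<Gamma> y \<and> f \<in> laurent_ring \<iota> \<Gamma>' y"
    if "mutation_equivalent \<Delta>' x \<Gamma>' y" for \<Gamma>' y
    using that
  proof (induction rule: mutation_equivalent.induct)
    case refl
    then show ?case using mutation_equivalent.refl compatible_refl seed_axioms f(2) by blast
  next
    case (step \<Gamma>' y w)
    then obtain \<Gamma> where \<Gamma>: "mutation_equivalent \<Delta> x \<Gamma> y" "compatible \<Gamma> \<Gamma>'" "seed \<iota> \<Gamma> y"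
      "f \<in> laurent_ring \<iota> \<Gamma>' y" by blast
    interpret S: seed \<iota> \<Gamma> y by (rule \<Gamma>(3))
    interpret S': seed \<iota> \<Gamma>' y by (rule seed_compatible[OF \<Gamma>(2,3)])
    have nodes: "nodes \<Gamma> = V" "mutables \<Gamma> = U" "nodes \<Gamma>' = V - vs" "mutables \<Gamma>' = U - us"
      by (rule compatible_sets[OF \<Gamma>(2)])+
    have w: "w \<in> U - us" "w \<in> mutables \<Gamma>" using step(2) nodes by auto
    define \<Gamma>w where "\<Gamma>w = mutate_quiver w \<Gamma>"
    define z where "z = mutate_cluster w \<Gamma> y"
    have z': "mutate_cluster w \<Gamma>' y = z"
      by (simp add: z_def mutate_cluster_exch compatible_exch[OF \<Gamma>(2) w(1)])
    interpret Z: seed \<iota> \<Gamma>w z unfolding \<Gamma>w_def z_def by (rule S.mutate_seed[OF w(2)])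
    have equiv: "mutation_equivalent \<Delta> x \<Gamma>w z"
      unfolding \<Gamma>w_def z_def by (rule mutation_equivalent.step[OF \<Gamma>(1) w(2)])
    have comp: "compatible \<Gamma>w (mutate_quiver w \<Gamma>')"
      unfolding \<Gamma>w_def by (rule compatible_mutate[OF \<Gamma>(2) w(1)])
    have nodes_w: "nodes \<Gamma>w = V" "mutables \<Gamma>w = U" by (simp_all add: \<Gamma>w_def nodes)
    let ?P = "exch \<Gamma>w z w"
    have P: "exch \<Gamma>' y w = ?P"
      using compatible_exch[OF \<Gamma>(2) w(1)] S.exch_mutate[OF w(2)] by (simp add: \<Gamma>w_def z_def)
    have fZ: "f \<in> Z.L" using f_L[OF equiv] Z.laurent_ring_eq_Sp by simp
    obtain N where "?P ^ N * f \<in> laurent_ring \<iota> \<Gamma>' z"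
      using S'.laurent_clear_denominator[of w f] \<Gamma>(4) S'.laurent_ring_eq_Sp step(2) by (auto simp: P z')
    then have "?P ^ N * f \<in> laurent_ring \<iota> (mutate_quiver w \<Gamma>') z" by simp
    then have PN: "?P ^ N * f \<in> Z.Sp {n \<in> exps V. \<forall>v\<in>vs. n v = 0}"
      unfolding laurent_ring_compatible[OF comp Z.seed_axioms] nodes_w
      by (rule Z.Sp_mono[unfolded nodes_w, rotated])
        (use lexps_compatible[OF comp] lexps_exps[of \<Gamma>w] nodes_w in auto)
    have zero_vs: "in_exp \<Gamma>w w v = 0" "out_exp \<Gamma>w w v = 0" if "v \<in> vs" for v
      using narrows_unattached[OF comp w(1) that] by (simp_all add: in_exp_def out_exp_def)
    let ?A = "{n \<in> exps V. \<forall>v\<in>vs. n v = 0}"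
    have "f \<in> Z.Sp {n \<in> lexps \<Gamma>w. \<forall>v\<in>vs. n v = 0}"
    proof (rule Z.Sp_cancel_power[OF Z.exch_Sp Z.exch_nonzero fZ lexps_exps])
      show "m + n \<in> lexps \<Gamma>w" if "m \<in> {in_exp \<Gamma>w w, out_exp \<Gamma>w w}" "n \<in> lexps \<Gamma>w" for m n
        using that Z.in_exp_lexps[of w] Z.out_exp_lexps[of w] lexps_add[of m] by blast
      show "(\<forall>v\<in>vs. (m + n) v = 0) \<longleftrightarrow> (\<forall>v\<in>vs. n v = 0)" if "m \<in> {in_exp \<Gamma>w w, out_exp \<Gamma>w w}" for m n
        using that zero_vs by auto
    qed (use PN nodes_w in simp)
    then have fA: "f \<in> Z.Sp (lexps \<Gamma>w \<inter> ?A)"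
      by (rule Z.Sp_mono[rotated]) (use lexps_exps[of \<Gamma>w] nodes_w in auto)
    have "f \<in> Z.Sp {n \<in> lexps \<Gamma>w \<inter> ?A. n u \<ge> 0}" if u: "u \<in> us" for u
    proof -
      have uU: "u \<in> U" using u us_sub by blast
      obtain v1 v2 where "v1 \<in> vs" "v2 \<in> vs" "narrows \<Delta> v1 u > 0" "narrows \<Delta> u v2 > 0"
        using two_sided[OF u] by blast
      then have v: "v1 \<in> vs" "v2 \<in> vs" "narrows \<Gamma>w v1 u > 0" "narrows \<Gamma>w u v2 > 0"
        using compatible_vs[OF comp uU] by simp_all
      \<comment> \<open>This mutation exists only in the larger quiver, where \<open>u\<close> is
        still mutable.\<close>
      have "mutation_equivalent \<Delta> x (mutate_quiver u \<Gamma>w) (mutate_cluster u \<Gamma>w z)"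
        by (rule mutation_equivalent.step[OF equiv]) (simp add: nodes_w uU)
      then have "f \<in> laurent_ring \<iota> \<Gamma>w (mutate_cluster u \<Gamma>w z)" using f_L by fastforce
      then show ?thesis
        by (intro Z.nonneg_if_two_sided[OF _ _ v fZ _ fA]) (use uU vs nodes_w in auto)
    qed
    then have "f \<in> Z.Sp (lexps \<Gamma>w \<inter> ?A \<inter> (\<Inter>u\<in>us. {n \<in> lexps \<Gamma>w \<inter> ?A. n u \<ge> 0}))"
      by (intro Z.Sp_Inter fA) (use nodes_w in auto)
    then have "f \<in> Z.Sp (lexps (mutate_quiver w \<Gamma>'))"
      by (rule Z.Sp_mono[rotated]) (unfold lexps_compatible[OF comp], auto)
    then have "f \<in> laurent_ring \<iota> (mutate_quiver w \<Gamma>') z"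
      by (simp only: laurent_ring_compatible[OF comp Z.seed_axioms] nodes_w)
    then show ?case using equiv comp Z.seed_axioms z' by auto
  qed
  then show ?thesis by (auto simp: UCA_def)
qed

text \<open>By the upper bound theorem only the neighbours of the initial seed have to be checked,
  and those at unattached vertices are also neighbours in the smaller quiver.\<close>

lemma UCA_deleted_subset:
  assumes ind: "rows_independent \<Delta>" and f: "f \<in> carrier (UCA \<iota> \<Delta>' x)"
  shows "f \<in> carrier (UCA \<iota> \<Delta> x)" "f \<in> laurent_ring \<iota> \<Delta>' x"
proof -
  have f_L: "f \<in> laurent_ring \<iota> \<Gamma> y" if "mutation_equivalent \<Delta>' x \<Gamma> y" for \<Gamma> y
    using f that by (auto simp: UCA_def)
  show f0: "f \<in> laurent_ring \<iota> \<Delta>' x" by (rule f_L[OF mutation_equivalent.refl])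
  show "f \<in> carrier (UCA \<iota> \<Delta> x)"
  proof (rule upper_bound_subset_UCA[OF ind])
    have mono: "laurent_ring \<iota> \<Delta>' y \<subseteq> laurent_ring \<iota> \<Delta> y" for y
      unfolding laurent_ring_def
      by (rule generate_ring_least[OF subring_set_generate]) (auto simp: delete_freeze_def intro: generate_ring.incl)
    then show "f \<in> laurent_ring \<iota> \<Delta> x" using f0 by blast
    fix u assume u: "u \<in> U"
    define y where "y = mutate_cluster u \<Delta> x"
    interpret Y: seed \<iota> "mutate_quiver u \<Delta>" y unfolding y_def by (rule mutate_seed[OF u])
    have L_y: "laurent_ring \<iota> \<Delta> y = Y.L" using Y.laurent_ring_eq_Sp by simp
    show "f \<in> laurent_ring \<iota> \<Delta> (mutate_cluster u \<Delta> x)"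
    proof (cases "u \<in> us")
      case False
      have "mutation_equivalent \<Delta>' x (mutate_quiver u \<Delta>') (mutate_cluster u \<Delta>' x)"
        using u False vs by (intro mutation_equivalent.intros) (auto simp: delete_freeze_def)
      from f_L[OF this] have "f \<in> laurent_ring \<iota> \<Delta>' y"
        using compatible_exch[OF compatible_refl, of u x] u False by (simp add: y_def mutate_cluster_exch)
      then show ?thesis using mono by (auto simp: y_def)
    next
      case True
      \<comment> \<open>In the smaller seed \<open>x u\<close> is frozen and not inverted, so
        \<open>f\<close> is polynomial in \<open>x u\<close>, which is Laurent in the cluster
        mutated at \<open>u\<close>.\<close>
      have "laurent_ring \<iota> \<Delta>' x \<subseteq> Y.L"
        unfolding laurent_ring_def
      proof (rule generate_ring_least[OF Y.Sp_lexps_subring])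
        have "x v \<in> Y.L" if "v \<in> V" for v
          using initial_in_mutated[OF u that] L_y by (simp add: y_def)
        moreover have "inverse (x v) \<in> Y.L" if "v \<in> U - us" for v
        proof -
          have "v \<noteq> u" using that True by blast
          then show ?thesis using Y.L_gens(3)[of v] that by (simp add: y_def mutate_cluster_exch)
        qed
        ultimately show "range \<iota> \<union> x ` nodes \<Delta>' \<union> (\<lambda>v. inverse (x v)) ` mutables \<Delta>' \<subseteq> Y.L"
          using Y.L_gens(1) by (auto simp: delete_freeze_def)
      qed
      then show ?thesis using f0 L_y by (auto simp: y_def)
    qed
  qed
qed

end

section \<open>Representations and vertex removal\<close>

text \<open>The additive inverse is a definite description, evaluated here directly on the bare
  record \<open>fun_ring S\<close>.\<close>

lemma fun_ring_uminus:
  assumes "f \<in> S \<rightarrow>\<^sub>E UNIV"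
  shows "\<ominus>\<^bsub>fun_ring S\<^esub> f = (\<lambda>s\<in>S. - f s)"
  unfolding a_inv_def m_inv_def
proof (rule the_equality)
  show "(\<lambda>s\<in>S. - f s) \<in> carrier (add_monoid (fun_ring S)) \<and>
    f \<otimes>\<^bsub>add_monoid (fun_ring S)\<^esub> (\<lambda>s\<in>S. - f s) = \<one>\<^bsub>add_monoid (fun_ring S)\<^esub> \<and>
    (\<lambda>s\<in>S. - f s) \<otimes>\<^bsub>add_monoid (fun_ring S)\<^esub> f = \<one>\<^bsub>add_monoid (fun_ring S)\<^esub>"
    by (auto simp: fun_ring_def fun_eq_iff)
next
  fix g assume g: "g \<in> carrier (add_monoid (fun_ring S)) \<and>
    f \<otimes>\<^bsub>add_monoid (fun_ring S)\<^esub> g = \<one>\<^bsub>add_monoid (fun_ring S)\<^esub> \<and>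
    g \<otimes>\<^bsub>add_monoid (fun_ring S)\<^esub> f = \<one>\<^bsub>add_monoid (fun_ring S)\<^esub>"
  show "g = (\<lambda>s\<in>S. - f s)"
  proof
    fix s show "g s = (\<lambda>s\<in>S. - f s) s"
    proof (cases "s \<in> S")
      case True
      have "(\<lambda>s\<in>S. f s + g s) s = (\<lambda>s\<in>S. 0) s" using g by (simp add: fun_ring_def)
      then show ?thesis using True by (simp add: eq_neg_iff_add_eq_0 add.commute)
    next
      case False
      then show ?thesis using g by (auto simp: fun_ring_def PiE_def extensional_def)
    qed
  qed
qed

text \<open>Ignoring values off \<open>Rep Q \<beta>\<close> lets polynomial functions be written as
  plain lambda terms.\<close>

definition polyfun ::
  "('q, 'a) pre_digraph \<Rightarrow> ('q \<Rightarrow> nat) \<Rightarrow> (('a \<Rightarrow> 'k::field mat) \<Rightarrow> 'k) \<Rightarrow> bool" where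
  "polyfun Q \<beta> F \<longleftrightarrow> restrict F (Rep Q \<beta>) \<in> poly_funs Q \<beta>"

lemma polyfun_cong: "(\<And>M. M \<in> Rep Q \<beta> \<Longrightarrow> F M = G M) \<Longrightarrow> polyfun Q \<beta> F \<Longrightarrow> polyfun Q \<beta> G"
  unfolding polyfun_def by (metis restrict_ext)

lemma poly_funs_extensional:
  assumes "f \<in> poly_funs Q \<beta>"
  shows "f \<in> Rep Q \<beta> \<rightarrow>\<^sub>E UNIV"
  using assms unfolding poly_funs_def
  by (induction rule: generate_ring.induct) (auto simp: fun_ring_uminus, auto simp: fun_ring_def)

lemma polyfun_const: "polyfun Q \<beta> (\<lambda>_. c)"
  unfolding polyfun_def poly_funs_def by (rule generate_ring.incl) auto

lemma polyfun_coord: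
  assumes "a \<in> arcs Q" "i < \<beta> (head Q a)" "j < \<beta> (tail Q a)"
  shows "polyfun Q \<beta> (\<lambda>M. M a $$ (i, j))"
  unfolding polyfun_def poly_funs_def using assms by (intro generate_ring.incl) auto

lemma polyfun_add: "polyfun Q \<beta> F \<Longrightarrow> polyfun Q \<beta> G \<Longrightarrow> polyfun Q \<beta> (\<lambda>M. F M + G M)"
  unfolding polyfun_def poly_funs_def
  by (drule (1) generate_ring.eng_add) (simp add: fun_ring_def cong: restrict_cong)

lemma polyfun_mult: "polyfun Q \<beta> F \<Longrightarrow> polyfun Q \<beta> G \<Longrightarrow> polyfun Q \<beta> (\<lambda>M. F M * G M)"
  unfolding polyfun_def poly_funs_def
  by (drule (1) generate_ring.eng_mult) (simp add: fun_ring_def cong: restrict_cong)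

lemma polyfun_sum: "(\<And>i. i \<in> I \<Longrightarrow> polyfun Q \<beta> (F i)) \<Longrightarrow> polyfun Q \<beta> (\<lambda>M. \<Sum>i\<in>I. F i M)"
  by (induction I rule: infinite_finite_induct) (auto intro: polyfun_const polyfun_add)

lemma poly_funs_induct [consumes 1, case_names const coord uminus add mult cong]:
  assumes f: "f \<in> poly_funs Q \<beta>"
    and const: "\<And>c. P (\<lambda>_. c)"
    and coord: "\<And>a i j. a \<in> arcs Q \<Longrightarrow> i < \<beta> (head Q a) \<Longrightarrow> j < \<beta> (tail Q a) \<Longrightarrow> P (\<lambda>M. M a $$ (i, j))"
    and uminus: "\<And>F. P F \<Longrightarrow> P (\<lambda>M. - F M)"
    and add: "\<And>F G. P F \<Longrightarrow> P G \<Longrightarrow> P (\<lambda>M. F M + G M)"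
    and mult: "\<And>F G. P F \<Longrightarrow> P G \<Longrightarrow> P (\<lambda>M. F M * G M)"
    and cong: "\<And>F G. P F \<Longrightarrow> (\<And>M. M \<in> Rep Q \<beta> \<Longrightarrow> F M = G M) \<Longrightarrow> P G"
  shows "P f"
proof -
  let ?S = "Rep Q \<beta>"
  have "f \<in> generate_ring (fun_ring ?S)
    (range (\<lambda>c. \<lambda>M\<in>?S. c) \<union>
      {\<lambda>M\<in>?S. M a $$ (i, j) | a i j. a \<in> arcs Q \<and> i < \<beta> (head Q a) \<and> j < \<beta> (tail Q a)})"
    using f by (simp add: poly_funs_def)
  then show ?thesis
  proof (induction rule: generate_ring.induct)
    case one
    show ?case by (rule cong[OF const[of 1]]) (simp add: fun_ring_def)
  next
    case (incl h)
    then consider c where "h = (\<lambda>M\<in>?S. c)"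
      | a i j where "a \<in> arcs Q" "i < \<beta> (head Q a)" "j < \<beta> (tail Q a)" "h = (\<lambda>M\<in>?S. M a $$ (i, j))"
      by blast
    then show ?case
    proof cases
      case 1
      show ?thesis by (rule cong[OF const]) (simp add: 1)
    next
      case 2
      show ?thesis by (rule cong[OF coord[OF 2(1-3)]]) (simp add: 2)
    qed
  next
    case (a_inv h)
    then have "h \<in> ?S \<rightarrow>\<^sub>E UNIV" using poly_funs_extensional[of h Q \<beta>] by (simp add: poly_funs_def)
    then show ?case by (intro cong[OF uminus[OF a_inv.IH]]) (simp add: fun_ring_uminus)
  next
    case (eng_add h g)
    show ?case by (rule cong[OF add[OF eng_add.IH]]) (simp add: fun_ring_def)
  next
    case (eng_mult h g)
    show ?case by (rule cong[OF mult[OF eng_mult.IH]]) (simp add: fun_ring_def)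
  qed
qed

lemma polyfun_compose:
  assumes f: "f \<in> poly_funs Q' \<beta>'"
    and maps: "\<And>M. M \<in> Rep Q \<beta> \<Longrightarrow> T M \<in> Rep Q' \<beta>'"
    and coords: "\<And>a i j. a \<in> arcs Q' \<Longrightarrow> i < \<beta>' (head Q' a) \<Longrightarrow> j < \<beta>' (tail Q' a) \<Longrightarrow>
      polyfun Q \<beta> (\<lambda>M. T M a $$ (i, j))"
  shows "polyfun Q \<beta> (\<lambda>M. f (T M))"
  using f
proof (induction rule: poly_funs_induct)
  case (uminus F)
  then show ?case using polyfun_mult[OF polyfun_const[of Q \<beta> "- 1"]] by simp
next
  case (cong F H)
  show ?case by (rule polyfun_cong[OF _ cong(1)]) (use cong(2) maps in auto)
qed (auto intro: polyfun_const polyfun_add polyfun_mult coords)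

text \<open>On a curve with polynomial coordinates, density reduces to a one-variable polynomial
  having only finitely many zeros.\<close>

lemma poly_funs_curve:
  assumes f: "f \<in> poly_funs Q \<beta>"
    and maps: "\<And>t :: 'k::field. T t \<in> Rep Q \<beta>"
    and coords: "\<And>a i j. a \<in> arcs Q \<Longrightarrow> i < \<beta> (head Q a) \<Longrightarrow> j < \<beta> (tail Q a) \<Longrightarrow>
      \<exists>p. \<forall>t. T t a $$ (i, j) = poly p t"
  shows "\<exists>p. \<forall>t. f (T t) = poly p t"
  using f
proof (induction rule: poly_funs_induct)
  case (const c)
  show ?case by (rule exI[of _ "[:c:]"]) simp
next
  case (uminus F)
  then obtain p where "\<forall>t. F (T t) = poly p t" by blast
  then show ?case by (intro exI[of _ "- p"]) simp
next
  case (add F G)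
  then obtain p q where "\<forall>t. F (T t) = poly p t" "\<forall>t. G (T t) = poly q t" by blast
  then show ?case by (intro exI[of _ "p + q"]) simp
next
  case (mult F G)
  then obtain p q where "\<forall>t. F (T t) = poly p t" "\<forall>t. G (T t) = poly q t" by blast
  then show ?case by (intro exI[of _ "p * q"]) simp
qed (use maps coords in auto)

section \<open>Invertible matrices and base change\<close>

definition minv :: "nat \<Rightarrow> 'k::field mat \<Rightarrow> 'k mat" where
  "minv n g = inv\<^bsub>ring_mat TYPE('k) n ()\<^esub> g"

abbreviation "MU n \<equiv> Units (ring_mat TYPE('k::field) n ())"

lemma ring_mat_monoid: "Group.monoid (ring_mat TYPE('k::field) n ())"
  using ring_mat[of n "()"] by (rule ring.is_monoid)

lemma MU_iff: "g \<in> MU n \<longleftrightarrow> g \<in> carrier_mat n n \<and> det g \<noteq> 0"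
  using det_non_zero_imp_unit[of g n "()"] unit_imp_det_non_zero[of g n "()"]
  by (auto simp: Units_def ring_mat_def)

lemma
  assumes "g \<in> MU n"
  shows MU_carrier: "g \<in> carrier_mat n n"
    and minv_carrier: "minv n g \<in> carrier_mat n n"
    and minv_left: "minv n g * g = 1\<^sub>m n"
    and minv_right: "g * minv n g = 1\<^sub>m n"
  using assms monoid.Units_inv_closed[OF ring_mat_monoid assms] monoid.Units_l_inv[OF ring_mat_monoid assms]
    monoid.Units_r_inv[OF ring_mat_monoid assms]
  by (auto simp: minv_def ring_mat_simps Units_def)

lemma minv_unique:
  assumes "g \<in> carrier_mat n n" "h \<in> carrier_mat n n" "g * h = 1\<^sub>m n" "h * g = 1\<^sub>m n"
  shows "minv n g = h"
  unfolding minv_def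
  by (rule monoid.inv_unique'[OF ring_mat_monoid, symmetric]) (use assms in \<open>simp_all add: ring_mat_simps\<close>)

lemma minv_one: "minv n (1\<^sub>m n) = 1\<^sub>m n"
  by (rule minv_unique) auto

lemma MU_one: "1\<^sub>m n \<in> MU n" by (simp add: MU_iff)

lemma MU_minv: "g \<in> MU n \<Longrightarrow> minv n g \<in> MU n"
  unfolding minv_def by (rule monoid.Units_inv_Units[OF ring_mat_monoid])

lemma MU_mult: "g \<in> MU n \<Longrightarrow> h \<in> MU n \<Longrightarrow> g * h \<in> MU n"
  using monoid.Units_m_closed[OF ring_mat_monoid, of g n h] by (simp add: ring_mat_simps)

lemma det_minv: "g \<in> MU n \<Longrightarrow> det (minv n g) * det g = 1"
  using det_mult[OF minv_carrier MU_carrier, of g n g] minv_left[of g n] by simp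

lemma minv_mult:
  assumes "g \<in> MU n" "h \<in> MU n"
  shows "minv n (g * h) = minv n h * minv n g"
proof (rule minv_unique)
  note c [simp] = MU_carrier[OF assms(1)] MU_carrier[OF assms(2)] minv_carrier[OF assms(1)] minv_carrier[OF assms(2)]
  show "g * h \<in> carrier_mat n n" "minv n h * minv n g \<in> carrier_mat n n"
    by (rule mult_carrier_mat[OF c(1,2)], rule mult_carrier_mat[OF c(4,3)])
  have "g * h * (minv n h * minv n g) = g * (h * minv n h) * minv n g"
    by (simp add: assoc_mult_mat[of _ n n _ n _ n] mult_carrier_mat[of _ n n _ n])
  then show "g * h * (minv n h * minv n g) = 1\<^sub>m n" using assms by (simp add: minv_right right_mult_one_mat[OF c(1)])
  have "minv n h * minv n g * (g * h) = minv n h * (minv n g * g) * h"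
    by (simp add: assoc_mult_mat[of _ n n _ n _ n] mult_carrier_mat[of _ n n _ n])
  then show "minv n h * minv n g * (g * h) = 1\<^sub>m n" using assms by (simp add: minv_left right_mult_one_mat[OF c(4)])
qed

lemma base_change_apply:
  "a \<in> arcs Q \<Longrightarrow> base_change Q \<beta> g M a = g (head Q a) * M a * minv (\<beta> (tail Q a)) (g (tail Q a))"
  by (simp add: base_change_def minv_def)

lemma Rep_carrier: "M \<in> Rep Q \<beta> \<Longrightarrow> a \<in> arcs Q \<Longrightarrow> M a \<in> carrier_mat (\<beta> (head Q a)) (\<beta> (tail Q a))"
  by (auto simp: Rep_def)

lemma GL_unit: "g \<in> GL Q \<beta> \<Longrightarrow> i \<in> verts Q \<Longrightarrow> g i \<in> MU (\<beta> i)"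
  by (auto simp: GL_def)

lemma Rep_eqI:
  assumes "M \<in> Rep Q \<beta>" "N \<in> Rep Q \<beta>" "\<And>a. a \<in> arcs Q \<Longrightarrow> M a = N a"
  shows "M = N"
  using assms unfolding Rep_def by (auto intro: PiE_ext)

context wf_digraph
begin

lemma base_change_Rep:
  assumes g: "g \<in> GL G \<beta>" and M: "M \<in> Rep G \<beta>"
  shows "base_change G \<beta> g M \<in> Rep G \<beta>"
  unfolding Rep_def
proof (rule PiE_I)
  fix a assume a: "a \<in> arcs G"
  have "g (head G a) \<in> MU (\<beta> (head G a))" "g (tail G a) \<in> MU (\<beta> (tail G a))"
    using GL_unit[OF g] a by simp_all
  then show "base_change G \<beta> g M a \<in> carrier_mat (\<beta> (head G a)) (\<beta> (tail G a))"
    unfolding base_change_apply[OF a] using Rep_carrier[OF M a] MU_carrier minv_carrier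
    by (intro mult_carrier_mat) auto
qed (simp add: base_change_def)

lemma base_change_mult:
  assumes g: "g \<in> GL G \<beta>" and h: "h \<in> GL G \<beta>" and M: "M \<in> Rep G \<beta>"
  shows "base_change G \<beta> g (base_change G \<beta> h M) = base_change G \<beta> (\<lambda>i\<in>verts G. g i * h i) M"
proof
  fix a
  show "base_change G \<beta> g (base_change G \<beta> h M) a = base_change G \<beta> (\<lambda>i\<in>verts G. g i * h i) M a"
  proof (cases "a \<in> arcs G")
    case a: True
    let ?m = "\<beta> (head G a)" and ?n = "\<beta> (tail G a)"
    have u: "g (head G a) \<in> MU ?m" "h (head G a) \<in> MU ?m" "g (tail G a) \<in> MU ?n" "h (tail G a) \<in> MU ?n"
      using GL_unit[OF g] GL_unit[OF h] a by simp_all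
    note c = MU_carrier[OF u(1)] MU_carrier[OF u(2)] minv_carrier[OF u(3)] minv_carrier[OF u(4)]
    note Ma = Rep_carrier[OF M a]
    have "g (head G a) * (h (head G a) * M a * minv ?n (h (tail G a))) * minv ?n (g (tail G a)) =
        g (head G a) * h (head G a) * M a * (minv ?n (h (tail G a)) * minv ?n (g (tail G a)))"
      using c Ma by (simp add: assoc_mult_mat[of _ ?m ?m _ ?m _ ?n] assoc_mult_mat[of _ ?m ?m _ ?n _ ?n]
          assoc_mult_mat[of _ ?m ?n _ ?n _ ?n] mult_carrier_mat[of _ ?m ?m _ ?n] mult_carrier_mat[of _ ?m ?n _ ?n]
          mult_carrier_mat[of _ ?m ?m _ ?m] mult_carrier_mat[of _ ?n ?n _ ?n])
    then show ?thesis using a u by (simp add: base_change_apply minv_mult)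
  qed (simp add: base_change_def)
qed

lemma polyfun_base_change:
  fixes g :: "'a \<Rightarrow> 'k::field mat"
  assumes g: "g \<in> GL G \<beta>" and f: "f \<in> poly_funs G \<beta>"
  shows "polyfun G \<beta> (\<lambda>M. f (base_change G \<beta> g M))"
proof (rule polyfun_compose[OF f base_change_Rep[OF g]])
  fix a i j assume a: "a \<in> arcs G" and ij: "i < \<beta> (head G a)" "j < \<beta> (tail G a)"
  let ?m = "\<beta> (head G a)" and ?n = "\<beta> (tail G a)"
  let ?h = "g (head G a)" and ?t = "minv ?n (g (tail G a))"
  have c: "?h \<in> carrier_mat ?m ?m" "?t \<in> carrier_mat ?n ?n"
    using GL_unit[OF g] a by (auto intro: MU_carrier minv_carrier)
  have "polyfun G \<beta> (\<lambda>M. \<Sum>k<?m. ?h $$ (i, k) * (\<Sum>l<?n. M a $$ (k, l) * ?t $$ (l, j)))"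
    using a by (intro polyfun_sum polyfun_mult polyfun_const polyfun_coord) auto
  then show "polyfun G \<beta> (\<lambda>M. base_change G \<beta> g M a $$ (i, j))"
  proof (rule polyfun_cong[rotated])
    fix M :: "'b \<Rightarrow> 'k mat" assume "M \<in> Rep G \<beta>"
    then have "M a \<in> carrier_mat ?m ?n" using a by (rule Rep_carrier)
    then show "(\<Sum>k<?m. ?h $$ (i, k) * (\<Sum>l<?n. M a $$ (k, l) * ?t $$ (l, j))) = base_change G \<beta> g M a $$ (i, j)"
      using c ij by (simp add: base_change_apply[OF a] scalar_prod_def lessThan_atLeast0)
  qed
qed

lemma GL_mult: "g \<in> GL G \<beta> \<Longrightarrow> h \<in> GL G \<beta> \<Longrightarrow> (\<lambda>i\<in>verts G. g i * h i) \<in> GL G \<beta>"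
  unfolding GL_def by (auto intro: MU_mult)

lemma GL_minv: "g \<in> GL G \<beta> \<Longrightarrow> (\<lambda>i\<in>verts G. minv (\<beta> i) (g i)) \<in> GL G \<beta>"
  unfolding GL_def by (auto intro: MU_minv)

text \<open>\<open>SL\<close> is normal in \<open>GL\<close>: moving \<open>s\<close> past
  \<open>g\<close> replaces it by its conjugate \<open>c\<close>, which again has determinant 1 at
  every vertex.\<close>

lemma SI_base_change:
  fixes g :: "'a \<Rightarrow> 'k::field mat"
  assumes f: "f \<in> carrier (SI G \<beta>)" and g: "g \<in> GL G \<beta>"
  shows "(\<lambda>M\<in>Rep G \<beta>. f (base_change G \<beta> g M)) \<in> carrier (SI G \<beta>)"
proof -
  have fp: "f \<in> poly_funs G \<beta>" and inv: "\<And>s M. s \<in> SL G \<beta> \<Longrightarrow> M \<in> Rep G \<beta> \<Longrightarrow> f (base_change G \<beta> s M) = f M"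
    using f by (auto simp: SI_def)
  have "f (base_change G \<beta> g (base_change G \<beta> s M)) = f (base_change G \<beta> g M)"
    if s: "s \<in> SL G \<beta>" and M: "M \<in> Rep G \<beta>" for s :: "'a \<Rightarrow> 'k mat" and M
  proof -
    have sG: "s \<in> GL G \<beta>" using s by (simp add: SL_def)
    define gi where "gi = (\<lambda>i\<in>verts G. minv (\<beta> i) (g i))"
    define gs where "gs = (\<lambda>i\<in>verts G. g i * s i)"
    define c where "c = (\<lambda>i\<in>verts G. gs i * gi i)"
    have GL12: "gi \<in> GL G \<beta>" "gs \<in> GL G \<beta>"
      unfolding gs_def gi_def by (rule GL_minv[OF g], rule GL_mult[OF g sG])
    have "c \<in> GL G \<beta>" unfolding c_def by (rule GL_mult[OF GL12(2,1)])
    note GL = GL12 this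
    have cg: "(\<lambda>i\<in>verts G. c i * g i) = gs"
    proof
      fix i show "(\<lambda>i\<in>verts G. c i * g i) i = gs i"
      proof (cases "i \<in> verts G")
        case True
        note u = GL_unit[OF g True] GL_unit[OF GL(2) True]
        have "gs i * minv (\<beta> i) (g i) * g i = gs i * (minv (\<beta> i) (g i) * g i)"
          by (rule assoc_mult_mat[OF MU_carrier[OF u(2)] minv_carrier[OF u(1)] MU_carrier[OF u(1)]])
        then show ?thesis using True MU_carrier[OF u(2)] by (simp add: c_def gi_def minv_left[OF u(1)])
      qed (use GL(2) in \<open>auto simp: GL_def\<close>)
    qed
    have "det (c i) = 1" if i: "i \<in> verts G" for i
    proof -
      note u = GL_unit[OF g i] GL_unit[OF sG i]
      have "det (c i) = det (g i) * det (s i) * det (minv (\<beta> i) (g i))"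
        using i MU_carrier[OF u(1)] MU_carrier[OF u(2)] minv_carrier[OF u(1)]
        by (simp add: c_def gs_def gi_def det_mult[of _ "\<beta> i"] mult_carrier_mat[of _ "\<beta> i" "\<beta> i" _ "\<beta> i"])
      then show ?thesis using det_minv[OF u(1)] s i by (simp add: SL_def mult.commute)
    qed
    then have cS: "c \<in> SL G \<beta>" using GL(3) by (simp add: SL_def)
    have "base_change G \<beta> g (base_change G \<beta> s M) = base_change G \<beta> gs M"
      unfolding gs_def by (rule base_change_mult[OF g sG M])
    also have "\<dots> = base_change G \<beta> c (base_change G \<beta> g M)"
      using base_change_mult[OF GL(3) g M] by (simp add: cg)
    finally show ?thesis using inv[OF cS base_change_Rep[OF g M]] by simp
  qed
  moreover have "base_change G \<beta> s M \<in> Rep G \<beta>" if "s \<in> SL G \<beta>" "M \<in> Rep G \<beta>"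
    for s :: "'a \<Rightarrow> 'k mat" and M
    using that by (simp add: SL_def base_change_Rep)
  ultimately show ?thesis
    using polyfun_base_change[OF g fp] by (simp add: SI_def polyfun_def)
qed

end

lemma sum_poly:
  assumes "\<And>k. k \<in> K \<Longrightarrow> \<exists>p. \<forall>t. F k t = poly p t"
  shows "\<exists>p. \<forall>t :: 'k::field. (\<Sum>k\<in>K. F k t) = poly p t"
proof -
  have "\<forall>k\<in>K. \<exists>p. \<forall>t. F k t = poly p t" using assms by blast
  then obtain P where "\<forall>k\<in>K. \<forall>t. F k t = poly (P k) t" by (metis (no_types) bchoice)
  then show ?thesis by (intro exI[of _ "\<Sum>k\<in>K. P k"]) (simp add: poly_sum)
qed

lemma char_matrix_poly:
  assumes "h \<in> carrier_mat d d" "i < d" "k < d"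
  shows "\<exists>p. \<forall>t :: 'k::field. char_matrix h t $$ (i, k) = poly p t"
  using assms by (intro exI[of _ "[:h $$ (i, k), if i = k then - 1 else 0:]"]) (auto simp: char_matrix_def)

lemma finite_singular_char_matrix:
  assumes "h \<in> carrier_mat d d"
  shows "finite {t :: 'k::field. char_matrix h t \<notin> MU d}"
proof -
  have "{t. char_matrix h t \<notin> MU d} \<subseteq> {t. poly (char_poly h) t = 0}"
    using assms eigenvalue_det[OF assms] eigenvalue_root_char_poly[OF assms] by (auto simp: MU_iff)
  moreover have "char_poly h \<noteq> 0" using degree_monic_char_poly[OF assms] by auto
  then have "finite {t. poly (char_poly h) t = 0}" by (rule poly_roots_finite)
  ultimately show ?thesis by (rule finite_subset)
qed

text \<open>The pairs \<open>(i, j)\<close> are injected by \<open>e\<close> into the basis indices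
  below \<open>d\<close>; \<open>K\<close> is the image and \<open>ie\<close> inverts
  \<open>e\<close> there.\<close>

lemma index_embedding:
  fixes n :: "'i \<Rightarrow> nat"
  assumes "finite I" "(\<Sum>i\<in>I. n i) \<le> d"
  shows "\<exists>e ie K. (\<forall>i\<in>I. \<forall>j<n i. ie (e i j) = (i, j) \<and> e i j < d \<and> e i j \<in> K) \<and>
    (\<forall>k\<in>K. fst (ie k) \<in> I \<and> snd (ie k) < n (fst (ie k)))"
proof -
  let ?D = "SIGMA i:I. {..<n i}"
  have "finite ?D" "card ?D \<le> card {..<d}" using assms by auto
  then obtain e where e: "inj_on e ?D" "e ` ?D \<subseteq> {..<d}"
    using inj_on_iff_card_le[of ?D "{..<d}"] by auto
  have "inv_into ?D e k \<in> ?D" if "k \<in> e ` ?D" for k by (rule inv_into_into[OF that])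
  then show ?thesis
    using e by (intro exI[of _ "\<lambda>i j. e (i, j)"] exI[of _ "inv_into ?D e"] exI[of _ "e ` ?D"]) fastforce
qed

text \<open>Without loops at \<open>r\<close> no arrow is both incoming and outgoing there, so the
  two families of maps can be changed independently.\<close>

locale vertex_removal = fin_digraph G for G :: "('q, 'a) pre_digraph" +
  fixes r :: 'q and \<beta> :: "'q \<Rightarrow> nat"
  assumes r: "r \<in> verts G" and noloop: "\<And>a. a \<in> arcs G \<Longrightarrow> tail G a = r \<Longrightarrow> head G a \<noteq> r"
begin

abbreviation "Q' \<equiv> remove_vertex G r"
abbreviation "d \<equiv> \<beta> r"

lemma remove_vertex_simps:
  "verts Q' = verts G - {r}"
  "Inl a \<in> arcs Q' \<longleftrightarrow> a \<in> arcs G \<and> tail G a \<noteq> r \<and> head G a \<noteq> r"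
  "Inr (a, b) \<in> arcs Q' \<longleftrightarrow> a \<in> arcs G \<and> head G a = r \<and> b \<in> arcs G \<and> tail G b = r"
  "tail Q' (Inl a) = tail G a" "head Q' (Inl a) = head G a"
  "tail Q' (Inr (a, b)) = tail G a" "head Q' (Inr (a, b)) = head G b"
  by (auto simp: remove_vertex_def)

lemma arcs_Q'_cases:
  assumes "c \<in> arcs Q'"
  obtains (Inl) a where "c = Inl a" "a \<in> arcs G" "tail G a \<noteq> r" "head G a \<noteq> r"
  | (Inr) a b where "c = Inr (a, b)" "a \<in> arcs G" "head G a = r" "b \<in> arcs G" "tail G b = r"
    "tail G a \<noteq> r" "head G b \<noteq> r"
proof (cases c)
  case (Inl a)
  then show ?thesis using assms that(1)[of a] by (simp add: remove_vertex_simps)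
next
  case (Inr p)
  then obtain a b where "c = Inr (a, b)" by (cases p) simp
  then show ?thesis
    using assms that(2)[of a b] noloop[of a] noloop[of b] by (auto simp: remove_vertex_simps)
qed

lemma wf_Q': "wf_digraph Q'"
proof
  fix c assume "c \<in> arcs Q'"
  then show "tail Q' c \<in> verts Q'" "head Q' c \<in> verts Q'"
    by (cases rule: arcs_Q'_cases; simp add: remove_vertex_simps)+
qed

text \<open>The products through \<open>r\<close> are the basic invariants of \<open>GL\<close> at
  \<open>r\<close> in the first fundamental theorem of invariant theory.\<close>

definition contract :: "('a \<Rightarrow> 'k::field mat) \<Rightarrow> ('a + 'a \<times> 'a) \<Rightarrow> 'k mat" where
  "contract M = (\<lambda>c\<in>arcs Q'. case c of Inl a \<Rightarrow> M a | Inr (a, b) \<Rightarrow> M b * M a)"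

lemma contract_apply:
  "Inl a \<in> arcs Q' \<Longrightarrow> contract M (Inl a) = M a"
  "Inr (a, b) \<in> arcs Q' \<Longrightarrow> contract M (Inr (a, b)) = M b * M a"
  by (simp_all add: contract_def)

lemma contract_Rep:
  assumes M: "M \<in> Rep G \<beta>"
  shows "contract M \<in> Rep Q' \<beta>"
  unfolding Rep_def
proof (rule PiE_I)
  fix c assume c: "c \<in> arcs Q'"
  then show "contract M c \<in> carrier_mat (\<beta> (head Q' c)) (\<beta> (tail Q' c))"
  proof (cases rule: arcs_Q'_cases)
    case (Inl a)
    then show ?thesis using c Rep_carrier[OF M, of a] by (simp add: contract_apply remove_vertex_simps(4-))
  next
    case (Inr a b)
    then show ?thesis
      using c Rep_carrier[OF M, of a] Rep_carrier[OF M, of b] mult_carrier_mat[of "M b" _ d "M a"]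
      by (simp add: contract_apply remove_vertex_simps(4-))
  qed
qed (simp add: contract_def)

lemma polyfun_contract:
  assumes f: "f \<in> poly_funs Q' \<beta>"
  shows "polyfun G \<beta> (\<lambda>M :: 'a \<Rightarrow> 'k::field mat. f (contract M))"
proof (rule polyfun_compose[OF f contract_Rep])
  fix c i j assume c: "c \<in> arcs Q'" and ij: "i < \<beta> (head Q' c)" "j < \<beta> (tail Q' c)"
  show "polyfun G \<beta> (\<lambda>M :: 'a \<Rightarrow> 'k mat. contract M c $$ (i, j))"
    using c
  proof (cases rule: arcs_Q'_cases)
    case (Inl a)
    then show ?thesis
      using c ij polyfun_coord[of a G i \<beta> j] by (simp add: contract_apply remove_vertex_simps(4-))
  next
    case (Inr a b)
    have eq: "(\<Sum>k<d. M b $$ (i, k) * M a $$ (k, j)) = contract M c $$ (i, j)" if M: "M \<in> Rep G \<beta>" for M :: "'a \<Rightarrow> 'k mat"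
      using c ij Inr Rep_carrier[OF M, of a] Rep_carrier[OF M, of b]
      by (simp add: contract_apply remove_vertex_simps(4-) scalar_prod_def lessThan_atLeast0)
    have "polyfun G \<beta> (\<lambda>M :: 'a \<Rightarrow> 'k mat. \<Sum>k<d. M b $$ (i, k) * M a $$ (k, j))"
      using ij Inr by (intro polyfun_sum polyfun_mult polyfun_coord) (auto simp: remove_vertex_simps(4-))
    then show ?thesis by (rule polyfun_cong[rotated]) (rule eq)
  qed
qed

text \<open>In every composite through \<open>r\<close> the factor \<open>g r\<close> meets its
  inverse, so \<open>g'\<close> has to agree with \<open>g\<close> only away from
  \<open>r\<close>.\<close>

lemma contract_base_change:
  assumes g: "g \<in> GL G \<beta>" and g': "\<And>i. i \<in> verts Q' \<Longrightarrow> g' i = g i" and M: "M \<in> Rep G \<beta>"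
  shows "contract (base_change G \<beta> g M) = base_change Q' \<beta> g' (contract M)"
proof
  fix c
  show "contract (base_change G \<beta> g M) c = base_change Q' \<beta> g' (contract M) c"
  proof (cases "c \<in> arcs Q'")
    case c: True
    then show ?thesis
    proof (cases rule: arcs_Q'_cases)
      case (Inl a)
      then show ?thesis
        using c g' by (simp add: contract_apply base_change_apply remove_vertex_simps(1,4-))
    next
      case (Inr a b)
      let ?m = "\<beta> (head G b)" and ?n = "\<beta> (tail G a)"
      have u: "g (head G b) \<in> MU ?m" "g (tail G a) \<in> MU ?n" "g r \<in> MU d"
        using GL_unit[OF g] Inr r by simp_all
      note ca = MU_carrier[OF u(1)] minv_carrier[OF u(2)] MU_carrier[OF u(3)] minv_carrier[OF u(3)]
      have Mab: "M b \<in> carrier_mat ?m d" "M a \<in> carrier_mat d ?n"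
        using Rep_carrier[OF M] Inr by fastforce+
      note assoc = assoc_mult_mat[of _ ?m ?m _ d _ d] assoc_mult_mat[of _ ?m d _ d _ d]
        assoc_mult_mat[of _ ?m d _ d _ ?n] assoc_mult_mat[of _ d d _ d _ ?n] assoc_mult_mat[of _ d d _ ?n _ ?n]
        assoc_mult_mat[of _ ?m ?m _ d _ ?n] assoc_mult_mat[of _ ?m ?m _ ?n _ ?n] assoc_mult_mat[of _ ?m d _ ?n _ ?n]
      note carr = mult_carrier_mat[of _ ?m ?m _ d] mult_carrier_mat[of _ ?m d _ d] mult_carrier_mat[of _ d d _ d]
        mult_carrier_mat[of _ d d _ ?n] mult_carrier_mat[of _ d ?n _ ?n] mult_carrier_mat[of _ ?m d _ ?n]
        mult_carrier_mat[of _ ?m ?n _ ?n]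
      have cancel: "minv d (g r) * (g r * X) = X" if "X \<in> carrier_mat d ?n" for X
        using that ca minv_left[OF u(3)] assoc_mult_mat[of "minv d (g r)" d d "g r" d X ?n] by simp
      have "(g (head G b) * M b * minv d (g r)) * (g r * M a * minv ?n (g (tail G a))) =
          g (head G b) * (M b * M a) * minv ?n (g (tail G a))"
        using ca Mab by (simp add: assoc carr cancel)
      then show ?thesis
        using c Inr g' by (simp add: contract_apply base_change_apply remove_vertex_simps(1,4-))
    qed
  qed (simp add: contract_def base_change_def)
qed

definition at_r :: "'k::field mat \<Rightarrow> 'q \<Rightarrow> 'k mat" where
  "at_r h = (\<lambda>i\<in>verts G. if i = r then h else 1\<^sub>m (\<beta> i))"

definition r_invariant :: "(('a \<Rightarrow> 'k::field mat) \<Rightarrow> 'k) \<Rightarrow> bool" where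
  "r_invariant f \<longleftrightarrow> (\<forall>h\<in>MU d. \<forall>M\<in>Rep G \<beta>. f (base_change G \<beta> (at_r h) M) = f M)"

lemma at_r_GL: "h \<in> MU d \<Longrightarrow> at_r h \<in> GL G \<beta>"
  unfolding GL_def at_r_def by (auto simp: MU_one)

text \<open>Together with \<open>scale_out\<close> this splits base change at \<open>r\<close> into
  two halves without inverses, which make sense for singular \<open>h\<close>.\<close>

definition scale_in :: "'k::field mat \<Rightarrow> ('a \<Rightarrow> 'k mat) \<Rightarrow> 'a \<Rightarrow> 'k mat" where
  "scale_in h M = (\<lambda>a\<in>arcs G. if head G a = r then h * M a else M a)"

definition scale_out :: "'k::field mat \<Rightarrow> ('a \<Rightarrow> 'k mat) \<Rightarrow> 'a \<Rightarrow> 'k mat" where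
  "scale_out h M = (\<lambda>a\<in>arcs G. if tail G a = r then M a * h else M a)"

lemma
  assumes h: "h \<in> carrier_mat d d" and M: "M \<in> Rep G \<beta>"
  shows scale_in_Rep: "scale_in h M \<in> Rep G \<beta>" and scale_out_Rep: "scale_out h M \<in> Rep G \<beta>"
proof -
  have "h * M a \<in> carrier_mat d (\<beta> (tail G a))" if "a \<in> arcs G" "head G a = r" for a
    using Rep_carrier[OF M that(1)] that(2) h by (intro mult_carrier_mat) auto
  moreover have "M a * h \<in> carrier_mat (\<beta> (head G a)) d" if "a \<in> arcs G" "tail G a = r" for a
    using Rep_carrier[OF M that(1)] that(2) h by (intro mult_carrier_mat) auto
  ultimately show "scale_in h M \<in> Rep G \<beta>" "scale_out h M \<in> Rep G \<beta>"
    using M unfolding Rep_def scale_in_def scale_out_def by (auto simp: PiE_iff)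
qed

text \<open>Base change by \<open>h\<close> at \<open>r\<close> multiplies outgoing maps on the
  right by the inverse of \<open>h\<close>, which undoes \<open>scale_out\<close>, and incoming maps
  on the left by \<open>h\<close>.\<close>

lemma scale_in_eq_base_change:
  assumes h: "h \<in> MU d" and M: "M \<in> Rep G \<beta>"
  shows "scale_in h M = base_change G \<beta> (at_r h) (scale_out h M)"
proof
  fix a
  show "scale_in h M a = base_change G \<beta> (at_r h) (scale_out h M) a"
  proof (cases "a \<in> arcs G")
    case a: True
    note Ma = Rep_carrier[OF M a]
    have tv: "tail G a \<in> verts G" "head G a \<in> verts G" using a by auto
    consider "tail G a = r" "head G a \<noteq> r" | "head G a = r" "tail G a \<noteq> r" | "tail G a \<noteq> r" "head G a \<noteq> r"
      using noloop[OF a] by blast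
    then show ?thesis
    proof cases
      case 1
      have "M a * h * minv d h = M a * (h * minv d h)"
        using Ma 1 MU_carrier[OF h] minv_carrier[OF h] by (intro assoc_mult_mat) auto
      then have "M a * h * minv d h = M a" using Ma 1 by (simp add: minv_right[OF h])
      moreover have "M a * h \<in> carrier_mat (\<beta> (head G a)) d"
        using Ma 1 MU_carrier[OF h] by (intro mult_carrier_mat) auto
      then have "1\<^sub>m (\<beta> (head G a)) * (M a * h) = M a * h" by (rule left_mult_one_mat)
      ultimately show ?thesis
        using a 1 tv r by (simp add: scale_in_def scale_out_def base_change_apply at_r_def)
    next
      case 2
      have "h * M a \<in> carrier_mat d (\<beta> (tail G a))"
        using Ma 2 MU_carrier[OF h] by (intro mult_carrier_mat) auto
      then have "h * M a * 1\<^sub>m (\<beta> (tail G a)) = h * M a" by (rule right_mult_one_mat)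
      then show ?thesis
        using a 2 tv r by (simp add: scale_in_def scale_out_def base_change_apply at_r_def minv_one)
    next
      case 3
      then show ?thesis
        using a Ma tv by (simp add: scale_in_def scale_out_def base_change_apply at_r_def minv_one)
    qed
  qed (simp add: scale_in_def base_change_def)
qed

text \<open>
  For invertible \<open>h\<close> this is invariance under \<open>h\<close>; the line \<open>h - t\<close> meets the invertible matrices
  in a cofinite set, so both sides, polynomial in \<open>t\<close>, agree at \<open>t = 0\<close> too.
\<close>

lemma r_invariant_scale:
  fixes f :: "('a \<Rightarrow> 'k::field_char_0 mat) \<Rightarrow> 'k"
  assumes f: "f \<in> poly_funs G \<beta>" "r_invariant f" and h: "h \<in> carrier_mat d d" and M: "M \<in> Rep G \<beta>"
  shows "f (scale_in h M) = f (scale_out h M)"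
proof -
  let ?c = "char_matrix h"
  have c: "?c t \<in> carrier_mat d d" for t using h by simp
  have const: "\<exists>p. \<forall>t :: 'k. z = poly p t" for z by (rule exI[of _ "[:z:]"]) simp
  have times: "\<exists>p. \<forall>t. F t * z = poly p t" if "\<exists>p. \<forall>t :: 'k. F t = poly p t" for F z
    using that by (metis mult.commute poly_smult)
  have "\<exists>p. \<forall>t. f (scale_in (?c t) M) = poly p t"
  proof (rule poly_funs_curve[OF f(1) scale_in_Rep[OF c M]])
    fix a i j assume a: "a \<in> arcs G" and ij: "i < \<beta> (head G a)" "j < \<beta> (tail G a)"
    note Ma = Rep_carrier[OF M a]
    show "\<exists>p. \<forall>t. scale_in (?c t) M a $$ (i, j) = poly p t"
    proof (cases "head G a = r")
      case True
      have "\<exists>p. \<forall>t. (\<Sum>k<d. ?c t $$ (i, k) * M a $$ (k, j)) = poly p t"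
        using h ij True by (intro sum_poly times char_matrix_poly) auto
      moreover have "scale_in (?c t) M a $$ (i, j) = (\<Sum>k<d. ?c t $$ (i, k) * M a $$ (k, j))" for t
        using a ij True Ma c[of t] by (simp add: scale_in_def scalar_prod_def lessThan_atLeast0)
      ultimately show ?thesis by simp
    qed (use a const in \<open>simp add: scale_in_def\<close>)
  qed
  then obtain p where p: "f (scale_in (?c t) M) = poly p t" for t by blast
  have "\<exists>p. \<forall>t. f (scale_out (?c t) M) = poly p t"
  proof (rule poly_funs_curve[OF f(1) scale_out_Rep[OF c M]])
    fix a i j assume a: "a \<in> arcs G" and ij: "i < \<beta> (head G a)" "j < \<beta> (tail G a)"
    note Ma = Rep_carrier[OF M a]
    show "\<exists>p. \<forall>t. scale_out (?c t) M a $$ (i, j) = poly p t"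
    proof (cases "tail G a = r")
      case True
      have "\<exists>p. \<forall>t. (\<Sum>k<d. ?c t $$ (k, j) * M a $$ (i, k)) = poly p t"
        using h ij True by (intro sum_poly times char_matrix_poly) auto
      moreover have "scale_out (?c t) M a $$ (i, j) = (\<Sum>k<d. ?c t $$ (k, j) * M a $$ (i, k))" for t
        using a ij True Ma c[of t] by (simp add: scale_out_def scalar_prod_def lessThan_atLeast0 mult.commute)
      ultimately show ?thesis by simp
    qed (use a const in \<open>simp add: scale_out_def\<close>)
  qed
  then obtain q where q: "f (scale_out (?c t) M) = poly q t" for t by blast
  have "poly (p - q) t = 0" if "?c t \<in> MU d" for t
    using f(2) that M scale_in_eq_base_change[OF that M] scale_out_Rep[OF c M, of t] p[of t] q[of t]
    by (simp add: r_invariant_def)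
  then have "- {t. ?c t \<notin> MU d} \<subseteq> {t. poly (p - q) t = 0}" by auto
  moreover have "infinite (- {t. ?c t \<notin> MU d})"
    using finite_singular_char_matrix[OF h] finite_compl infinite_UNIV_char_0 by blast
  ultimately have "p - q = 0" using poly_roots_finite finite_subset by blast
  moreover have "?c 0 = h" using h by (auto simp: char_matrix_def)
  ultimately show ?thesis using p[of 0] q[of 0] by simp
qed

text \<open>By the last clause, invariant polynomial functions factor through
  \<open>contract\<close>. They do so although \<open>s (contract M)\<close> need not lie in the
  orbit of \<open>M\<close> under \<open>GL\<close> at \<open>r\<close>.\<close>

definition is_section :: "((('a + 'a \<times> 'a) \<Rightarrow> 'k::field mat) \<Rightarrow> ('a \<Rightarrow> 'k mat)) \<Rightarrow> bool" where
  "is_section s \<longleftrightarrow> (\<forall>N\<in>Rep Q' \<beta>. s N \<in> Rep G \<beta> \<and> contract (s N) = N) \<and>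
    (\<forall>a\<in>arcs G. \<forall>i j. i < \<beta> (head G a) \<longrightarrow> j < \<beta> (tail G a) \<longrightarrow> polyfun Q' \<beta> (\<lambda>N. s N a $$ (i, j))) \<and>
    (\<forall>f M. f \<in> poly_funs G \<beta> \<longrightarrow> r_invariant f \<longrightarrow> M \<in> Rep G \<beta> \<longrightarrow> f (s (contract M)) = f M)"

lemma delta_sum:
  fixes F :: "nat \<Rightarrow> 'k::field"
  assumes "m < n"
  shows "(\<Sum>k = 0..<n. F k * (if k = m then 1 else 0)) = F m" "(\<Sum>k = 0..<n. (if k = m then 1 else 0) * F k) = F m"
  using assms by (simp_all add: if_distrib[of "\<lambda>z. _ * z"] if_distrib[of "\<lambda>z. z * _"] sum.delta cong: if_cong)

lemma Rep_Q'_carrier: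
  assumes "N \<in> Rep Q' \<beta>"
  shows "a \<in> arcs G \<Longrightarrow> tail G a \<noteq> r \<Longrightarrow> head G a \<noteq> r \<Longrightarrow> N (Inl a) \<in> carrier_mat (\<beta> (head G a)) (\<beta> (tail G a))"
    "a \<in> arcs G \<Longrightarrow> head G a = r \<Longrightarrow> b \<in> arcs G \<Longrightarrow> tail G b = r \<Longrightarrow>
      N (Inr (a, b)) \<in> carrier_mat (\<beta> (head G b)) (\<beta> (tail G a))"
  using Rep_carrier[OF assms, of "Inl a"] Rep_carrier[OF assms, of "Inr (a, b)"]
  by (simp_all add: remove_vertex_simps)

lemma contract_eqI:
  assumes N: "N \<in> Rep Q' \<beta>" and M: "M \<in> Rep G \<beta>"
    and "\<And>a. a \<in> arcs G \<Longrightarrow> tail G a \<noteq> r \<Longrightarrow> head G a \<noteq> r \<Longrightarrow> M a = N (Inl a)"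
    and "\<And>a b. a \<in> arcs G \<Longrightarrow> head G a = r \<Longrightarrow> b \<in> arcs G \<Longrightarrow> tail G b = r \<Longrightarrow> M b * M a = N (Inr (a, b))"
  shows "contract M = N"
proof (rule Rep_eqI[OF contract_Rep[OF M] N])
  fix c assume "c \<in> arcs Q'"
  then show "contract M c = N c"
    using assms(3,4) by (cases rule: arcs_Q'_cases) (auto simp: contract_apply remove_vertex_simps)
qed

text \<open>
  Embed the disjoint union of bases of the spaces at the tails of the incoming arrows into the
  standard basis at \<open>r\<close> by \<open>e\<close>, with \<open>E a\<close> the resulting injections.  Every family of incoming maps
  is \<open>h * E a\<close> for one square matrix \<open>h\<close>, which an \<open>r\<close>-invariant function allows to be moved to the
  outgoing side.
\<close>

lemma section_in:
  assumes le: "(\<Sum>a | a \<in> arcs G \<and> head G a = r. \<beta> (tail G a)) \<le> d"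
  shows "\<exists>s :: (('a + 'a \<times> 'a) \<Rightarrow> 'k::field_char_0 mat) \<Rightarrow> ('a \<Rightarrow> 'k mat). is_section s"
proof -
  let ?I = "{a \<in> arcs G. head G a = r}"
  obtain e ie K where e: "\<forall>i\<in>?I. \<forall>j<\<beta> (tail G i). ie (e i j) = (i, j) \<and> e i j < d \<and> e i j \<in> K"
    "\<forall>k\<in>K. fst (ie k) \<in> ?I \<and> snd (ie k) < \<beta> (tail G (fst (ie k)))"
    using index_embedding[of ?I "\<lambda>i. \<beta> (tail G i)" d] le by auto
  have ie: "ie (e a j) = (a, j)" "e a j < d" "e a j \<in> K"
    if "a \<in> arcs G" "head G a = r" "j < \<beta> (tail G a)" for a j
    using that e(1) by simp_all
  have ie_D: "fst (ie k) \<in> arcs G" "head G (fst (ie k)) = r" "snd (ie k) < \<beta> (tail G (fst (ie k)))"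
    if "k \<in> K" for k
    using that e(2) by simp_all
  define E :: "'a \<Rightarrow> 'k mat" where "E a = mat d (\<beta> (tail G a)) (\<lambda>(k, j). if k = e a j then 1 else 0)" for a
  define B :: "(('a + 'a \<times> 'a) \<Rightarrow> 'k mat) \<Rightarrow> 'a \<Rightarrow> 'k mat" where
    "B N b = mat (\<beta> (head G b)) d
      (\<lambda>(i, k). if k \<in> K then N (Inr (fst (ie k), b)) $$ (i, snd (ie k)) else 0)" for N b
  define s where "s N = (\<lambda>a\<in>arcs G. if head G a = r then E a else if tail G a = r then B N a else N (Inl a))" for N
  have s_Rep: "s N \<in> Rep G \<beta>" if N: "N \<in> Rep Q' \<beta>" for N
    using Rep_Q'_carrier(1)[OF N] unfolding Rep_def by (auto simp: s_def E_def B_def)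
  have "contract (s N) = N" if N: "N \<in> Rep Q' \<beta>" for N
  proof (rule contract_eqI[OF N s_Rep[OF N]])
    fix a b assume ab: "a \<in> arcs G" "head G a = r" "b \<in> arcs G" "tail G b = r"
    have "B N b * E a = N (Inr (a, b))"
      using Rep_Q'_carrier(2)[OF N ab] ie[OF ab(1,2)]
      by (intro eq_matI) (auto simp: B_def E_def scalar_prod_def delta_sum)
    then show "s N b * s N a = N (Inr (a, b))" using ab noloop by (auto simp: s_def)
  qed (simp add: s_def)
  moreover have "polyfun Q' \<beta> (\<lambda>N. s N a $$ (i, j))"
    if a: "a \<in> arcs G" and ij: "i < \<beta> (head G a)" "j < \<beta> (tail G a)" for a i j
  proof -
    consider "head G a = r" | "head G a \<noteq> r" "tail G a = r" "j \<in> K" | "head G a \<noteq> r" "tail G a = r" "j \<notin> K"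
      | "head G a \<noteq> r" "tail G a \<noteq> r" by blast
    then show ?thesis
    proof cases
      case 2
      then show ?thesis
        using a ij ie_D[OF 2(3)] polyfun_coord[of "Inr (fst (ie j), a)" Q' i \<beta> "snd (ie j)"]
        by (simp add: s_def B_def remove_vertex_simps)
    next
      case 4
      then show ?thesis
        using a ij polyfun_coord[of "Inl a" Q' i \<beta> j] by (simp add: s_def remove_vertex_simps)
    qed (use a ij in \<open>auto simp: s_def E_def B_def intro: polyfun_const\<close>)
  qed
  moreover have "f (s (contract M)) = f M" if f: "f \<in> poly_funs G \<beta>" "r_invariant f" and M: "M \<in> Rep G \<beta>" for f M
  proof -
    \<comment> \<open>Column \<open>e a j\<close> of \<open>h\<close> is column \<open>j\<close> of
      \<open>M a\<close>; columns outside \<open>K\<close> are filled with 0.\<close>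
    define h where "h = mat d d (\<lambda>(i, k). if k \<in> K then M (fst (ie k)) $$ (i, snd (ie k)) else 0)"
    define M0 where "M0 = (\<lambda>a\<in>arcs G. if head G a = r then E a else M a)"
    have h: "h \<in> carrier_mat d d" by (simp add: h_def)
    have M0: "M0 \<in> Rep G \<beta>" using Rep_carrier[OF M] unfolding Rep_def by (auto simp: M0_def E_def)
    have "scale_in h M0 = M"
    proof (rule Rep_eqI[OF scale_in_Rep[OF h M0] M])
      fix a assume a: "a \<in> arcs G"
      have "h * E a = M a" if ar: "head G a = r"
        using Rep_carrier[OF M a] ar ie[OF a ar]
        by (intro eq_matI) (auto simp: h_def E_def scalar_prod_def delta_sum)
      then show "scale_in h M0 a = M a" using a by (simp add: scale_in_def M0_def)
    qed
    moreover have "scale_out h M0 = s (contract M)"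
    proof (rule Rep_eqI[OF scale_out_Rep[OF h M0] s_Rep[OF contract_Rep[OF M]]])
      fix b assume b: "b \<in> arcs G"
      have "M b * h = B (contract M) b" if br: "tail G b = r"
      proof (rule eq_matI)
        fix i k assume "i < dim_row (B (contract M) b)" "k < dim_col (B (contract M) b)"
        then have ik: "i < \<beta> (head G b)" "k < d" by (simp_all add: B_def)
        note Mb = Rep_carrier[OF M b]
        show "(M b * h) $$ (i, k) = B (contract M) b $$ (i, k)"
        proof (cases "k \<in> K")
          case True
          note D = ie_D[OF True]
          have "Inr (fst (ie k), b) \<in> arcs Q'" using D b br by (simp add: remove_vertex_simps)
          then have "contract M (Inr (fst (ie k), b)) = M b * M (fst (ie k))" by (rule contract_apply)
          then show ?thesis
            using ik True Mb br D Rep_carrier[OF M D(1)] by (simp add: B_def h_def scalar_prod_def)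
        next
          case False
          then show ?thesis using ik Mb br by (simp add: B_def h_def scalar_prod_def)
        qed
      qed (use Rep_carrier[OF M b] br in \<open>simp_all add: B_def h_def\<close>)
      then show "scale_out h M0 b = s (contract M) b"
        using b noloop[OF b] by (auto simp: scale_out_def M0_def s_def contract_apply remove_vertex_simps)
    qed
    ultimately show ?thesis using r_invariant_scale[OF f h M0] by simp
  qed
  ultimately show ?thesis using s_Rep unfolding is_section_def by blast
qed

text \<open>The dual construction: \<open>F b\<close> projects onto the block of basis vectors
  reserved for the head of \<open>b\<close>. Outgoing maps have the form \<open>F b * h\<close>, and
  \<open>h\<close> is moved to the incoming side.\<close>

lemma section_out:
  assumes le: "(\<Sum>b | b \<in> arcs G \<and> tail G b = r. \<beta> (head G b)) \<le> d"
  shows "\<exists>s :: (('a + 'a \<times> 'a) \<Rightarrow> 'k::field_char_0 mat) \<Rightarrow> ('a \<Rightarrow> 'k mat). is_section s"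
proof -
  let ?I = "{b \<in> arcs G. tail G b = r}"
  obtain e ie K where e: "\<forall>i\<in>?I. \<forall>j<\<beta> (head G i). ie (e i j) = (i, j) \<and> e i j < d \<and> e i j \<in> K"
    "\<forall>k\<in>K. fst (ie k) \<in> ?I \<and> snd (ie k) < \<beta> (head G (fst (ie k)))"
    using index_embedding[of ?I "\<lambda>i. \<beta> (head G i)" d] le by auto
  have ie: "ie (e b i) = (b, i)" "e b i < d" "e b i \<in> K"
    if "b \<in> arcs G" "tail G b = r" "i < \<beta> (head G b)" for b i
    using that e(1) by simp_all
  have ie_D: "fst (ie k) \<in> arcs G" "tail G (fst (ie k)) = r" "snd (ie k) < \<beta> (head G (fst (ie k)))"
    if "k \<in> K" for k
    using that e(2) by simp_all
  define F :: "'a \<Rightarrow> 'k mat" where "F b = mat (\<beta> (head G b)) d (\<lambda>(i, k). if k = e b i then 1 else 0)" for b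
  define A :: "(('a + 'a \<times> 'a) \<Rightarrow> 'k mat) \<Rightarrow> 'a \<Rightarrow> 'k mat" where
    "A N a = mat d (\<beta> (tail G a))
      (\<lambda>(k, j). if k \<in> K then N (Inr (a, fst (ie k))) $$ (snd (ie k), j) else 0)" for N a
  define s where "s N = (\<lambda>a\<in>arcs G. if tail G a = r then F a else if head G a = r then A N a else N (Inl a))" for N
  have s_Rep: "s N \<in> Rep G \<beta>" if N: "N \<in> Rep Q' \<beta>" for N
    using Rep_Q'_carrier(1)[OF N] unfolding Rep_def by (auto simp: s_def F_def A_def)
  have "contract (s N) = N" if N: "N \<in> Rep Q' \<beta>" for N
  proof (rule contract_eqI[OF N s_Rep[OF N]])
    fix a b assume ab: "a \<in> arcs G" "head G a = r" "b \<in> arcs G" "tail G b = r"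
    have "F b * A N a = N (Inr (a, b))"
      using Rep_Q'_carrier(2)[OF N ab] ie[OF ab(3,4)]
      by (intro eq_matI) (auto simp: A_def F_def scalar_prod_def delta_sum)
    then show "s N b * s N a = N (Inr (a, b))" using ab noloop by (auto simp: s_def)
  qed (simp add: s_def)
  moreover have "polyfun Q' \<beta> (\<lambda>N. s N a $$ (i, j))"
    if a: "a \<in> arcs G" and ij: "i < \<beta> (head G a)" "j < \<beta> (tail G a)" for a i j
  proof -
    consider "tail G a = r" | "tail G a \<noteq> r" "head G a = r" "i \<in> K" | "tail G a \<noteq> r" "head G a = r" "i \<notin> K"
      | "head G a \<noteq> r" "tail G a \<noteq> r" by blast
    then show ?thesis
    proof cases
      case 2
      then show ?thesis
        using a ij ie_D[OF 2(3)] polyfun_coord[of "Inr (a, fst (ie i))" Q' "snd (ie i)" \<beta> j]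
        by (simp add: s_def A_def remove_vertex_simps)
    next
      case 4
      then show ?thesis
        using a ij polyfun_coord[of "Inl a" Q' i \<beta> j] by (simp add: s_def remove_vertex_simps)
    qed (use a ij in \<open>auto simp: s_def F_def A_def intro: polyfun_const\<close>)
  qed
  moreover have "f (s (contract M)) = f M" if f: "f \<in> poly_funs G \<beta>" "r_invariant f" and M: "M \<in> Rep G \<beta>" for f M
  proof -
    \<comment> \<open>Row \<open>e b i\<close> of \<open>h\<close> is row \<open>i\<close> of
      \<open>M b\<close>; rows outside \<open>K\<close> are filled with 0.\<close>
    define h where "h = mat d d (\<lambda>(k, l). if k \<in> K then M (fst (ie k)) $$ (snd (ie k), l) else 0)"
    define M0 where "M0 = (\<lambda>a\<in>arcs G. if tail G a = r then F a else M a)"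
    have h: "h \<in> carrier_mat d d" by (simp add: h_def)
    have M0: "M0 \<in> Rep G \<beta>" using Rep_carrier[OF M] unfolding Rep_def by (auto simp: M0_def F_def)
    have "scale_out h M0 = M"
    proof (rule Rep_eqI[OF scale_out_Rep[OF h M0] M])
      fix b assume b: "b \<in> arcs G"
      have "F b * h = M b" if br: "tail G b = r"
        using Rep_carrier[OF M b] br ie[OF b br]
        by (intro eq_matI) (auto simp: h_def F_def scalar_prod_def delta_sum)
      then show "scale_out h M0 b = M b" using b by (simp add: scale_out_def M0_def)
    qed
    moreover have "scale_in h M0 = s (contract M)"
    proof (rule Rep_eqI[OF scale_in_Rep[OF h M0] s_Rep[OF contract_Rep[OF M]]])
      fix a assume a: "a \<in> arcs G"
      have "h * M a = A (contract M) a" if ar: "head G a = r"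
      proof (rule eq_matI)
        fix k j assume "k < dim_row (A (contract M) a)" "j < dim_col (A (contract M) a)"
        then have kj: "k < d" "j < \<beta> (tail G a)" by (simp_all add: A_def)
        note Ma = Rep_carrier[OF M a]
        show "(h * M a) $$ (k, j) = A (contract M) a $$ (k, j)"
        proof (cases "k \<in> K")
          case True
          note D = ie_D[OF True]
          have "Inr (a, fst (ie k)) \<in> arcs Q'" using D a ar by (simp add: remove_vertex_simps)
          then have "contract M (Inr (a, fst (ie k))) = M (fst (ie k)) * M a" by (rule contract_apply)
          then show ?thesis
            using kj True Ma ar D Rep_carrier[OF M D(1)] by (simp add: A_def h_def scalar_prod_def)
        next
          case False
          then show ?thesis using kj Ma ar by (simp add: A_def h_def scalar_prod_def)
        qed
      qed (use Rep_carrier[OF M a] ar in \<open>simp_all add: A_def h_def\<close>)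
      then show "scale_in h M0 a = s (contract M) a"
        using a noloop[OF a] by (auto simp: scale_in_def M0_def s_def contract_apply remove_vertex_simps)
    qed
    ultimately show ?thesis using r_invariant_scale[OF f h M0] by simp
  qed
  ultimately show ?thesis using s_Rep unfolding is_section_def by blast
qed

end

lemma (in wf_digraph) base_change_one:
  assumes M: "M \<in> Rep G \<beta>" and g: "\<And>i. i \<in> verts G \<Longrightarrow> g i = 1\<^sub>m (\<beta> i)"
  shows "base_change G \<beta> g M = M"
proof
  fix a show "base_change G \<beta> g M a = M a"
  proof (cases "a \<in> arcs G")
    case True
    then show ?thesis using Rep_carrier[OF M True] g by (simp add: base_change_apply minv_one)
  next
    case False
    then show ?thesis using M by (auto simp: base_change_def Rep_def)
  qed
qed

section \<open>Transfer of semi-invariants along the section\<close>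

context vertex_removal
begin

lemma
  assumes "is_section s"
  shows section_Rep: "N \<in> Rep Q' \<beta> \<Longrightarrow> s N \<in> Rep G \<beta>"
    and contract_section: "N \<in> Rep Q' \<beta> \<Longrightarrow> contract (s N) = N"
    and section_contract: "f \<in> poly_funs G \<beta> \<Longrightarrow> r_invariant f \<Longrightarrow> M \<in> Rep G \<beta> \<Longrightarrow> f (s (contract M)) = f M"
    and polyfun_section: "f \<in> poly_funs G \<beta> \<Longrightarrow> polyfun Q' \<beta> (\<lambda>N. f (s N))"
proof -
  show Rep: "N \<in> Rep Q' \<beta> \<Longrightarrow> s N \<in> Rep G \<beta>" for N using assms unfolding is_section_def by blast
  show "N \<in> Rep Q' \<beta> \<Longrightarrow> contract (s N) = N" using assms unfolding is_section_def by blast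
  show "f \<in> poly_funs G \<beta> \<Longrightarrow> r_invariant f \<Longrightarrow> M \<in> Rep G \<beta> \<Longrightarrow> f (s (contract M)) = f M"
    using assms unfolding is_section_def by blast
  show "polyfun Q' \<beta> (\<lambda>N. f (s N))" if "f \<in> poly_funs G \<beta>"
    by (rule polyfun_compose[OF that Rep]) (use assms in \<open>auto simp: is_section_def\<close>)
qed

lemma section_exists:
  assumes "min (\<Sum>a | a \<in> arcs G \<and> head G a = r. \<beta> (tail G a))
    (\<Sum>b | b \<in> arcs G \<and> tail G b = r. \<beta> (head G b)) \<le> d"
  shows "\<exists>s :: (('a + 'a \<times> 'a) \<Rightarrow> 'k::field_char_0 mat) \<Rightarrow> ('a \<Rightarrow> 'k mat). is_section s"
  using assms section_in section_out by (auto simp: min_le_iff_disj)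

definition extend :: "('q \<Rightarrow> 'k::field mat) \<Rightarrow> 'q \<Rightarrow> 'k mat" where
  "extend g = (\<lambda>i\<in>verts G. if i = r then 1\<^sub>m d else g i)"

lemma extend_GL:
  assumes g: "g \<in> GL Q' \<beta>"
  shows "extend g \<in> GL G \<beta>"
  unfolding GL_def
proof (rule PiE_I)
  fix i assume "i \<in> verts G"
  then show "extend g i \<in> MU (\<beta> i)"
    using GL_unit[OF g, of i] by (simp add: extend_def MU_one remove_vertex_simps(1))
qed (simp add: extend_def)

lemma extend_SL:
  assumes g: "g \<in> SL Q' \<beta>"
  shows "extend g \<in> SL G \<beta>"
proof -
  have "g \<in> GL Q' \<beta>" "\<And>i. i \<in> verts Q' \<Longrightarrow> det (g i) = 1" using g by (simp_all add: SL_def)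
  then show ?thesis using extend_GL[of g] by (simp add: SL_def extend_def remove_vertex_simps(1))
qed

text \<open>The two arguments of \<open>f\<close> need not be equal, as \<open>s\<close> depends on
  chosen bases. They have the same contraction, and \<open>f\<close> sees only that.\<close>

lemma section_base_change:
  assumes s: "is_section s" and f: "f \<in> poly_funs G \<beta>" "r_invariant f"
    and g: "g \<in> GL Q' \<beta>" and N: "N \<in> Rep Q' \<beta>"
  shows "f (s (base_change Q' \<beta> g N)) = f (base_change G \<beta> (extend g) (s N))"
proof -
  note sN = section_Rep[OF s N]
  have "contract (base_change G \<beta> (extend g) (s N)) = base_change Q' \<beta> g (contract (s N))"
    by (rule contract_base_change[OF extend_GL[OF g] _ sN]) (simp add: extend_def remove_vertex_simps)
  then show ?thesis
    using section_contract[OF s f base_change_Rep[OF extend_GL[OF g] sN]] contract_section[OF s N] by simp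
qed

lemma SI_section:
  fixes f :: "('a \<Rightarrow> 'k::field mat) \<Rightarrow> 'k"
  assumes s: "is_section s" and f: "f \<in> carrier (SI G \<beta>)" "r_invariant f"
  shows "(\<lambda>N\<in>Rep Q' \<beta>. f (s N)) \<in> carrier (SI Q' \<beta>)"
proof -
  have fp: "f \<in> poly_funs G \<beta>" using f(1) by (simp add: SI_def)
  have "f (s (base_change Q' \<beta> g N)) = f (s N)" if g: "g \<in> SL Q' \<beta>" and N: "N \<in> Rep Q' \<beta>" for g N
  proof -
    have "g \<in> GL Q' \<beta>" using g by (simp add: SL_def)
    then have "f (s (base_change Q' \<beta> g N)) = f (base_change G \<beta> (extend g) (s N))"
      by (rule section_base_change[OF s fp f(2) _ N])
    then show ?thesis using f(1) extend_SL[OF g] section_Rep[OF s N] by (simp add: SI_def)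
  qed
  moreover have "base_change Q' \<beta> g N \<in> Rep Q' \<beta>" if "g \<in> SL Q' \<beta>" "N \<in> Rep Q' \<beta>" for g :: "'q \<Rightarrow> 'k mat" and N
    using that by (simp add: SL_def wf_digraph.base_change_Rep[OF wf_Q'])
  ultimately show ?thesis using polyfun_section[OF s fp] by (simp add: SI_def polyfun_def)
qed

lemma SI_weight_r_invariant:
  fixes f :: "('a \<Rightarrow> 'k::field mat) \<Rightarrow> 'k"
  assumes f: "f \<in> SI_weight G \<beta> \<sigma>" and \<sigma>: "\<sigma> r = 0"
  shows "r_invariant f"
  unfolding r_invariant_def
proof (intro ballI)
  fix h :: "'k mat" and M :: "'a \<Rightarrow> 'k mat"
  assume h: "h \<in> MU d" and M: "M \<in> Rep G \<beta>"
  have "(\<Prod>i\<in>verts G. det (at_r h i) powi \<sigma> i) = 1"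
    using \<sigma> by (intro prod.neutral) (auto simp: at_r_def)
  then show "f (base_change G \<beta> (at_r h) M) = f M"
    using f at_r_GL[OF h] M by (simp add: SI_weight_def)
qed

lemma SI_weight_section:
  fixes f :: "('a \<Rightarrow> 'k::field mat) \<Rightarrow> 'k"
  assumes s: "is_section s" and f: "f \<in> SI_weight G \<beta> \<sigma>" and \<sigma>: "\<sigma> r = 0"
  shows "(\<lambda>N\<in>Rep Q' \<beta>. f (s N)) \<in> SI_weight Q' \<beta> \<sigma>"
proof -
  have fS: "f \<in> carrier (SI G \<beta>)" using f by (simp add: SI_weight_def)
  then have fp: "f \<in> poly_funs G \<beta>" by (simp add: SI_def)
  note ri = SI_weight_r_invariant[OF f \<sigma>]
  have "f (s (base_change Q' \<beta> g N)) = (\<Prod>i\<in>verts Q'. det (g i) powi \<sigma> i) * f (s N)"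
    if g: "g \<in> GL Q' \<beta>" and N: "N \<in> Rep Q' \<beta>" for g N
  proof -
    have "(\<Prod>i\<in>verts G. det (extend g i) powi \<sigma> i) = (\<Prod>i\<in>verts Q'. det (g i) powi \<sigma> i)"
      using r finite_verts by (simp add: prod.remove[of "verts G" r] remove_vertex_simps(1) \<sigma>)
        (auto intro!: prod.cong simp: extend_def)
    then show ?thesis
      using section_base_change[OF s fp ri g N] f extend_GL[OF g] section_Rep[OF s N]
      by (simp add: SI_weight_def)
  qed
  moreover have "base_change Q' \<beta> g N \<in> Rep Q' \<beta>" if "g \<in> GL Q' \<beta>" "N \<in> Rep Q' \<beta>" for g :: "'q \<Rightarrow> 'k mat" and N
    using that by (simp add: wf_digraph.base_change_Rep[OF wf_Q'])
  ultimately show ?thesis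
    using SI_section[OF s fS ri] by (simp add: SI_weight_def)
qed

lemma SI_contract:
  fixes k :: "('a + 'a \<times> 'a \<Rightarrow> 'k::field mat) \<Rightarrow> 'k"
  assumes k: "k \<in> carrier (SI Q' \<beta>)"
  shows "(\<lambda>M\<in>Rep G \<beta>. k (contract M)) \<in> carrier (SI G \<beta>)"
    and "r_invariant (\<lambda>M\<in>Rep G \<beta>. k (contract M))"
proof -
  have kp: "k \<in> poly_funs Q' \<beta>" using k by (simp add: SI_def)
  have "k (contract (base_change G \<beta> g M)) = k (contract M)"
    if g: "g \<in> SL G \<beta>" and M: "M \<in> Rep G \<beta>" for g M
  proof -
    have gG: "g \<in> GL G \<beta>" using g by (simp add: SL_def)
    have "contract (base_change G \<beta> g M) = base_change Q' \<beta> (restrict g (verts Q')) (contract M)"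
      by (rule contract_base_change[OF gG _ M]) simp
    moreover have "restrict g (verts Q') \<in> SL Q' \<beta>"
      using g by (auto simp: SL_def GL_def remove_vertex_simps)
    ultimately show ?thesis using k contract_Rep[OF M] by (simp add: SI_def)
  qed
  moreover have "base_change G \<beta> g M \<in> Rep G \<beta>" if "g \<in> SL G \<beta>" "M \<in> Rep G \<beta>" for g :: "'q \<Rightarrow> 'k mat" and M
    using that by (simp add: SL_def base_change_Rep)
  ultimately show "(\<lambda>M\<in>Rep G \<beta>. k (contract M)) \<in> carrier (SI G \<beta>)"
    using polyfun_contract[OF kp] by (simp add: SI_def polyfun_def)
  have "contract (base_change G \<beta> (at_r h) M) = contract M" if h: "h \<in> MU d" and M: "M \<in> Rep G \<beta>" for h :: "'k mat" and M
  proof -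
    have "contract (base_change G \<beta> (at_r h) M) = base_change Q' \<beta> (at_r h) (contract M)"
      by (rule contract_base_change[OF at_r_GL[OF h] _ M]) simp
    also have "\<dots> = contract M"
      by (rule wf_digraph.base_change_one[OF wf_Q' contract_Rep[OF M]]) (simp add: at_r_def remove_vertex_simps)
    finally show ?thesis .
  qed
  then show "r_invariant (\<lambda>M\<in>Rep G \<beta>. k (contract M))"
    by (simp add: r_invariant_def base_change_Rep at_r_GL)
qed

end

section \<open>Rescaling the initial variables\<close>

context seed
begin

lemma UCA_iff: "f \<in> carrier (UCA \<iota> \<Delta> x) \<longleftrightarrow>
    (\<forall>\<Gamma> y. mutation_equivalent \<Delta> x \<Gamma> y \<longrightarrow> f \<in> laurent_ring \<iota> \<Gamma> y)"
  unfolding UCA_def by auto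

lemma UCA_subring: "subring_set (carrier (UCA \<iota> \<Delta> x))"
proof -
  have "subring_set (laurent_ring \<iota> \<Gamma> y)" for \<Gamma> y
    unfolding laurent_ring_def by (rule subring_set_generate)
  note ops = subring_set_one[OF this] subring_set_uminus[OF this] subring_set_add[OF this] subring_set_mult[OF this]
  show ?thesis by (simp add: subring_set_def Ball_def UCA_iff ops)
qed

lemma UCA_const: "\<iota> c \<in> carrier (UCA \<iota> \<Delta> x)"
  unfolding UCA_iff laurent_ring_def by (auto intro: generate_ring.incl)

text \<open>The Laurent phenomenon for initial variables follows from the upper bound theorem, as
  they are visibly Laurent in all neighbours.\<close>

lemma UCA_initial:
  assumes "rows_independent \<Delta>" and v: "v \<in> V"
  shows "x v \<in> carrier (UCA \<iota> \<Delta> x)"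
proof (rule upper_bound_subset_UCA[OF assms(1)])
  show "x v \<in> laurent_ring \<iota> \<Delta> x" using L_gens(2)[OF v] laurent_ring_eq_Sp by simp
qed (rule initial_in_mutated[OF _ v])

text \<open>Denominators are cleared by an initial cluster monomial, since \<open>\<tau>\<close> is only additive and multiplicative on the UCA.\<close>

lemma UCA_rescale:
  fixes \<tau> :: "'f \<Rightarrow> 'f" and c :: "'v \<Rightarrow> 'k"
  defines "C \<equiv> carrier (UCA \<iota> \<Delta> x)"
  assumes ind: "rows_independent \<Delta>"
    and add: "\<And>f g. f \<in> C \<Longrightarrow> g \<in> C \<Longrightarrow> \<tau> (f + g) = \<tau> f + \<tau> g"
    and mult: "\<And>f g. f \<in> C \<Longrightarrow> g \<in> C \<Longrightarrow> \<tau> (f * g) = \<tau> f * \<tau> g"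
    and const: "\<And>a. \<tau> (\<iota> a) = \<iota> a"
    and scale: "\<And>v. v \<in> V \<Longrightarrow> \<tau> (x v) = \<iota> (c v) * x v"
    and c: "\<And>v. v \<in> V \<Longrightarrow> c v \<noteq> 0"
    and f: "ev p \<in> C"
  shows "\<tau> (ev p) = (\<Sum>n\<in>keys p. \<iota> (lookup p n * (\<Prod>v\<in>V. c v powi n v)) * mn n)"
proof -
  define S where "S = keys p"
  define y where "y v = \<iota> (c v) * x v" for v
  note sub = UCA_subring[folded C_def]
  have xC: "x v \<in> C" if "v \<in> V" for v unfolding C_def by (rule UCA_initial[OF ind that])
  have constC: "\<iota> a \<in> C" for a unfolding C_def by (rule UCA_const)
  have one: "\<tau> 1 = 1" using const[of 1] by simp
  have power: "\<tau> (x v ^ k) = y v ^ k" if v: "v \<in> V" for v k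
  proof (induction k)
    case (Suc k)
    then show ?case
      using mult[OF xC[OF v] subring_set_power[OF sub xC[OF v], of k]] scale[OF v] by (simp add: y_def)
  qed (simp add: one)
  have prod: "\<tau> (\<Prod>v\<in>W. x v ^ k v) = (\<Prod>v\<in>W. y v ^ k v)" if "finite W" "W \<subseteq> V" for W k
    using that
  proof (induction W rule: finite_induct)
    case (insert v W)
    have "x v ^ k v \<in> C" "(\<Prod>v\<in>W. x v ^ k v) \<in> C"
      using insert.prems by (auto intro!: subring_set_power[OF sub] subring_set_prod[OF sub] xC)
    then show ?case using insert mult power by simp
  qed (simp add: one)
  have mon_nat: "lmon V z n = (\<Prod>v\<in>V. z v ^ nat (n v))" if "\<And>v. v \<in> V \<Longrightarrow> n v \<ge> 0" for z :: "'v \<Rightarrow> 'f" and n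
    unfolding lmon_def using that by (intro prod.cong) (auto simp: power_int_def)
  have mon: "mn n \<in> C \<and> \<tau> (mn n) = lmon V y n" if n: "\<And>v. v \<in> V \<Longrightarrow> n v \<ge> 0" for n
  proof -
    have "mn n = (\<Prod>v\<in>V. x v ^ nat (n v))" "lmon V y n = (\<Prod>v\<in>V. y v ^ nat (n v))"
      by (rule mon_nat[OF n], assumption)+
    then show ?thesis
      using prod[OF fin subset_refl, of "\<lambda>v. nat (n v)"]
      by (auto intro!: subring_set_power[OF sub] subring_set_prod[OF sub] xC)
  qed
  have sum: "\<tau> (\<Sum>i\<in>I. g i) = (\<Sum>i\<in>I. \<tau> (g i))" if "\<And>i. i \<in> I \<Longrightarrow> g i \<in> C" for I :: "('v \<Rightarrow> int) set" and g
    using that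
  proof (induction I rule: infinite_finite_induct)
    case (insert i I)
    then show ?case using add[of "g i" "sum g I"] subring_set_sum[OF sub, of I g] by simp
  qed (use const[of 0] in auto)
  obtain N where N: "\<And>n v. n \<in> S \<Longrightarrow> v \<in> V \<Longrightarrow> n v + N \<ge> 0"
    using exponents_bounded_below[OF finite_keys fin, of p] unfolding S_def by blast
  \<comment> \<open>With the absolute value, \<open>mon\<close> applies to \<open>m\<close> itself
    as well as to all \<open>n + m\<close>.\<close>
  define m :: "'v \<Rightarrow> int" where "m v = \<bar>N\<bar>" for v
  have y0: "y v \<noteq> 0" if "v \<in> V" for v using nz[OF that] c[OF that] by (simp add: y_def)
  have mon_y: "lmon V y (n + k) = lmon V y n * lmon V y k" for n k
    unfolding lmon_def prod.distrib[symmetric] by (rule prod.cong) (auto simp: power_int_add y0)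
  have m: "mn m \<in> C" "\<tau> (mn m) = lmon V y m" using mon[of m] by (simp_all add: m_def)
  have nm: "mn (n + m) \<in> C" "\<tau> (mn (n + m)) = lmon V y (n + m)" if "n \<in> S" for n
  proof -
    have "(n + m) v \<ge> 0" if "v \<in> V" for v using N[OF \<open>n \<in> S\<close> that] by (simp add: m_def)
    then show "mn (n + m) \<in> C" "\<tau> (mn (n + m)) = lmon V y (n + m)" using mon by blast+
  qed
  have "lmon V y m * \<tau> (ev p) = \<tau> (mn m * ev p)" using mult[OF m(1) f] m(2) by simp
  also have "mn m * ev p = (\<Sum>n\<in>S. \<iota> (lookup p n) * mn (n + m))"
    by (simp add: leval_def S_def sum_distrib_left mon_add algebra_simps)
  also have "\<tau> \<dots> = (\<Sum>n\<in>S. \<tau> (\<iota> (lookup p n) * mn (n + m)))"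
    by (rule sum) (rule subring_set_mult[OF sub constC nm(1)])
  also have "\<dots> = (\<Sum>n\<in>S. \<iota> (lookup p n) * (lmon V y n * lmon V y m))"
    by (rule sum.cong) (simp_all add: mult constC nm const mon_y)
  also have "\<dots> = lmon V y m * (\<Sum>n\<in>S. \<iota> (lookup p n) * lmon V y n)"
    by (simp add: sum_distrib_left algebra_simps)
  finally have "\<tau> (ev p) = (\<Sum>n\<in>S. \<iota> (lookup p n) * lmon V y n)"
    using y0 fin by (simp add: lmon_def)
  moreover have "\<iota> (a powi k) = \<iota> a powi k" for a k
    by (simp add: power_int_def hom_power hom_inverse)
  then have "(\<Sum>n\<in>S. \<iota> (lookup p n) * lmon V y n) =
      (\<Sum>n\<in>S. \<iota> (lookup p n * (\<Prod>v\<in>V. c v powi n v)) * mn n)"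
    by (simp add: lmon_def y_def power_int_mult_distrib prod.distrib hom_mult hom_prod mult.assoc)
  ultimately show ?thesis by (simp add: S_def)
qed

end

context frozen_deletion
begin

text \<open>Nonnegativity at the attached vertices comes from the neighbouring seeds; this starts
  the induction of \<open>in_UCA_deleted\<close>.\<close>

lemma in_laurent_ring_deleted:
  assumes f: "f \<in> carrier (UCA \<iota> \<Delta> x)" "f \<in> Sp {n \<in> lexps \<Delta>. \<forall>v\<in>vs. n v = 0}"
  shows "f \<in> laurent_ring \<iota> \<Delta>' x"
proof -
  let ?E = "{n \<in> lexps \<Delta>. \<forall>v\<in>vs. n v = 0}"
  have f_L: "f \<in> laurent_ring \<iota> \<Gamma> y" if "mutation_equivalent \<Delta> x \<Gamma> y" for \<Gamma> y
    using f(1) that by (auto simp: UCA_def)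
  have "f \<in> L" using f_L[OF mutation_equivalent.refl] laurent_ring_eq_Sp by simp
  have E: "?E \<subseteq> {n \<in> exps V. \<forall>v\<in>vs. n v = 0}" using lexps_exps by blast
  have "f \<in> Sp {n \<in> ?E. n u \<ge> 0}" if u: "u \<in> us" for u
  proof -
    have uU: "u \<in> U" using u us_sub by blast
    obtain v1 v2 where v: "v1 \<in> vs" "v2 \<in> vs" "narrows \<Delta> v1 u > 0" "narrows \<Delta> u v2 > 0"
      using two_sided[OF u] by blast
    have "f \<in> laurent_ring \<iota> (mutate_quiver u \<Delta>) (mutate_cluster u \<Delta> x)"
      by (rule f_L[OF mutation_equivalent.step[OF mutation_equivalent.refl uU]])
    then show ?thesis
      using nonneg_if_two_sided[OF vs uU v \<open>f \<in> L\<close> _ f(2) E] by simp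
  qed
  then have "f \<in> Sp (?E \<inter> (\<Inter>u\<in>us. {n \<in> ?E. n u \<ge> 0}))"
    by (intro Sp_Inter f(2)) (use E in auto)
  then have "f \<in> Sp (lexps \<Delta>')"
    by (rule Sp_mono[rotated]) (auto simp: lexps_deleted)
  then show ?thesis by (simp add: laurent_ring_compatible[OF compatible_refl seed_axioms])
qed

lemma UCA_deleted_iff:
  assumes "rows_independent \<Delta>"
  shows "f \<in> carrier (UCA \<iota> \<Delta>' x) \<longleftrightarrow>
    f \<in> carrier (UCA \<iota> \<Delta> x) \<and> f \<in> Sp {n \<in> lexps \<Delta>. \<forall>v\<in>vs. n v = 0}"
proof
  assume "f \<in> carrier (UCA \<iota> \<Delta>' x)"
  note f = UCA_deleted_subset[OF assms this]
  have "f \<in> Sp (lexps \<Delta>')"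
    using f(2) by (simp add: laurent_ring_compatible[OF compatible_refl seed_axioms])
  then have "f \<in> Sp {n \<in> lexps \<Delta>. \<forall>v\<in>vs. n v = 0}"
    by (rule Sp_mono[rotated]) (auto simp: lexps_deleted)
  then show "f \<in> carrier (UCA \<iota> \<Delta> x) \<and> f \<in> Sp {n \<in> lexps \<Delta>. \<forall>v\<in>vs. n v = 0}" using f(1) by blast
next
  assume "f \<in> carrier (UCA \<iota> \<Delta> x) \<and> f \<in> Sp {n \<in> lexps \<Delta>. \<forall>v\<in>vs. n v = 0}"
  then show "f \<in> carrier (UCA \<iota> \<Delta>' x)" using in_UCA_deleted in_laurent_ring_deleted by blast
qed

end

lemma two_power_int_eq_1: "(2 :: 'k::field_char_0) powi k = 1 \<Longrightarrow> k = 0"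
proof -
  have pow: "n = 0" if "(2 :: 'k) ^ n = 1" for n
  proof -
    have "of_nat (2 ^ n) = (of_nat 1 :: 'k)" using that by simp
    then have "(2 :: nat) ^ n = 1" by (simp only: of_nat_eq_iff)
    then show ?thesis by simp
  qed
  assume "(2 :: 'k) powi k = 1"
  then show "k = 0" using pow[of "nat k"] pow[of "nat (- k)"]
    by (cases "k \<ge> 0") (simp_all add: power_int_def power_one_over inverse_eq_divide)
qed

section \<open>Comparison of the gradings\<close>

lemma acyclic_quiver_noloop:
  assumes "acyclic_quiver Q" "a \<in> arcs Q"
  shows "tail Q a \<noteq> head Q a"
proof
  assume loop: "tail Q a = head Q a"
  interpret fin_digraph Q using assms(1) by (simp add: acyclic_quiver_def)
  have "awalk (tail Q a) [a] (tail Q a)"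
    using assms(2) loop by (simp add: awalk_def cas.simps)
  then have "cycle [a]" unfolding cycle_def by (intro exI[of _ "tail Q a"]) simp
  then show False using assms(1) by (auto simp: acyclic_quiver_def)
qed

lemma SI_simps:
  "f \<otimes>\<^bsub>SI Q \<beta>\<^esub> g = (\<lambda>M\<in>Rep Q \<beta>. f M * g M)" "f \<oplus>\<^bsub>SI Q \<beta>\<^esub> g = (\<lambda>M\<in>Rep Q \<beta>. f M + g M)"
  "\<one>\<^bsub>SI Q \<beta>\<^esub> = (\<lambda>M\<in>Rep Q \<beta>. 1)"
  by (simp_all add: SI_def fun_ring_def)

lemma UCA_simps:
  "f \<otimes>\<^bsub>UCA \<iota> \<Delta> x\<^esub> g = f * g" "f \<oplus>\<^bsub>UCA \<iota> \<Delta> x\<^esub> g = f + g" "\<one>\<^bsub>UCA \<iota> \<Delta> x\<^esub> = 1"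
  by (simp_all add: UCA_def class_ring_simps)

lemma SI_extensional: "f \<in> carrier (SI Q \<beta>) \<Longrightarrow> f \<in> Rep Q \<beta> \<rightarrow>\<^sub>E UNIV"
  by (simp add: SI_def poly_funs_extensional)

locale graded_vertex_removal =
  S: frozen_deletion \<iota> \<Delta> x vs us + R: vertex_removal Q r \<beta>
  for \<iota> :: "'k::field_char_0 \<Rightarrow> 'f::field" and \<Delta> :: "'v ice_quiver" and x vs us
    and Q :: "('q, 'a) pre_digraph" and r \<beta> +
  fixes \<sigma> :: "'v \<Rightarrow> 'q \<Rightarrow> int" and \<phi> :: "'f \<Rightarrow> ('a \<Rightarrow> 'k mat) \<Rightarrow> 'k"
  assumes ind: "rows_independent \<Delta>"
    and \<phi>: "\<phi> \<in> ring_iso (UCA \<iota> \<Delta> x) (SI Q \<beta>)"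
    and \<phi>_const: "\<And>c. \<phi> (\<iota> c) = (\<lambda>M\<in>Rep Q \<beta>. c)"
    and \<phi>_weight: "\<And>v. v \<in> nodes \<Delta> \<Longrightarrow> \<phi> (x v) \<in> SI_weight Q \<beta> (\<sigma> v)"
    and \<sigma>_zero: "\<And>v. v \<in> nodes \<Delta> - vs \<Longrightarrow> \<sigma> v r = 0"
    and \<sigma>_sign: "(\<forall>v\<in>vs. \<sigma> v r < 0) \<or> (\<forall>v\<in>vs. \<sigma> v r > 0)"
    and \<sigma>_trivial: "\<And>v. v \<in> nodes \<Delta> \<Longrightarrow> \<beta> r = 0 \<Longrightarrow> \<sigma> v r = 0"
begin

abbreviation "C \<equiv> carrier (UCA \<iota> \<Delta> x)"

lemma \<phi>_bij: "bij_betw \<phi> C (carrier (SI Q \<beta>))"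
  using \<phi> by (simp add: ring_iso_def)

lemma \<phi>_SI: "f \<in> C \<Longrightarrow> \<phi> f \<in> carrier (SI Q \<beta>)"
  using \<phi>_bij by (auto simp: bij_betw_def)

lemma
  assumes "f \<in> C" "g \<in> C"
  shows \<phi>_add: "\<phi> (f + g) = (\<lambda>M\<in>Rep Q \<beta>. \<phi> f M + \<phi> g M)"
    and \<phi>_mult: "\<phi> (f * g) = (\<lambda>M\<in>Rep Q \<beta>. \<phi> f M * \<phi> g M)"
  using \<phi> assms ring_hom_add[of \<phi> "UCA \<iota> \<Delta> x" "SI Q \<beta>" f g] ring_hom_mult[of \<phi> "UCA \<iota> \<Delta> x" "SI Q \<beta>" f g]
  by (simp_all add: ring_iso_def SI_simps UCA_simps)

lemma \<phi>_extensional: "f \<in> C \<Longrightarrow> \<phi> f \<in> Rep Q \<beta> \<rightarrow>\<^sub>E UNIV"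
  using SI_extensional \<phi>_SI by blast

lemma \<phi>_eqI:
  assumes "f \<in> C" "g \<in> C" "\<And>M. M \<in> Rep Q \<beta> \<Longrightarrow> \<phi> f M = \<phi> g M"
  shows "f = g"
proof -
  have "\<phi> f = \<phi> g" using assms \<phi>_extensional by (intro PiE_ext[of _ "Rep Q \<beta>" "\<lambda>_. UNIV"]) auto
  then show ?thesis using \<phi>_bij assms(1,2) by (auto simp: bij_betw_def dest: inj_onD)
qed

text \<open>The action of \<open>GL\<close> at \<open>r\<close>, transported to the cluster algebra;
  \<open>R.SI_base_change\<close> guarantees that the translated function has a preimage.\<close>

definition act :: "'k mat \<Rightarrow> 'f \<Rightarrow> 'f" where
  "act h f = inv_into C \<phi> (\<lambda>M\<in>Rep Q \<beta>. \<phi> f (base_change Q \<beta> (R.at_r h) M))"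

lemma
  assumes f: "f \<in> C" and h: "h \<in> MU (\<beta> r)"
  shows act_C: "act h f \<in> C"
    and \<phi>_act: "\<And>M. M \<in> Rep Q \<beta> \<Longrightarrow> \<phi> (act h f) M = \<phi> f (base_change Q \<beta> (R.at_r h) M)"
proof -
  have "(\<lambda>M\<in>Rep Q \<beta>. \<phi> f (base_change Q \<beta> (R.at_r h) M)) \<in> carrier (SI Q \<beta>)"
    by (rule R.SI_base_change[OF \<phi>_SI[OF f] R.at_r_GL[OF h]])
  then have *: "(\<lambda>M\<in>Rep Q \<beta>. \<phi> f (base_change Q \<beta> (R.at_r h) M)) \<in> \<phi> ` C"
    using \<phi>_bij by (simp add: bij_betw_def)
  show "act h f \<in> C" unfolding act_def by (rule inv_into_into[OF *])
  show "\<phi> (act h f) M = \<phi> f (base_change Q \<beta> (R.at_r h) M)" if "M \<in> Rep Q \<beta>" for M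
    unfolding act_def f_inv_into_f[OF *] using that by simp
qed

lemma r_invariant_iff:
  assumes f: "f \<in> C"
  shows "R.r_invariant (\<phi> f) \<longleftrightarrow> (\<forall>h\<in>MU (\<beta> r). act h f = f)"
proof
  assume "R.r_invariant (\<phi> f)"
  then show "\<forall>h\<in>MU (\<beta> r). act h f = f"
    using \<phi>_act[OF f] by (auto intro!: \<phi>_eqI f act_C simp: R.r_invariant_def)
next
  assume *: "\<forall>h\<in>MU (\<beta> r). act h f = f"
  then show "R.r_invariant (\<phi> f)"
    unfolding R.r_invariant_def using \<phi>_act[OF f] by metis
qed

text \<open>Weights are given only for the initial variables; \<open>UCA_rescale\<close> extends
  their effect to whole Laurent expansions.\<close>

lemma act_ev:
  assumes f: "S.ev p \<in> C" and h: "h \<in> MU (\<beta> r)"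
  shows "act h (S.ev p) = (\<Sum>n\<in>keys p.
    \<iota> (lookup p n * (\<Prod>v\<in>nodes \<Delta>. (det h powi \<sigma> v r) powi n v)) * S.mn n)"
proof (rule S.UCA_rescale[OF ind])
  have bc: "base_change Q \<beta> (R.at_r h) M \<in> Rep Q \<beta>" if "M \<in> Rep Q \<beta>" for M
    by (rule R.base_change_Rep[OF R.at_r_GL[OF h] that])
  note subr = S.UCA_subring
  show "act h (f + g) = act h f + act h g" if "f \<in> C" "g \<in> C" for f g
    using that h bc subring_set_add[OF subr]
    by (intro \<phi>_eqI) (auto simp: act_C \<phi>_act \<phi>_add)
  show "act h (f * g) = act h f * act h g" if "f \<in> C" "g \<in> C" for f g
    using that h bc subring_set_mult[OF subr]
    by (intro \<phi>_eqI) (auto simp: act_C \<phi>_act \<phi>_mult)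
  show "act h (\<iota> a) = \<iota> a" for a
    using h bc by (intro \<phi>_eqI) (auto simp: act_C \<phi>_act S.UCA_const \<phi>_const)
  show "act h (x v) = \<iota> (det h powi \<sigma> v r) * x v" if v: "v \<in> nodes \<Delta>" for v
  proof (rule \<phi>_eqI)
    note xC = S.UCA_initial[OF ind v]
    show "act h (x v) \<in> C" by (rule act_C[OF xC h])
    show "\<iota> (det h powi \<sigma> v r) * x v \<in> C" by (rule subring_set_mult[OF subr S.UCA_const xC])
    fix M :: "'a \<Rightarrow> 'k mat" assume M: "M \<in> Rep Q \<beta>"
    have "(\<Prod>i\<in>verts Q. det (R.at_r h i) powi \<sigma> v i) = det h powi \<sigma> v r"
      using R.r R.finite_verts
      by (simp add: prod.remove[of "verts Q" r] R.at_r_def)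
    then show "\<phi> (act h (x v)) M = \<phi> (\<iota> (det h powi \<sigma> v r) * x v) M"
      using \<phi>_weight[OF v] R.at_r_GL[OF h] M
      by (simp add: \<phi>_act[OF xC h] \<phi>_mult[OF S.UCA_const xC] \<phi>_const SI_weight_def)
  qed
  show "det h powi \<sigma> v r \<noteq> 0" for v using h by (simp add: MU_iff)
qed (rule f)

text \<open>Invariance forces every monomial to have \<open>r\<close>-degree 0. This degree is a sum
  over \<open>vs\<close> of weights of one sign times nonnegative exponents, so each exponent must
  vanish.\<close>

lemma r_invariant_iff_deleted:
  assumes f: "f \<in> C"
  shows "R.r_invariant (\<phi> f) \<longleftrightarrow> f \<in> S.Sp {n \<in> lexps \<Delta>. \<forall>v\<in>vs. n v = 0}"
proof
  assume "f \<in> S.Sp {n \<in> lexps \<Delta>. \<forall>v\<in>vs. n v = 0}"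
  then obtain p where p: "keys p \<subseteq> {n \<in> lexps \<Delta>. \<forall>v\<in>vs. n v = 0}" "f = S.ev p"
    by (rule S.SpE)
  have "act h f = f" if h: "h \<in> MU (\<beta> r)" for h
  proof -
    have "(\<Prod>v\<in>nodes \<Delta>. (det h powi \<sigma> v r) powi n v) = 1" if "n \<in> keys p" for n
    proof (rule prod.neutral, intro ballI)
      fix v assume "v \<in> nodes \<Delta>"
      then show "(det h powi \<sigma> v r) powi n v = 1"
        using p(1) that \<sigma>_zero[of v] by (cases "v \<in> vs") auto
    qed
    then show ?thesis using act_ev[of p h] f h by (simp add: p(2)) (simp add: leval_def)
  qed
  then show "R.r_invariant (\<phi> f)" using r_invariant_iff[OF f] by blast
next
  assume ri: "R.r_invariant (\<phi> f)"
  have "f \<in> S.L" using f S.laurent_ring_eq_Sp mutation_equivalent.refl[of \<Delta> x] by (auto simp: S.UCA_iff)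
  then obtain p where p: "keys p \<subseteq> lexps \<Delta>" "f = S.ev p" by (rule S.SpE)
  have "n v = 0" if n: "n \<in> keys p" and v: "v \<in> vs" for n v
  proof -
    have vs_nodes: "vs \<subseteq> nodes \<Delta>" using S.vs by blast
    \<comment> \<open>A nonzero weight excludes \<open>\<beta> r = 0\<close>, where weights are
      normalised to 0; hence there is a row to multiply by 2.\<close>
    have "\<sigma> v r \<noteq> 0" using \<sigma>_sign v by fastforce
    then have "\<beta> r > 0" using \<sigma>_trivial[of v] v vs_nodes by fastforce
    \<comment> \<open>Since 2 has infinite order, one matrix of determinant 2 detects the \<open>r\<close>-degree.\<close>
    define h :: "'k mat" where "h = multrow_mat (\<beta> r) 0 2"
    have det_h: "det h = 2" using det_multrow_mat[OF \<open>\<beta> r > 0\<close>] by (simp add: h_def)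
    then have h: "h \<in> MU (\<beta> r)" by (simp add: MU_iff) (simp add: h_def)
    have two: "(\<Prod>v\<in>W. (2 powi \<sigma> v r) powi n v) = (2 :: 'k) powi (\<Sum>v\<in>W. \<sigma> v r * n v)" for n and W :: "'v set"
      by (induction W rule: infinite_finite_induct) (simp_all add: power_int_add power_int_mult)
    have "S.ev p = (\<Sum>n\<in>keys p. \<iota> (lookup p n *
        (\<Prod>v\<in>nodes \<Delta>. (2 powi \<sigma> v r) powi n v)) * S.mn n)"
      using act_ev[of p h] r_invariant_iff[OF f] ri f h det_h p(2) by simp
    then have "(\<Sum>n\<in>keys p. \<iota> (lookup p n *
        (2 powi (\<Sum>v\<in>nodes \<Delta>. \<sigma> v r * n v) - 1)) * S.mn n) = 0"
      by (simp add: two right_diff_distrib left_diff_distrib S.hom_minus sum_subtractf)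
        (simp add: leval_def)
    then have "lookup p n * (2 powi (\<Sum>v\<in>nodes \<Delta>. \<sigma> v r * n v) - 1) = 0"
      by (rule S.linear_independent[where e = "\<lambda>n. n", rotated 3])
        (use n p(1) lexps_exps[of \<Delta>] in auto)
    then have "(\<Sum>v\<in>nodes \<Delta>. \<sigma> v r * n v) = 0"
      using n two_power_int_eq_1[where ?'k = 'k] by (auto simp: in_keys_iff)
    moreover have "(\<Sum>v\<in>nodes \<Delta>. \<sigma> v r * n v) = (\<Sum>v\<in>vs. \<sigma> v r * n v)"
      using \<sigma>_zero S.fin vs_nodes by (intro sum.mono_neutral_right) auto
    ultimately have sum0: "(\<Sum>v\<in>vs. \<sigma> v r * n v) = 0" by simp
    have fin_vs: "finite vs" using S.fin vs_nodes by (rule rev_finite_subset)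
    have nonneg: "n w \<ge> 0" if "w \<in> vs" for w
      using p(1) n that S.vs by (auto simp: lexps_def)
    from \<sigma>_sign show "n v = 0"
    proof
      assume neg: "\<forall>v\<in>vs. \<sigma> v r < 0"
      have "(\<Sum>v\<in>vs. - (\<sigma> v r * n v)) = 0" using sum0 by (simp add: sum_negf)
      then have "- (\<sigma> v r * n v) = 0"
        using fin_vs v neg nonneg by (subst (asm) sum_nonneg_eq_0_iff) (auto simp: mult_nonpos_nonneg less_imp_le)
      then show ?thesis using neg v by auto
    next
      assume pos: "\<forall>v\<in>vs. \<sigma> v r > 0"
      have "\<sigma> v r * n v = 0"
        using sum0 fin_vs v pos nonneg by (subst (asm) sum_nonneg_eq_0_iff) (auto simp: less_imp_le)
      then show ?thesis using pos v by auto
    qed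
  qed
  then have "keys p \<subseteq> {n \<in> lexps \<Delta>. \<forall>v\<in>vs. n v = 0}" using p(1) by blast
  then show "f \<in> S.Sp {n \<in> lexps \<Delta>. \<forall>v\<in>vs. n v = 0}" unfolding p(2) by (rule S.SpI)
qed

lemma deleted_UCA_iff: "f \<in> carrier (UCA \<iota> S.\<Delta>' x) \<longleftrightarrow> f \<in> C \<and> R.r_invariant (\<phi> f)"
  using S.UCA_deleted_iff[OF ind] r_invariant_iff_deleted by blast

text \<open>The map restricts invariant functions along \<open>s\<close>. Its inverse composes a
  function with \<open>contract\<close> and applies the inverse of \<open>\<phi>\<close>.\<close>

lemma section_ring_iso:
  assumes s: "R.is_section s"
  shows "(\<lambda>f. \<lambda>N\<in>Rep R.Q' \<beta>. \<phi> f (s N)) \<in> ring_iso (UCA \<iota> S.\<Delta>' x) (SI R.Q' \<beta>)"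
    (is "?\<psi> \<in> _")
proof -
  let ?C' = "carrier (UCA \<iota> S.\<Delta>' x)"
  have C': "f \<in> C" "R.r_invariant (\<phi> f)" if "f \<in> ?C'" for f using that deleted_UCA_iff by blast+
  have \<psi>_SI: "?\<psi> f \<in> carrier (SI R.Q' \<beta>)" if "f \<in> ?C'" for f
    by (rule R.SI_section[OF s \<phi>_SI[OF C'(1)[OF that]] C'(2)[OF that]])
  note sR = R.section_Rep[OF s]
  show ?thesis
  proof (rule ring_iso_memI)
    show "?\<psi> f \<in> carrier (SI R.Q' \<beta>)" if "f \<in> ?C'" for f by (rule \<psi>_SI[OF that])
    show "?\<psi> (f \<otimes>\<^bsub>UCA \<iota> S.\<Delta>' x\<^esub> g) = ?\<psi> f \<otimes>\<^bsub>SI R.Q' \<beta>\<^esub> ?\<psi> g" if "f \<in> ?C'" "g \<in> ?C'" for f g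
      using \<phi>_mult[OF C'(1)[OF that(1)] C'(1)[OF that(2)]] sR by (auto simp: SI_simps UCA_simps)
    show "?\<psi> (f \<oplus>\<^bsub>UCA \<iota> S.\<Delta>' x\<^esub> g) = ?\<psi> f \<oplus>\<^bsub>SI R.Q' \<beta>\<^esub> ?\<psi> g" if "f \<in> ?C'" "g \<in> ?C'" for f g
      using \<phi>_add[OF C'(1)[OF that(1)] C'(1)[OF that(2)]] sR by (auto simp: SI_simps UCA_simps)
    show "?\<psi> \<one>\<^bsub>UCA \<iota> S.\<Delta>' x\<^esub> = \<one>\<^bsub>SI R.Q' \<beta>\<^esub>"
      using \<phi>_const[of 1] sR by (auto simp: SI_simps UCA_simps)
    show "bij_betw ?\<psi> ?C' (carrier (SI R.Q' \<beta>))"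
      unfolding bij_betw_def
    proof (intro conjI inj_onI subset_antisym image_subsetI subsetI)
      fix f g assume fg: "f \<in> ?C'" "g \<in> ?C'" "?\<psi> f = ?\<psi> g"
      show "f = g"
      proof (rule \<phi>_eqI[OF C'(1)[OF fg(1)] C'(1)[OF fg(2)]])
        fix M :: "'a \<Rightarrow> 'k mat" assume M: "M \<in> Rep Q \<beta>"
        have recover: "\<phi> k M = ?\<psi> k (R.contract M)" if "k \<in> ?C'" for k
          using R.section_contract[OF s _ C'(2)[OF that] M] \<phi>_SI[OF C'(1)[OF that]] R.contract_Rep[OF M]
          by (simp add: SI_def)
        show "\<phi> f M = \<phi> g M" using recover[OF fg(1)] recover[OF fg(2)] fg(3) by simp
      qed
    next
      show "?\<psi> f \<in> carrier (SI R.Q' \<beta>)" if "f \<in> ?C'" for f by (rule \<psi>_SI[OF that])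
    next
      fix k :: "('a + 'a \<times> 'a \<Rightarrow> 'k mat) \<Rightarrow> 'k" assume k: "k \<in> carrier (SI R.Q' \<beta>)"
      have "(\<lambda>M\<in>Rep Q \<beta>. k (R.contract M)) \<in> \<phi> ` C"
        using R.SI_contract(1)[OF k] \<phi>_bij by (simp add: bij_betw_def)
      then obtain f where f: "f \<in> C" "\<phi> f = (\<lambda>M\<in>Rep Q \<beta>. k (R.contract M))" by force
      have "f \<in> ?C'" using f R.SI_contract(2)[OF k] deleted_UCA_iff by simp
      moreover have "k = ?\<psi> f"
      proof (rule PiE_ext[of _ "Rep R.Q' \<beta>" "\<lambda>_. UNIV"])
        show "k N = ?\<psi> f N" if "N \<in> Rep R.Q' \<beta>" for N
          using that R.section_Rep[OF s that] R.contract_section[OF s that] by (simp add: f(2))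
      qed (use SI_extensional[OF k] in auto)
      ultimately show "k \<in> ?\<psi> ` ?C'" by blast
    qed
  qed
qed

lemma naturally_graded_deleted:
  fixes s :: "('a + 'a \<times> 'a \<Rightarrow> 'k mat) \<Rightarrow> 'a \<Rightarrow> 'k mat"
  assumes s: "R.is_section s" and seed: "is_seed \<iota> \<Delta> x" and config: "weight_config (verts Q) \<Delta> \<sigma>"
    and trivial: "\<And>v i. v \<in> nodes \<Delta> \<Longrightarrow> i \<in> verts Q \<Longrightarrow> \<beta> i = 0 \<Longrightarrow> \<sigma> v i = 0"
  shows "naturally_graded_UCA R.Q' \<beta> \<iota> S.\<Delta>' x \<sigma>"
proof -
  have nodes: "nodes S.\<Delta>' = nodes \<Delta> - vs" "mutables S.\<Delta>' = mutables \<Delta> - us"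
    by (rule S.compatible_sets[OF S.compatible_refl])+
  have "is_seed \<iota> S.\<Delta>' x"
    using S.compatible_ice(2)[OF S.compatible_refl] seed
    unfolding is_seed_def alg_independent_def nodes by blast
  moreover have "weight_config (verts R.Q') S.\<Delta>' \<sigma>"
    unfolding weight_config_def
  proof (intro ballI)
    fix u i assume u: "u \<in> mutables S.\<Delta>'" and i: "i \<in> verts R.Q'"
    have u': "u \<in> mutables \<Delta> - us" "u \<notin> vs" "i \<in> verts Q"
      using u i S.vs by (auto simp: nodes R.remove_vertex_simps)
    \<comment> \<open>A vertex that remains mutable has no arrows to or from \<open>vs\<close>, so
      deleting \<open>vs\<close> drops only zero summands.\<close>
    have eq: "(\<Sum>v\<in>nodes S.\<Delta>'. int (narrows S.\<Delta>' v u) * \<sigma> v i) = (\<Sum>v\<in>nodes \<Delta>. int (narrows \<Delta> v u) * \<sigma> v i)"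
      "(\<Sum>v\<in>nodes S.\<Delta>'. int (narrows S.\<Delta>' u v) * \<sigma> v i) = (\<Sum>v\<in>nodes \<Delta>. int (narrows \<Delta> u v) * \<sigma> v i)"
      using u' S.unattached[OF u'(1)] S.fin unfolding nodes
      by (auto intro!: sum.mono_neutral_cong_left simp: delete_freeze_def)
    show "(\<Sum>v\<in>nodes S.\<Delta>'. int (narrows S.\<Delta>' v u) * \<sigma> v i) = (\<Sum>w\<in>nodes S.\<Delta>'. int (narrows S.\<Delta>' u w) * \<sigma> w i)"
      using config u' unfolding eq weight_config_def by blast
  qed
  moreover have "\<forall>v\<in>nodes S.\<Delta>'. \<forall>i\<in>verts R.Q'. \<beta> i = 0 \<longrightarrow> \<sigma> v i = 0"
    using trivial by (auto simp: nodes R.remove_vertex_simps)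
  moreover have "(\<lambda>N\<in>Rep R.Q' \<beta>. \<phi> (\<iota> c) (s N)) = (\<lambda>N\<in>Rep R.Q' \<beta>. c)" for c
    using R.section_Rep[OF s] by (auto simp: \<phi>_const)
  moreover have "(\<lambda>N\<in>Rep R.Q' \<beta>. \<phi> (x v) (s N)) \<in> SI_weight R.Q' \<beta> (\<sigma> v)" if "v \<in> nodes S.\<Delta>'" for v
    using R.SI_weight_section[OF s \<phi>_weight \<sigma>_zero] that by (simp add: nodes)
  ultimately show ?thesis
    unfolding naturally_graded_UCA_def
    by (intro conjI bexI[OF _ section_ring_iso[OF s]]) auto
qed

end

text \<open>
  Only \<open>vs\<close> contributes to the \<open>r\<close>-coordinate of the weight condition at \<open>u\<close>, and it contributes
  with one sign.
\<close>

lemma attached_two_sided: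
  assumes config: "weight_config I \<Delta> \<sigma>" and r: "r \<in> I" and vs: "vs \<subseteq> nodes \<Delta>" and fin: "finite (nodes \<Delta>)"
    and zero: "\<And>v. v \<in> nodes \<Delta> - vs \<Longrightarrow> \<sigma> v r = 0"
    and sign: "(\<forall>v\<in>vs. \<sigma> v r < 0) \<or> (\<forall>v\<in>vs. \<sigma> v r > 0)"
    and u: "u \<in> attached \<Delta> vs"
  shows "(\<exists>v\<in>vs. narrows \<Delta> u v > 0) \<and> (\<exists>v\<in>vs. narrows \<Delta> v u > 0)"
proof -
  have fin_vs: "finite vs" using fin vs by (rule rev_finite_subset)
  have restrict: "(\<Sum>v\<in>nodes \<Delta>. int (m v) * \<sigma> v r) = (\<Sum>v\<in>vs. int (m v) * \<sigma> v r)" for m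
    using zero fin vs by (intro sum.mono_neutral_right) auto
  have "(\<Sum>v\<in>nodes \<Delta>. int (narrows \<Delta> v u) * \<sigma> v r) = (\<Sum>v\<in>nodes \<Delta>. int (narrows \<Delta> u v) * \<sigma> v r)"
    using config r u unfolding weight_config_def attached_def by blast
  then have eq: "(\<Sum>v\<in>vs. int (narrows \<Delta> v u) * \<sigma> v r) = (\<Sum>v\<in>vs. int (narrows \<Delta> u v) * \<sigma> v r)"
    by (simp add: restrict)
  have nonzero: "(\<Sum>v\<in>vs. int (m v) * \<sigma> v r) = 0 \<longleftrightarrow> (\<forall>v\<in>vs. m v = 0)" for m
    using sign
  proof
    assume neg: "\<forall>v\<in>vs. \<sigma> v r < 0"
    have "(\<Sum>v\<in>vs. int (m v) * \<sigma> v r) = 0 \<longleftrightarrow> (\<Sum>v\<in>vs. int (m v) * (- \<sigma> v r)) = 0"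
      by (simp add: sum_negf)
    moreover have "(\<Sum>v\<in>vs. int (m v) * (- \<sigma> v r)) = 0 \<longleftrightarrow> (\<forall>v\<in>vs. int (m v) * (- \<sigma> v r) = 0)"
      using neg by (intro sum_nonneg_eq_0_iff[OF fin_vs] mult_nonneg_nonneg) (auto simp: less_imp_le)
    moreover have "\<forall>v\<in>vs. \<sigma> v r \<noteq> 0" using neg by fastforce
    ultimately show ?thesis by auto
  next
    assume pos: "\<forall>v\<in>vs. \<sigma> v r > 0"
    have "(\<Sum>v\<in>vs. int (m v) * \<sigma> v r) = 0 \<longleftrightarrow> (\<forall>v\<in>vs. int (m v) * \<sigma> v r = 0)"
      using pos by (intro sum_nonneg_eq_0_iff[OF fin_vs] mult_nonneg_nonneg) (auto simp: less_imp_le)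
    moreover have "\<forall>v\<in>vs. \<sigma> v r \<noteq> 0" using pos by fastforce
    ultimately show ?thesis by auto
  qed
  have "(\<exists>v\<in>vs. narrows \<Delta> u v > 0) \<or> (\<exists>v\<in>vs. narrows \<Delta> v u > 0)"
    using u by (auto simp: attached_def)
  then show ?thesis using eq nonzero[of "narrows \<Delta> u"] nonzero[of "\<lambda>v. narrows \<Delta> v u"] by (metis neq0_conv)
qed

theorem theorem0p2:
  fixes \<iota> :: "'k::{alg_closed_field, field_char_0} \<Rightarrow> 'f::field"
    and Q :: "('q, 'a) pre_digraph"
    and \<beta> :: "'q \<Rightarrow> nat"
    and \<Delta> :: "'v::linorder ice_quiver"
    and x :: "'v \<Rightarrow> 'f"
    and \<sigma> :: "'v \<Rightarrow> 'q \<Rightarrow> int"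
    and r :: 'q
    and vs :: "'v set"
  assumes "field_hom \<iota>"
    and "acyclic_quiver Q"
    and "naturally_graded_UCA Q \<beta> \<iota> \<Delta> x \<sigma>"
    and "full_rank \<Delta>"
    and "r \<in> verts Q"
    and "min (\<Sum>a | a \<in> arcs Q \<and> head Q a = r. \<beta> (tail Q a))
             (\<Sum>b | b \<in> arcs Q \<and> tail Q b = r. \<beta> (head Q b)) \<le> \<beta> r"
    and "vs \<subseteq> nodes \<Delta> - mutables \<Delta>"
    and "\<And>v. v \<in> nodes \<Delta> - vs \<Longrightarrow> \<sigma> v r = 0"
    and "(\<forall>v\<in>vs. \<sigma> v r < 0) \<or> (\<forall>v\<in>vs. \<sigma> v r > 0)"
  shows "naturally_graded_UCA (remove_vertex Q r) \<beta> \<iota>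
           (delete_freeze \<Delta> vs (attached \<Delta> vs)) x \<sigma>"
proof -
  have seed: "is_seed \<iota> \<Delta> x" and config: "weight_config (verts Q) \<Delta> \<sigma>"
    and trivial: "\<And>v i. v \<in> nodes \<Delta> \<Longrightarrow> i \<in> verts Q \<Longrightarrow> \<beta> i = 0 \<Longrightarrow> \<sigma> v i = 0"
    using assms(3) by (auto simp: naturally_graded_UCA_def)
  obtain \<phi> where \<phi>: "\<phi> \<in> ring_iso (UCA \<iota> \<Delta> x) (SI Q \<beta>)" "\<And>c. \<phi> (\<iota> c) = (\<lambda>M\<in>Rep Q \<beta>. c)"
    "\<And>v. v \<in> nodes \<Delta> \<Longrightarrow> \<phi> (x v) \<in> SI_weight Q \<beta> (\<sigma> v)"
    using assms(3) unfolding naturally_graded_UCA_def by blast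
  have ice: "is_ice_quiver \<Delta>" and fin: "finite (nodes \<Delta>)"
    using seed by (auto simp: is_seed_def is_ice_quiver_def)
  have vs_nodes: "vs \<subseteq> nodes \<Delta>" using assms(7) by blast
  interpret S: seed \<iota> \<Delta> x
    using laurent_if_alg_independent[OF assms(1) fin, of x] seed ice
    by (simp add: seed_def seed_axioms_def is_seed_def)
  have fd: "frozen_deletion \<iota> \<Delta> x vs (attached \<Delta> vs)"
    using attached_two_sided[OF config assms(5) vs_nodes fin assms(8,9)] assms(7) S.seed_axioms
    by (simp add: frozen_deletion_def frozen_deletion_axioms_def)
  have vr: "vertex_removal Q r"
    unfolding vertex_removal_def vertex_removal_axioms_def
    using assms(2,5) acyclic_quiver_noloop[OF assms(2)] by (metis acyclic_quiver_def)
  interpret graded_vertex_removal \<iota> \<Delta> x vs "attached \<Delta> vs" Q r \<beta> \<sigma> \<phi>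
    by (intro graded_vertex_removal.intro graded_vertex_removal_axioms.intro fd vr
        rows_independent_if_full_rank[OF ice assms(4)] \<phi> assms(8,9) trivial assms(5))
  obtain s :: "('a + 'a \<times> 'a \<Rightarrow> 'k mat) \<Rightarrow> 'a \<Rightarrow> 'k mat" where "R.is_section s"
    using R.section_exists[OF assms(6)] by blast
  then show ?thesis by (rule naturally_graded_deleted[OF _ seed config trivial])
qed

end
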